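(* Let $\Gamma$ be a countably infinite discrete group which is not virtually cyclic. If $f\in\mathbb{Z}\Gamma$ satisfies $$\{v\in\ell^2(\Gamma,\mathbb{R}): v\cdot f=0\}=\{0\},$$ then the principal algebraic action $\alpha_f$ of $\Gamma$ on $X_f$ is ergodic with respect to the normalized Haar measure of $X_f$.
   Context: $\mathbb{Z}\Gamma$ is the integral group ring of $\Gamma$. For $v\in\ell^2(\Gamma,\mathbb{R})$ and $f=\sum_\gamma f_\gamma\cdot\gamma\in\mathbb{Z}\Gamma$, the convolution $v\cdot f\in\ell^2(\Gamma,\mathbb{R})$ is $(v\cdot f)_\gamma=\sum_{\gamma'\in\Gamma}v_{\gamma'}f_{\gamma'^{-1}\gamma}$ (right multiplication by $f$). Let $\mathbb{T}=\mathbb{R}/\mathbb{Z}$. On $\mathbb{T}^\Gamma$ define $(\lambda^\gamma x)_{\gamma'}=x_{\gamma^{-1}\gamma'}$ and $(\rho^\gamma x)_{\gamma'}=x_{\gamma'\gamma}$, and $\rho^f=\sum_\gamma f_\gamma\rho^\gamma$. Set $X_f=\ker\rho^f\subset\mathbb{T}^\Gamma$ (the Pontryagin dual of $\mathbb{Z}\Gamma/\mathbb{Z}\Gamma f$); the principal algebraic $\Gamma$-action $\alpha_f$ is the restriction of $\lambda$ to $X_f$. A group is virtually cyclic if it has a cyclic subgroup of finite index. *)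

theory Defs
  imports "HOL-Probability.Probability"
begin

text \<open>The group \<Gamma> is a type of class group_add (NOT assumed commutative);
  the group operation is written +, the identity 0, inverses -g.
  The circle T = R/Z is modelled by the unit circle in C via t |-> exp(2 pi i t),
  so T^Gamma is the set of functions 'g => complex with unit-modulus values,
  carrying the product topology; additive T-notation becomes multiplicative.\<close>

definition group_ring :: "('g \<Rightarrow> int) set" where
  "group_ring = {f. finite {g. f g \<noteq> 0}}"

definition ell2 :: "('g \<Rightarrow> real) set" where
  "ell2 = {v. (\<lambda>g. (v g)\<^sup>2) summable_on UNIV}"

definition conv :: "('g::group_add \<Rightarrow> real) \<Rightarrow> ('g \<Rightarrow> int) \<Rightarrow> 'g \<Rightarrow> real" where
  "conv v f g = (\<Sum>\<^sub>\<infinity>g'. v g' * of_int (f (- g' + g)))"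

definition torus_pow :: "('g \<Rightarrow> complex) set" where
  "torus_pow = {x. \<forall>g. cmod (x g) = 1}"

definition rho :: "('g::group_add \<Rightarrow> int) \<Rightarrow> ('g \<Rightarrow> complex) \<Rightarrow> 'g \<Rightarrow> complex" where
  "rho f x g' = (\<Prod>g\<in>{g. f g \<noteq> 0}. x (g' + g) powi f g)"

definition X_f :: "('g::group_add \<Rightarrow> int) \<Rightarrow> ('g \<Rightarrow> complex) set" where
  "X_f f = {x \<in> torus_pow. \<forall>g'. rho f x g' = 1}"

definition lshift :: "'g::group_add \<Rightarrow> ('g \<Rightarrow> 'a) \<Rightarrow> 'g \<Rightarrow> 'a" where
  "lshift g x g' = x (- g + g')"

definition normalized_haar :: "('g \<Rightarrow> complex) set \<Rightarrow> ('g \<Rightarrow> complex) measure \<Rightarrow> bool" where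
  "normalized_haar X M \<longleftrightarrow>
     space M = X \<and> sets M = sets (restrict_space borel X) \<and> prob_space M \<and>
     (\<forall>y\<in>X. \<forall>A\<in>sets M. emeasure M ((\<lambda>x. \<lambda>g. x g * y g) ` A) = emeasure M A)"

definition ergodic_shift :: "('g::group_add \<Rightarrow> 'a) measure \<Rightarrow> bool" where
  "ergodic_shift M \<longleftrightarrow>
     (\<forall>g. lshift g \<in> M \<rightarrow>\<^sub>M M \<and> distr M M (lshift g) = M) \<and>
     (\<forall>A\<in>sets M. (\<forall>g. lshift g ` A = A) \<longrightarrow> emeasure M A = 0 \<or> emeasure M A = 1)"

definition cyclic_subgroup :: "'g::group_add \<Rightarrow> 'g set" where
  "cyclic_subgroup g = {x. \<exists>n. x = (((+) g) ^^ n) 0 \<or> x = (((+) (- g)) ^^ n) 0}"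

definition virtually_cyclic :: "'g::group_add itself \<Rightarrow> bool" where
  "virtually_cyclic _ \<longleftrightarrow> (\<exists>g::'g. finite {((+) a) ` cyclic_subgroup g | a. True})"

end

(*
  By Fourier analysis on X_f, an invariant set of measure strictly between 0 and 1 yields a nontrivial
  character with a finite orbit: an element h of Z[Gamma] outside Z[Gamma] f and a subgroup L of finite
  index with (g - 1) h = c(g) f for g in L.  Injectivity of f makes c : L -> Z[Gamma] a cocycle, and it
  suffices to find v vanishing at infinity with (g - 1) v = c(g) on L: then v is integer-valued because
  L is infinite, and h = v f.

  If L contains a, b and there is a nonempty set Y with Y + a and Y + b disjoint subsets of Y, then a
  and b generate a free semigroup, hence a binary tree, and the random walk on any finite subset S of L
  containing a and b is transient: |u(x)|^2 is bounded by the Dirichlet energy of u.  Projecting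
  c restricted to S onto the closure of the gradients gives a potential v vanishing at infinity with
  divergence-free remainder r in l^2.  Then h - v f is harmonic and vanishes at infinity, so it is 0,
  so r f = 0 and r = 0 by injectivity.

  Otherwise let H be a finitely generated infinite subgroup of L.  Either c is a coboundary on H, or a
  level set of c is an almost invariant subset of L that cuts H into two infinite pieces; comparing its
  right translates produces a pair a, b as above or shows that L, hence Gamma, is virtually cyclic.
  If there is no such H, then L is locally finite and h = v f is solved by linear algebra on a finite set.
*)

theory Submission
  imports Defs "HOL-Library.Function_Algebras"
begin

section \<open>Group theory: cuts and free semigroups\<close>

text \<open>The hypothesis on the group enters through its ends. For the integers and
  \<open>f\<close> = u - 1, with u a generator, \<open>f\<close> is injective on l^2, but
  \<open>X_f\<close> consists of constant points and the action is trivial: for h = 1 the cocycle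
  value c(u) is a point mass, and its potential is a step function, which cannot be made to vanish
  at both ends. The task is thus to normalize a potential to 0 at all ends at once. With a ping-pong
  pair the energy controls the sup norm, so a potential in c_0 exists whatever the number of ends;
  the price is a remainder that is only in l^2, and this is what injectivity on l^2 removes. Without
  such a pair a potential is read off from the values of c at infinity: a single limit can be
  subtracted, two different limits give a cut. The split is on the existence of a ping-pong pair and
  not on the number of ends. As \<open>L\<close> may be infinitely generated, potentials are found
  on finite sets and glued by their uniqueness on an infinite subgroup.\<close>

lemmas group_add_normalize = diff_conv_add_uminus minus_add add.assoc

section \<open>Integer multiples in a group that need not be commutative\<close>

definition zmul :: "int \<Rightarrow> 'g::group_add \<Rightarrow> 'g" where
  "zmul k g = (if 0 \<le> k then (((+) g) ^^ nat k) 0 else (((+) (- g)) ^^ nat (- k)) 0)"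

lemma zmul_0 [simp]: "zmul 0 g = 0"
  by (simp add: zmul_def)

lemma zmul_Suc: "zmul (k + 1) g = g + zmul k g"
proof (cases "0 \<le> k")
  case True
  then have "nat (k + 1) = Suc (nat k)" by simp
  with True show ?thesis by (simp add: zmul_def)
next
  case False
  then obtain n where k: "k = - int (Suc n)"
    by (metis add.inverse_inverse int_cases not_le of_nat_0_le_iff)
  have "nat (int n + 1) = Suc n" by simp
  then show ?thesis unfolding k by (cases n) (auto simp: zmul_def nat_add_distrib)
qed

lemma zmul_1 [simp]: "zmul 1 g = g"
  using zmul_Suc[of 0 g] by simp

lemma zmul_pred: "zmul (k - 1) g = - g + zmul k g"
  using zmul_Suc[of "k - 1" g] by simp

lemma zmul_add: "zmul (a + b) g = zmul a g + zmul b g"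
proof (induction a rule: int_induct[where k = 0])
  case (step1 i)
  have "zmul (i + 1 + b) g = g + zmul (i + b) g"
    using zmul_Suc[of "i + b" g] by (simp add: algebra_simps)
  then show ?case by (simp add: step1 zmul_Suc add.assoc)
next
  case (step2 i)
  have "zmul (i - 1 + b) g = - g + zmul (i + b) g"
    using zmul_pred[of "i + b" g] by (simp add: algebra_simps)
  then show ?case by (simp add: step2 zmul_pred add.assoc)
qed simp

lemma zmul_uminus: "zmul (- a) g = - zmul a g"
proof -
  have "zmul (- a) g + zmul a g = 0" using zmul_add[of "- a" a g] by simp
  then show ?thesis by (simp add: eq_neg_iff_add_eq_0)
qed

lemma zmul_diff: "zmul (a - b) g = zmul a g - zmul b g"
  using zmul_add[of a "- b" g] by (simp add: zmul_uminus)

lemma zmul_zmul: "zmul a (zmul b g) = zmul (a * b) g"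
proof (induction a rule: int_induct[where k = 0])
  case (step1 i)
  have "zmul ((i + 1) * b) g = zmul (b + i * b) g" by (simp add: algebra_simps)
  then show ?case using zmul_Suc[of i "zmul b g"] step1 by (simp add: zmul_add)
next
  case (step2 i)
  have "(i - 1) * b = - b + i * b" by (simp add: algebra_simps)
  then have "zmul ((i - 1) * b) g = - zmul b g + zmul (i * b) g"
    by (simp only: zmul_add zmul_uminus)
  then show ?case using zmul_pred[of i "zmul b g"] step2 by simp
qed simp

lemma zmul_conj: "- y + zmul m a + y = zmul m (- y + a + y)"
proof (induction m rule: int_induct[where k = 0])
  case (step1 i)
  then have "zmul (i + 1) (- y + a + y) = (- y + a + y) + (- y + zmul i a + y)"
    by (simp add: zmul_Suc)
  then show ?case by (simp add: zmul_Suc group_add_normalize del: add_uminus_conv_diff)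
next
  case (step2 i)
  then have "zmul (i - 1) (- y + a + y) = - (- y + a + y) + (- y + zmul i a + y)"
    by (simp add: zmul_pred)
  then show ?case
    unfolding zmul_pred by (simp add: group_add_normalize del: add_uminus_conv_diff)
qed simp

lemma zmul_in_cyclic_subgroup: "zmul k g \<in> cyclic_subgroup g"
  unfolding zmul_def cyclic_subgroup_def by auto

section \<open>Subgroups, word balls and generated subgroups\<close>

definition add_subgroup :: "'g::group_add set \<Rightarrow> bool" where
  "add_subgroup H \<longleftrightarrow> 0 \<in> H \<and> (\<forall>a\<in>H. \<forall>b\<in>H. a + b \<in> H) \<and> (\<forall>a\<in>H. - a \<in> H)"

lemma add_subgroupD:
  assumes "add_subgroup H"
  shows "0 \<in> H" "a \<in> H \<Longrightarrow> b \<in> H \<Longrightarrow> a + b \<in> H" "a \<in> H \<Longrightarrow> - a \<in> H"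
    "a \<in> H \<Longrightarrow> b \<in> H \<Longrightarrow> a - b \<in> H"
  using assms unfolding add_subgroup_def diff_conv_add_uminus by blast+

lemma add_subgroup_zmul:
  assumes "add_subgroup H" "g \<in> H"
  shows "zmul k g \<in> H"
proof (induction k rule: int_induct[where k = 0])
  case (step1 i)
  then show ?case unfolding zmul_Suc using add_subgroupD(2)[OF assms(1) assms(2)] by blast
next
  case (step2 i)
  then show ?case
    unfolding zmul_pred using add_subgroupD(2,3)[OF assms(1)] assms(2) by blast
qed (use add_subgroupD(1)[OF assms(1)] in simp)

text \<open>Letters are added on the left, so \<open>x\<close> and \<open>s + x\<close> are
  neighbours in the Cayley graph, and right translations are graph automorphisms.\<close>

primrec word_ball :: "'g::group_add set \<Rightarrow> nat \<Rightarrow> 'g set" where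
  "word_ball S 0 = {0}"
| "word_ball S (Suc n) = word_ball S n \<union> (\<Union>s\<in>S. (+) s ` word_ball S n)"

definition gen :: "'g::group_add set \<Rightarrow> 'g set" where
  "gen S = (\<Union>n. word_ball S n)"

lemma finite_word_ball: "finite S \<Longrightarrow> finite (word_ball S n)"
  by (induction n) auto

lemma word_ball_mono: "m \<le> n \<Longrightarrow> word_ball S m \<subseteq> word_ball S n"
  by (rule lift_Suc_mono_le) auto

lemma zero_in_word_ball: "0 \<in> word_ball S n"
  using word_ball_mono[of 0 n S] by auto

lemma word_ball_subset_gen: "word_ball S n \<subseteq> gen S"
  unfolding gen_def by blast

lemma gen_step: "s \<in> S \<Longrightarrow> x \<in> gen S \<Longrightarrow> s + x \<in> gen S"
proof -
  assume s: "s \<in> S" and "x \<in> gen S"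
  then obtain n where "x \<in> word_ball S n" unfolding gen_def by auto
  then have "s + x \<in> word_ball S (Suc n)" using s by auto
  then show ?thesis using word_ball_subset_gen by blast
qed

lemma finite_subset_word_ball:
  assumes "finite B" "B \<subseteq> gen S"
  obtains n where "B \<subseteq> word_ball S n"
proof -
  have "\<exists>n. B \<subseteq> word_ball S n" using assms
  proof (induction B)
    case (insert b B)
    then obtain m n where "B \<subseteq> word_ball S m" "b \<in> word_ball S n"
      unfolding gen_def by auto
    then have "insert b B \<subseteq> word_ball S (max m n)"
      using word_ball_mono[of m "max m n" S] word_ball_mono[of n "max m n" S] by auto
    then show ?case by blast
  qed simp
  then show ?thesis using that by blast
qed

lemma gen_induct [consumes 1, case_names zero step]:
  assumes "x \<in> gen S" "P 0" "\<And>s y. s \<in> S \<Longrightarrow> y \<in> gen S \<Longrightarrow> P y \<Longrightarrow> P (s + y)"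
  shows "P x"
proof -
  have "\<forall>x\<in>word_ball S n. P x" for n
  proof (induction n)
    case (Suc n)
    then show ?case using assms(3) word_ball_subset_gen[of S n] by auto
  qed (use assms(2) in auto)
  then show ?thesis using assms(1) unfolding gen_def by auto
qed

lemma gen_subset: "S \<subseteq> gen S"
proof
  fix s assume "s \<in> S"
  then have "s + 0 \<in> word_ball S (Suc 0)" by force
  then show "s \<in> gen S" using word_ball_subset_gen[of S "Suc 0"] by auto
qed

lemma add_subgroup_gen:
  assumes "\<forall>s\<in>S. - s \<in> S"
  shows "add_subgroup (gen S)"
proof -
  have z: "0 \<in> gen S" using zero_in_word_ball word_ball_subset_gen by blast
  have add: "a + b \<in> gen S" if "a \<in> gen S" "b \<in> gen S" for a b
    using that(1) by (induction rule: gen_induct) (auto simp: that(2) add.assoc gen_step)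
  have "- a \<in> gen S" if "a \<in> gen S" for a
    using that
  proof (induction rule: gen_induct)
    case (step s y)
    then have "- y + - s \<in> gen S" using add gen_subset assms by blast
    then show ?case by (simp add: minus_add del: add_uminus_conv_diff)
  qed (simp add: z)
  then show ?thesis unfolding add_subgroup_def using z add by blast
qed

lemma gen_least:
  assumes "add_subgroup H" "S \<subseteq> H"
  shows "gen S \<subseteq> H"
proof
  fix x assume "x \<in> gen S"
  then show "x \<in> H"
    by (induction rule: gen_induct) (use assms add_subgroupD[OF assms(1)] in auto)
qed

lemma gen_mono: "S \<subseteq> T \<Longrightarrow> gen S \<subseteq> gen T"
proof
  fix x assume "S \<subseteq> T" "x \<in> gen S"
  then show "x \<in> gen T"
    by (induction rule: gen_induct[OF \<open>x \<in> gen S\<close>])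
      (use zero_in_word_ball word_ball_subset_gen gen_step in blast)+
qed

text \<open>Each point of a ball is reached from 0 by a path inside the ball. All uses of
  connectedness below go through this statement, so paths never appear explicitly.\<close>

lemma word_ball_const:
  assumes "\<And>x s. x \<in> word_ball S n \<Longrightarrow> s \<in> S \<Longrightarrow> P (s + x) = P x" "x \<in> word_ball S n"
  shows "P x = P 0"
  using assms
proof (induction n arbitrary: x)
  case (Suc n)
  then have IH: "\<And>y. y \<in> word_ball S n \<Longrightarrow> P y = P 0" by auto
  show ?case
    using Suc.prems(2) IH Suc.prems(1) by auto
qed simp

section \<open>Cuts of a Cayley graph and ping-pong under right translation\<close>

definition ping_pong :: "'g::group_add \<Rightarrow> 'g \<Rightarrow> bool" where
  "ping_pong a b \<longleftrightarrow> (\<exists>Y. Y \<noteq> {} \<and> (\<forall>y\<in>Y. y + a \<in> Y \<and> y + b \<in> Y) \<and>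
     (\<forall>y\<in>Y. \<forall>z\<in>Y. y + a \<noteq> z + b))"

text \<open>Enclosing the finite boundary of \<open>A\<close> in a ball makes it connected, so a
  right translate of the ball that avoids the original lies entirely on one side of the cut.\<close>

locale cut =
  fixes S :: "'g::group_add set" and A :: "'g set" and n :: nat
  assumes finS: "finite S" and symS: "\<forall>s\<in>S. - s \<in> S"
    and AS: "A \<subseteq> gen S"
    and boundary: "\<And>x s. x \<in> gen S \<Longrightarrow> s \<in> S \<Longrightarrow> (s + x \<in> A) \<noteq> (x \<in> A) \<Longrightarrow> x \<in> word_ball S n"
    and infA: "infinite A" and infA': "infinite (gen S - A)"
begin

lemma subgroup_gen: "add_subgroup (gen S)"
  by (rule add_subgroup_gen) (rule symS)

lemmas genD = add_subgroupD[OF subgroup_gen]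

lemma ball_gen: "x \<in> word_ball S m \<Longrightarrow> x \<in> gen S"
  using word_ball_subset_gen by blast

text \<open>The boundary ball and its right translate by \<open>g\<close> are disjoint, so the cut
  and its translate are nested.\<close>

definition far :: "'g \<Rightarrow> bool" where
  "far g \<longleftrightarrow> g \<in> gen S \<and> (\<forall>x\<in>word_ball S n. x + g \<notin> word_ball S n)"

lemma far_uminus: "far g \<Longrightarrow> far (- g)"
  unfolding far_def using genD(3) by (metis add.right_neutral add.assoc left_minus)

lemma finite_translates:
  assumes "finite K" "finite L"
  shows "finite {g. \<exists>x\<in>K. x + g \<in> (L::'g set)}"
proof -
  have "{g. \<exists>x\<in>K. x + g \<in> L} \<subseteq> (\<lambda>(x, y). - x + y) ` (K \<times> L)"
    by (force simp: add.assoc[symmetric])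
  then show ?thesis using assms finite_subset by blast
qed

lemma exists_avoiding:
  assumes "infinite X" "X \<subseteq> gen S" "finite L"
  obtains g where "g \<in> X" "\<And>x. x \<in> word_ball S n \<Longrightarrow> x + g \<notin> L"
proof -
  have "infinite (X - {g. \<exists>x\<in>word_ball S n. x + g \<in> L})"
    using assms finite_translates[OF finite_word_ball[OF finS] assms(3)] by (simp add: Diff_infinite_finite)
  then have "X - {g. \<exists>x\<in>word_ball S n. x + g \<in> L} \<noteq> {}" by (metis finite.emptyI)
  then show ?thesis using that by blast
qed

text \<open>The translated ball is connected, contains \<open>g\<close>, and no boundary edge starts
  in it.\<close>

lemma far_side_translate:
  assumes "far g" "x \<in> word_ball S n"
  shows "(x + g \<in> A) = (g \<in> A)"
proof -
  have "(x + g \<in> A) = (0 + g \<in> A)"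
  proof (rule word_ball_const[OF _ assms(2), where P = "\<lambda>x. x + g \<in> A"])
    fix x s assume x: "x \<in> word_ball S n" "s \<in> S"
    then have "x + g \<notin> word_ball S n" "x + g \<in> gen S"
      using assms(1) ball_gen genD(2) unfolding far_def by auto
    then show "(s + x + g \<in> A) = (x + g \<in> A)"
      using boundary[of "x + g" s] x(2) by (auto simp: add.assoc)
  qed
  then show ?thesis by simp
qed

text \<open>With \<open>far_side_translate\<close>: for far \<open>g\<close>, \<open>A\<close> or its complement contains \<open>A + g\<close> or
  the complement of \<open>A + g\<close>.\<close>

lemma far_side_complement:
  assumes g: "far g" and x: "x \<in> gen S" "(x \<in> A) \<noteq> (g \<in> A)"
  shows "(x - g \<in> A) = (- g \<in> A)"
proof -
  have K: "(x - g \<in> A) = (- g \<in> A)" if "x \<in> word_ball S n" for x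
    using far_side_translate[OF far_uminus[OF g] that] by simp
  \<comment> \<open>Walk from \<open>x\<close> back towards 0. Outside the ball neither the walk nor
    its translate by \<open>- g\<close> crosses the cut; in the ball, which contains 0,
    \<open>K\<close> decides.\<close>
  show ?thesis
    using x
  proof (induction rule: gen_induct)
    case zero
    then show ?case using K zero_in_word_ball by blast
  next
    case (step s y)
    show ?case
    proof (cases "s + y \<in> word_ball S n")
      case True
      then show ?thesis using K by blast
    next
      case False
      have gS: "g \<in> gen S" using g unfolding far_def by blast
      have mem: "s + y \<in> gen S" using step gen_step by blast
      have 1: "(y \<in> A) = (s + y \<in> A)"
        using boundary[OF mem symS[rule_format, OF step(1)]] False by auto
      \<comment> \<open>Otherwise \<open>s + y\<close> would lie in the translated ball, hence on
        the side of \<open>g\<close>, against the premise.\<close>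
      have "s + y - g \<notin> word_ball S n"
        using far_side_translate[OF g, of "s + y - g"] step(4) by auto
      moreover have "s + y - g \<in> gen S" using genD(4) mem gS by blast
      moreover have "- s + (s + y - g) = y - g"
        by (simp add: group_add_normalize del: add_uminus_conv_diff)
      ultimately have "(y - g \<in> A) = (s + y - g \<in> A)"
        using boundary[of "s + y - g" "- s"] symS[rule_format, OF step(1)] by auto
      then show ?thesis using step.IH step.prems 1 by auto
    qed
  qed
qed

lemma far_in:
  assumes "infinite X" "X \<subseteq> gen S"
  obtains g where "g \<in> X" "far g"
proof -
  obtain g where "g \<in> X" "\<And>x. x \<in> word_ball S n \<Longrightarrow> x + g \<notin> word_ball S n"
    using exists_avoiding[OF assms finite_word_ball[OF finS, of n]] by blast
  then show ?thesis using that[of g] assms(2) unfolding far_def by blast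
qed

text \<open>A far element either yields a translation of \<open>A\<close> into itself, possibly
  after inversion, or maps one side of the cut into the other like a reflection. If a far
  \<open>g\<close> in \<open>A\<close> and a far \<open>h\<close> outside \<open>A\<close> both act
  as reflections, their composite \<open>h + g\<close> is a translation.\<close>

lemma translation:
  obtains t where "t \<in> gen S" "t \<in> A" "- t \<notin> A" "\<And>y. y \<in> A \<Longrightarrow> y + t \<in> A"
proof -
  obtain g where g: "g \<in> A" "far g" using far_in[OF infA AS] by blast
  obtain h where h: "h \<in> gen S" "h \<notin> A" "far h" using far_in[OF infA'] by blast
  have gS: "g \<in> gen S" using g AS by blast
  note obtained = that
  have trans: ?thesis if t: "far t" "t \<in> A" "- t \<notin> A" for t
  proof (rule obtained[of t])
    show tS: "t \<in> gen S" using t AS by blast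
    fix y assume y: "y \<in> A"
    \<comment> \<open>If \<open>y + t\<close> were on the side opposite to \<open>t\<close>, then
      \<open>y\<close> would be on the side of \<open>- t\<close>, which is outside
      \<open>A\<close>.\<close>
    show "y + t \<in> A"
      using far_side_complement[OF t(1), of "y + t"] genD(2)[of y t] y AS t tS by auto
  qed (use t in auto)
  consider "- g \<notin> A" | "- h \<in> A" | "- g \<in> A" "- h \<notin> A" by blast
  then show ?thesis
  proof cases
    case 1 then show ?thesis using trans g by blast
  next
    case 2 then show ?thesis using trans[OF far_uminus[OF h(3)]] h by simp
  next
    case 3
    have G: "y + g \<in> A" if "y \<in> gen S" "y \<notin> A" for y
      using far_side_complement[OF far_uminus[OF g(2)], of y] that 3 g by auto
    have H: "x + h \<notin> A" "x - h \<notin> A" if "x \<in> A" for x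
      using far_side_complement[OF far_uminus[OF h(3)], of x] far_side_complement[OF h(3), of x]
        that 3 h AS by auto
    show ?thesis
    proof (rule that[of "h + g"])
      show "h + g \<in> gen S" using genD(2) h gS by blast
      show "h + g \<in> A" using G h by blast
      show "- (h + g) \<notin> A" using H(2)[OF 3(1)] by (simp add: minus_add)
      fix y assume "y \<in> A"
      then show "y + (h + g) \<in> A"
        using G[of "y + h"] H(1)[of y] genD(2)[of y h] h AS by (auto simp: add.assoc)
    qed
  qed
qed

text \<open>An infinite strip between \<open>A + t\<close> and the complement of \<open>A\<close>
  has room for a translate of the boundary ball by some \<open>g\<close>. The complement of
  \<open>A\<close> and the set \<open>A + t\<close> then lie on the same side of the cut translated
  by \<open>g\<close>, so the other side fits into the strip. If that is \<open>A + g\<close>, then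
  \<open>t\<close> and \<open>g\<close> play ping-pong on \<open>A\<close>; if it is the translated
  complement, a further shift by \<open>- t\<close> makes \<open>- t\<close> and
  \<open>g - t\<close> play on the complement.\<close>

lemma ping_pong_or_finite:
  assumes t: "t \<in> gen S" "\<And>y. y \<in> A \<Longrightarrow> y + t \<in> A" and inf: "infinite {x \<in> A. x - t \<notin> A}"
  shows "\<exists>a\<in>gen S. \<exists>b\<in>gen S. ping_pong a b"
proof -
  let ?K = "word_ball S n"
  have "finite (?K \<union> (\<lambda>x. x + t) ` ?K)" "?K \<union> (\<lambda>x. x + t) ` ?K \<subseteq> gen S"
    using finite_word_ball[OF finS] genD(2) t(1) ball_gen by auto
  \<comment> \<open>The larger ball also contains \<open>K + t\<close>, where \<open>K\<close> is
    the boundary ball. Keeping \<open>K + g\<close> away from it therefore makes both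
    \<open>g\<close> and \<open>g - t\<close> far.\<close>
  then obtain m where m: "?K \<union> (\<lambda>x. x + t) ` ?K \<subseteq> word_ball S m"
    by (metis finite_subset_word_ball)
  obtain g where g: "g \<in> A" "g - t \<notin> A" and av: "\<And>x. x \<in> ?K \<Longrightarrow> x + g \<notin> word_ball S m"
    using exists_avoiding[OF inf _ finite_word_ball[OF finS, of m]] AS by (metis (lifting) mem_Collect_eq subset_iff)
  have gS: "g \<in> gen S" using g AS by blast
  have far1: "far g" unfolding far_def using gS av m by blast
  have far2: "far (g - t)" unfolding far_def
  proof safe
    show "g - t \<in> gen S" using gS t genD(4) by blast
    fix x assume x: "x \<in> ?K" "x + (g - t) \<in> ?K"
    then have "x + (g - t) + t \<in> word_ball S m" using m by blast
    then show False using av[OF x(1)] by (simp add: group_add_normalize del: add_uminus_conv_diff)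
  qed
  \<comment> \<open>The larger ball moved by \<open>- g\<close> misses the boundary ball, since
    \<open>K + g\<close> misses the larger ball. As \<open>t\<close> lies in it,
    \<open>t - g\<close> and \<open>- g\<close> are on the same side.\<close>
  have 0: "(x - g \<in> A) = (0 - g \<in> A)" if "x \<in> word_ball S m" for x
  proof (rule word_ball_const[OF _ that, where P = "\<lambda>x. x - g \<in> A"])
    fix x s assume x: "x \<in> word_ball S m" "s \<in> S"
    have "x - g \<notin> ?K" using av[of "x - g"] x by auto
    moreover have "x - g \<in> gen S" using x gS ball_gen genD(4) by blast
    ultimately show "(s + x - g \<in> A) = (x - g \<in> A)"
      using boundary[of "x - g" s] x(2) by (auto simp: add_diff_eq)
  qed
  have "t \<in> word_ball S m" using m zero_in_word_ball[of S n] by force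
  then have sides: "(t - g \<in> A) = (- g \<in> A)" using 0 by simp
  have 1: "(x - g \<in> A) = (- g \<in> A)" if "x \<in> gen S" "x \<notin> A" for x
    using far_side_complement[OF far1 that(1)] that g by blast
  have 2: "(x + t - g \<in> A) = (- g \<in> A)" if "x \<in> A" for x
    using far_side_complement[OF far2, of x] that g AS sides
    by (auto simp: group_add_normalize simp del: add_uminus_conv_diff)
  have g1: "y + g \<in> gen S" if "y \<in> gen S" for y using that gS genD(2) by blast
  show ?thesis
  proof (cases "- g \<in> A")
    case False
    have "ping_pong t g" unfolding ping_pong_def
    proof (intro exI[of _ A] conjI ballI)
      show "A \<noteq> {}" using g by blast
      fix y assume y: "y \<in> A"
      show "y + t \<in> A" using t y by blast
      show "y + g \<in> A" using 1[of "y + g"] g1[of y] False y AS by auto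
      fix z assume z: "z \<in> A"
      show "y + t \<noteq> z + g" using 2[OF y] False z by (metis add_diff_cancel)
    qed
    then show ?thesis using t gS by blast
  next
    case True
    have "ping_pong (- t) (g - t)" unfolding ping_pong_def
    proof (intro exI[of _ "gen S - A"] conjI ballI)
      show "gen S - A \<noteq> {}" using infA' by (metis finite.emptyI)
      fix y assume y: "y \<in> gen S - A"
      have "y - t \<in> gen S" using y t genD(4) by blast
      moreover have "y - t \<notin> A" using t(2)[of "y - t"] y by auto
      ultimately show "y + - t \<in> gen S - A" by simp
      have "y + (g - t) \<in> gen S" using y genD(2)[of y "g - t"] genD(4)[OF gS t(1)] by blast
      moreover have "y + (g - t) \<notin> A"
        using 2[of "y + (g - t)"] True y
        by (auto simp: group_add_normalize simp del: add_uminus_conv_diff)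
      ultimately show "y + (g - t) \<in> gen S - A" by simp
      fix z assume z: "z \<in> gen S - A"
      have "z + g \<in> A" using 1[of "z + g"] g1[of z] True z by auto
      moreover have "z + g = y" if "y + - t = z + (g - t)"
        using that by (metis add_diff_eq add_uminus_conv_diff diff_add_cancel)
      ultimately show "y + - t \<noteq> z + (g - t)" using y by blast
    qed
    then show ?thesis using genD(3)[OF t(1)] genD(4)[OF gS t(1)] by blast
  qed
qed

end

lemma translation_multiples:
  assumes "t \<in> A" "- t \<notin> A" "\<forall>y\<in>A. y + t \<in> A" "0 < (k::int)"
  shows "zmul k t \<in> A" "zmul (- k) t \<notin> A"
proof -
  have "zmul k t \<in> A \<and> zmul (- k) t \<notin> A"
    using assms(4)
  proof (induction k rule: int_gr_induct)
    case base
    then show ?case using assms by (simp add: zmul_uminus)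
  next
    case (step i)
    have "zmul (i + 1) t = zmul i t + t" by (simp add: zmul_add)
    moreover have "zmul (- (i + 1)) t + t = zmul (- i) t"
      using zmul_add[of "- (i + 1)" 1 t] by simp
    ultimately show ?case using step assms(3) by metis
  qed
  then show "zmul k t \<in> A" "zmul (- k) t \<notin> A" by auto
qed

lemma translation_inj:
  assumes "t \<in> A" "- t \<notin> A" "\<forall>y\<in>A. y + t \<in> A"
  shows "inj (\<lambda>k. zmul k t)"
proof (rule injI, rule ccontr)
  fix k l assume kl: "zmul k t = zmul l t" "k \<noteq> l"
  have "zmul \<bar>k - l\<bar> t = 0" "zmul (- \<bar>k - l\<bar>) t = 0"
    using kl by (auto simp: abs_if zmul_diff zmul_uminus)
  then show False using translation_multiples[OF assms, of "\<bar>k - l\<bar>"] kl by auto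
qed

text \<open>The strip meets every orbit of right translation by \<open>t\<close>:
  \<open>x - zmul k t\<close> is in \<open>A\<close> for very negative \<open>k\<close> and outside
  for large \<open>k\<close>, so it leaves \<open>A\<close> at some step. A finite strip then makes
  \<open>gen S\<close> virtually cyclic.\<close>

lemma (in cut) finite_imp_cyclic:
  assumes t: "t \<in> gen S" "t \<in> A" "- t \<notin> A" "\<forall>y\<in>A. y + t \<in> A"
    and x: "x \<in> gen S"
  shows "\<exists>d\<in>{x \<in> A. x - t \<notin> A}. \<exists>k. x = d + zmul k t"
proof -
  note mult = translation_multiples[OF t(2,3,4)]
  obtain m where m: "x \<in> word_ball S m" using x unfolding gen_def by blast
  \<comment> \<open>The exceptional \<open>k\<close>: those for which a ball containing 0 and
    \<open>x\<close>, moved by \<open>- zmul k t\<close>, meets the boundary ball. They are finitely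
    many because the multiples of \<open>t\<close> are distinct; for all other \<open>k\<close> the
    points \<open>x - zmul k t\<close> and \<open>- zmul k t\<close> are on the same side.\<close>
  define F where "F = {k. \<exists>z\<in>word_ball S m. z - zmul k t \<in> word_ball S n}"
  have "(\<lambda>k. zmul k t) ` F \<subseteq> (\<lambda>(z, y). - y + z) ` (word_ball S m \<times> word_ball S n)"
  proof safe
    fix k assume "k \<in> F"
    then obtain z where z: "z \<in> word_ball S m" "z - zmul k t \<in> word_ball S n"
      unfolding F_def by blast
    have "zmul k t = - (z - zmul k t) + z"
      by (simp add: group_add_normalize del: add_uminus_conv_diff)
    then show "zmul k t \<in> (\<lambda>(z, y). - y + z) ` (word_ball S m \<times> word_ball S n)"
      using z by (intro image_eqI[where x = "(z, z - zmul k t)"]) auto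
  qed
  then have "finite ((\<lambda>k. zmul k t) ` F)"
    using finite_word_ball[OF finS] by (meson finite_SigmaI finite_imageI finite_subset)
  then have finF: "finite F"
    using translation_inj[OF t(2,3,4)] by (meson finite_imageD inj_on_subset subset_UNIV)
  have outside: "(x - zmul k t \<in> A) = (- zmul k t \<in> A)" if "k \<notin> F" for k
  proof -
    have "(x - zmul k t \<in> A) = (0 - zmul k t \<in> A)"
    proof (rule word_ball_const[OF _ m, where P = "\<lambda>x. x - zmul k t \<in> A"])
      fix z s assume z: "z \<in> word_ball S m" "s \<in> S"
      have "z - zmul k t \<notin> word_ball S n" using that z unfolding F_def by blast
      moreover have "z - zmul k t \<in> gen S"
        using z ball_gen t(1) genD(4) add_subgroup_zmul[OF subgroup_gen] by blast
      ultimately show "(s + z - zmul k t \<in> A) = (z - zmul k t \<in> A)"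
        using boundary[of "z - zmul k t" s] z(2) by (auto simp: add_diff_eq)
    qed
    then show ?thesis by simp
  qed
  have "bdd_above (abs ` F)" using finF by simp
  then obtain M where "\<And>k. k \<in> F \<Longrightarrow> \<bar>k\<bar> \<le> M" unfolding bdd_above_def by auto
  then have N: "\<And>k. k \<in> F \<Longrightarrow> \<bar>k\<bar> < \<bar>M\<bar> + 1" "0 < \<bar>M\<bar> + 1" by fastforce+
  define N where "N = \<bar>M\<bar> + 1"
  note N = N[folded N_def]
  have hi: "x - zmul k t \<notin> A" if "N \<le> k" for k
  proof -
    have "k \<notin> F" using N(1)[of k] that by auto
    then show ?thesis using outside mult(2)[of k] that N(2) by (auto simp: zmul_uminus)
  qed
  have lo: "x - zmul (- N) t \<in> A"
  proof -
    have "- N \<notin> F" using N(1)[of "- N"] by auto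
    then show ?thesis using outside[of "- N"] mult(1)[of N] N(2) by (simp add: zmul_uminus)
  qed
  have "\<exists>k. x - zmul k t \<in> A \<and> x - zmul (k + 1) t \<notin> A"
  proof (rule ccontr)
    assume no: "\<not> ?thesis"
    have "x - zmul k t \<in> A" if "- N \<le> k" for k
      using that by (induction k rule: int_ge_induct) (use lo no in auto)
    then show False using hi[of N] N(2) by auto
  qed
  then obtain k where k: "x - zmul k t \<in> A" "x - zmul (k + 1) t \<notin> A" by blast
  have "x - zmul k t - t = x - zmul (k + 1) t"
    by (simp add: zmul_Suc group_add_normalize del: add_uminus_conv_diff)
  then show ?thesis using k by (intro bexI[of _ "x - zmul k t"] exI[of _ k]) auto
qed

text \<open>The second alternative keeps the translation \<open>t\<close> with its action on
  \<open>A\<close>, and not virtual cyclicity alone: the passage to \<open>L\<close> has to know on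
  which side the multiples of \<open>t\<close> lie.\<close>

theorem fg_cut_dichotomy:
  fixes S :: "'g::group_add set"
  assumes "finite S" "\<forall>s\<in>S. - s \<in> S" "A \<subseteq> gen S"
    and "\<And>s. s \<in> S \<Longrightarrow> finite {x \<in> gen S. (s + x \<in> A) \<noteq> (x \<in> A)}"
    and "infinite A" "infinite (gen S - A)"
  shows "(\<exists>a\<in>gen S. \<exists>b\<in>gen S. ping_pong a b) \<or>
    (\<exists>t\<in>A. \<exists>D. - t \<notin> A \<and> (\<forall>y\<in>A. y + t \<in> A) \<and> finite D \<and> (\<forall>x\<in>gen S. \<exists>d\<in>D. \<exists>k. x = d + zmul k t))"
proof -
  have "finite (\<Union>s\<in>S. {x \<in> gen S. (s + x \<in> A) \<noteq> (x \<in> A)})" using assms by blast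
  then obtain n where n: "(\<Union>s\<in>S. {x \<in> gen S. (s + x \<in> A) \<noteq> (x \<in> A)}) \<subseteq> word_ball S n"
    by (rule finite_subset_word_ball) blast
  interpret cut S A n
    by unfold_locales (use assms n in blast)+
  obtain t where t: "t \<in> gen S" "t \<in> A" "- t \<notin> A" "\<forall>y\<in>A. y + t \<in> A"
    by (rule translation) blast
  show ?thesis
  proof (cases "finite {x \<in> A. x - t \<notin> A}")
    case True
    then show ?thesis using t finite_imp_cyclic[OF t] by (intro disjI2 bexI[OF _ t(2)] exI[of _ "{x \<in> A. x - t \<notin> A}"] conjI ballI) simp_all
  next
    case False
    then show ?thesis using ping_pong_or_finite[OF t(1)] t(4) by blast
  qed
qed


section \<open>From finitely generated subgroups to \<open>L\<close>\<close>

lemma infinite_multiples_same_remainder: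
  fixes X :: "'a set" and D :: "'g::group_add set"
  assumes "infinite X" "finite D" "\<And>x. x \<in> X \<Longrightarrow> \<exists>d\<in>D. \<exists>k. F x = d + zmul k t"
  obtains x y d k l where "x \<in> X" "y \<in> X" "x \<noteq> y" "F x = d + zmul k t" "F y = d + zmul l t"
proof -
  obtain d where d: "\<And>x. x \<in> X \<Longrightarrow> d x \<in> D \<and> (\<exists>k. F x = d x + zmul k t)"
    using assms(3) by metis
  have "\<not> inj_on d X"
    using assms(1,2) d by (metis finite_imageD finite_subset image_subsetI)
  then show ?thesis using d that unfolding inj_on_def by metis
qed

text \<open>Without a ping-pong pair every finitely generated subgroup of \<open>L\<close> that
  contains \<open>S\<close> is virtually cyclic, so it remains to see that \<open>L\<close> is
  finitely generated. Each coset \<open>gen S + y\<close> meets both sides of \<open>A\<close>;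
  walking inside it by steps of \<open>S\<close> from one side to the other passes through the
  finite boundary \<open>B\<close>. Hence \<open>S\<close> and \<open>B\<close> generate
  \<open>L\<close>.\<close>

theorem cut_dichotomy:
  fixes L :: "'g::group_add set"
  assumes L: "add_subgroup L" and AL: "A \<subseteq> L"
    and inv: "\<And>g. g \<in> L \<Longrightarrow> finite {x \<in> L. (g + x \<in> A) \<noteq> (x \<in> A)}"
    and S: "finite S" "\<forall>s\<in>S. - s \<in> S" "S \<subseteq> L"
    and inf: "infinite (gen S \<inter> A)" "infinite (gen S - A)"
  shows "(\<exists>a\<in>L. \<exists>b\<in>L. ping_pong a b) \<or>
    (\<exists>t D. finite D \<and> (\<forall>x\<in>L. \<exists>d\<in>D. \<exists>k. x = d + zmul k t))"
proof (subst disj_commute, rule disjCI)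
  assume no: "\<not> (\<exists>a\<in>L. \<exists>b\<in>L. ping_pong a b)"
  note LD = add_subgroupD[OF L]
  have dich: "\<exists>t\<in>A \<inter> gen T. \<exists>D. - t \<notin> A \<and> (\<forall>y\<in>A \<inter> gen T. y + t \<in> A) \<and> finite D \<and>
      (\<forall>x\<in>gen T. \<exists>d\<in>D. \<exists>k. x = d + zmul k t)"
    if T: "finite T" "\<forall>s\<in>T. - s \<in> T" "T \<subseteq> L" "S \<subseteq> T" for T
  proof -
    have gT: "gen S \<subseteq> gen T" "gen T \<subseteq> L" using gen_mono[OF T(4)] gen_least[OF L T(3)] by auto
    have fin: "finite {x \<in> gen T. (s + x \<in> A \<inter> gen T) \<noteq> (x \<in> A \<inter> gen T)}" if "s \<in> T" for s
      by (rule finite_subset[OF _ inv[of s]]) (use that T gT gen_step[of s T] in auto)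
    have "infinite (A \<inter> gen T)"
      by (rule infinite_super[OF _ inf(1)]) (use gT in auto)
    moreover have "infinite (gen T - A \<inter> gen T)"
      by (rule infinite_super[OF _ inf(2)]) (use gT in auto)
    ultimately have "\<exists>t\<in>A \<inter> gen T. \<exists>D. - t \<notin> A \<inter> gen T \<and> (\<forall>y\<in>A \<inter> gen T. y + t \<in> A \<inter> gen T) \<and>
        finite D \<and> (\<forall>x\<in>gen T. \<exists>d\<in>D. \<exists>k. x = d + zmul k t)"
      using fg_cut_dichotomy[OF T(1,2) _ fin] no gT(2) by blast
    moreover have "- t \<in> gen T" if "t \<in> A \<inter> gen T" for t
      using that add_subgroupD(3)[OF add_subgroup_gen[OF T(2)]] by blast
    ultimately show ?thesis by blast
  qed
  define split where "split y \<longleftrightarrow> (\<exists>d\<in>gen S. d + y \<in> A) \<and> (\<exists>d\<in>gen S. d + y \<notin> A)" for y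
  have GS: "add_subgroup (gen S)" by (rule add_subgroup_gen) (rule S(2))
  note GSD = add_subgroupD[OF GS]
  have GSL: "gen S \<subseteq> L" by (rule gen_least[OF L S(3)])
  have all_split: "split y" if y: "y \<in> L" for y
  proof -
    \<comment> \<open>In the virtually cyclic group generated by \<open>S\<close> and
      \<open>y\<close>, some \<open>zmul q t\<close> with \<open>q \<noteq> 0\<close> lies in
      \<open>gen S\<close>, and conjugation by \<open>y\<close> takes \<open>zmul j t\<close> to
      \<open>zmul p t\<close> with \<open>p \<noteq> 0\<close>. Thus
      \<open>y + zmul (i * q * p) t\<close> lies in \<open>gen S + y\<close>. By almost invariance
      under \<open>y\<close> it is, for all but finitely many \<open>i\<close>, on the same side as
      \<open>zmul (i * q * p) t\<close>, and that side depends on the sign of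
      \<open>i * q * p\<close>.\<close>
    let ?T = "insert y (insert (- y) S)"
    have T: "finite ?T" "\<forall>s\<in>?T. - s \<in> ?T" "?T \<subseteq> L" "S \<subseteq> ?T"
      using S y LD(3) by auto
    have GT: "add_subgroup (gen ?T)" by (rule add_subgroup_gen) (rule T(2))
    note GTD = add_subgroupD[OF GT]
    have yT: "y \<in> gen ?T" by (rule subsetD[OF gen_subset]) simp
    obtain t D where t: "t \<in> A" "t \<in> gen ?T" "- t \<notin> A" "\<forall>y\<in>A \<inter> gen ?T. y + t \<in> A"
      and D: "finite D" "\<forall>x\<in>gen ?T. \<exists>d\<in>D. \<exists>k. x = d + zmul k t"
      using dich[OF T] by (elim bexE exE conjE IntE) (rule that; assumption)
    have t': "t \<in> A \<inter> gen ?T" "- t \<notin> A \<inter> gen ?T" "\<forall>y\<in>A \<inter> gen ?T. y + t \<in> A \<inter> gen ?T"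
      using t GTD(2) by auto
    note mult = translation_multiples[OF t'] and inj = translation_inj[OF t']
    have zT: "zmul k t \<in> gen ?T" for k using add_subgroup_zmul[OF GT t(2)] .
    have pos: "zmul k t \<in> A" if "0 < k" for k using mult(1)[OF that] by blast
    have neg: "zmul k t \<notin> A" if "k < 0" for k using mult(2)[of "- k"] zT[of k] that by auto
    have "infinite (gen S)" using inf(1) by (meson finite_Int)
    moreover have "\<exists>d\<in>D. \<exists>k. x = d + zmul k t" if "x \<in> gen S" for x
      using D(2)[rule_format, of x] gen_mono[OF T(4)] that by blast
    ultimately obtain x1 x2 d k l where x: "x1 \<in> gen S" "x2 \<in> gen S" "x1 \<noteq> x2"
      "x1 = d + zmul k t" "x2 = d + zmul l t"
      using infinite_multiples_same_remainder[of "gen S" D "\<lambda>x. x" t] D(1) by metis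
    define q where "q = l - k"
    have q: "q \<noteq> 0" "zmul q t \<in> gen S"
    proof -
      have "- x1 + x2 = zmul q t"
        unfolding q_def x(4,5) using zmul_add[of "- k" l t]
        by (simp add: group_add_normalize zmul_uminus del: add_uminus_conv_diff)
      then show "zmul q t \<in> gen S" using GSD(2)[OF GSD(3)[OF x(1)] x(2)] by simp
      show "q \<noteq> 0" using x unfolding q_def by auto
    qed
    have "\<exists>d\<in>D. \<exists>k. - y + zmul m t + y = d + zmul k t" for m
      using D(2)[rule_format, OF GTD(2)[OF GTD(2)[OF GTD(3)[OF yT] zT[of m]] yT]] .
    then obtain m1 m2 d' k' l' where m: "m1 \<noteq> m2" "- y + zmul m1 t + y = d' + zmul k' t"
      "- y + zmul m2 t + y = d' + zmul l' t"
      using infinite_multiples_same_remainder[of "UNIV :: int set" D "\<lambda>m. - y + zmul m t + y" t] D(1)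
      by (metis infinite_UNIV_int)
    define j p where "j = m2 - m1" and "p = l' - k'"
    have "- y + zmul j t + y = - (- y + zmul m1 t + y) + (- y + zmul m2 t + y)"
      using zmul_add[of "- m1" m2 t]
      by (simp add: j_def group_add_normalize zmul_uminus del: add_uminus_conv_diff)
    also have "\<dots> = zmul p t"
      unfolding m using zmul_add[of "- k'" l' t]
      by (simp add: p_def group_add_normalize zmul_uminus del: add_uminus_conv_diff)
    finally have conj: "- y + zmul j t + y = zmul p t" .
    have p: "p \<noteq> 0"
    proof
      assume "p = 0"
      then have "zmul j t + y = y" using conj by (metis add.assoc add.right_neutral add_minus_cancel zmul_0)
      then have "zmul j t = zmul 0 t" by (metis add.left_neutral add_right_cancel zmul_0)
      then have "j = 0" using inj unfolding inj_def by blast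
      then show False using m(1) unfolding j_def by simp
    qed
    have swap: "zmul (i * q * j) t + y = y + zmul (i * q * p) t" for i
    proof -
      have "- y + zmul (i * q * j) t + y = zmul (i * q * p) t"
        using zmul_conj[of y "i * q" "zmul j t"] conj by (simp add: zmul_zmul)
      then show ?thesis by (metis add.assoc add_minus_cancel)
    qed
    have inS: "zmul (i * q * j) t \<in> gen S" for i
      using add_subgroup_zmul[OF GS q(2), of "i * j"] by (simp add: zmul_zmul ac_simps)
    have fin: "finite {i :: int. (y + zmul (i * q * p) t \<in> A) \<noteq> (zmul (i * q * p) t \<in> A)}" (is "finite ?F")
    proof (rule finite_imageD)
      show "inj_on (\<lambda>i. zmul (i * q * p) t) ?F"
        using inj p q(1) unfolding inj_on_def inj_def by fastforce
      have "gen ?T \<subseteq> L" by (rule gen_least[OF L T(3)])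
      then show "finite ((\<lambda>i. zmul (i * q * p) t) ` ?F)"
        by (intro finite_subset[OF _ inv[OF y]]) (use zT in auto)
    qed
    have "infinite {i :: int. 0 < i * (q * p)}"
    proof (cases "0 < q * p")
      case True
      then have "{i :: int. 0 < i * (q * p)} = {0<..}"
        by (simp add: set_eq_iff zero_less_mult_iff[of _ "q * p"])
      then show ?thesis by (simp add: infinite_Ioi)
    next
      case False
      then have "q * p < 0" using p q(1) by (metis linorder_neqE_linordered_idom mult_eq_0_iff)
      then have "{i :: int. 0 < i * (q * p)} = {..<0}"
        by (simp add: set_eq_iff zero_less_mult_iff[of _ "q * p"])
      then show ?thesis by (simp add: infinite_Iio)
    qed
    moreover have "bij_betw uminus {i :: int. 0 < i * (q * p)} {i. i * (q * p) < 0}"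
      by (rule bij_betw_byWitness[where f' = uminus]) auto
    ultimately have "infinite {i :: int. 0 < i * (q * p)}" "infinite {i :: int. i * (q * p) < 0}"
      using bij_betw_finite by blast+
    then obtain i1 i2 where i: "0 < i1 * (q * p)" "i1 \<notin> ?F" "i2 * (q * p) < 0" "i2 \<notin> ?F"
      using fin by (metis (no_types, lifting) finite_subset mem_Collect_eq subsetI)
    have "zmul (i1 * q * j) t + y \<in> A"
      using swap[of i1] i(1,2) pos[of "i1 * q * p"] by (simp add: mult.assoc)
    moreover have "zmul (i2 * q * j) t + y \<notin> A"
      using swap[of i2] i(3,4) neg[of "i2 * q * p"] by (simp add: mult.assoc)
    ultimately show "split y" unfolding split_def using inS by blast
  qed
  define B where "B = (\<Union>s\<in>S. {x \<in> L. (s + x \<in> A) \<noteq> (x \<in> A)})"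
  have finB: "finite B" unfolding B_def using S inv by blast
  let ?T = "S \<union> B \<union> uminus ` B"
  have T: "finite ?T" "\<forall>s\<in>?T. - s \<in> ?T" "?T \<subseteq> L" "S \<subseteq> ?T"
    using S finB LD(3) unfolding B_def by auto
  have "L \<subseteq> gen ?T"
  proof
    fix y assume y: "y \<in> L"
    have "\<exists>d\<in>gen S. d + y \<in> B"
    proof (rule ccontr)
      assume nb: "\<not> ?thesis"
      have "(d + y \<in> A) = (y \<in> A)" if "d \<in> gen S" for d
        using that
      proof (induction rule: gen_induct)
        case (step s d)
        have "d + y \<in> L" using GSL y step LD(2) by blast
        then have "(s + (d + y) \<in> A) = (d + y \<in> A)" using nb step unfolding B_def by blast
        then show ?case using step by (simp add: add.assoc)
      qed simp
      then show False using all_split[OF y] unfolding split_def by blast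
    qed
    then obtain d where d: "d \<in> gen S" "d + y \<in> B" by blast
    have GT: "add_subgroup (gen ?T)" by (rule add_subgroup_gen) (rule T(2))
    have "- d + (d + y) \<in> gen ?T"
      using add_subgroupD(2)[OF GT add_subgroupD(3)[OF GT]] d gen_mono[OF T(4)] gen_subset[of ?T]
      by blast
    then show "y \<in> gen ?T" by simp
  qed
  then show "\<exists>t D. finite D \<and> (\<forall>x\<in>L. \<exists>d\<in>D. \<exists>k. x = d + zmul k t)"
    using dich[OF T] by blast
qed

lemma virtually_cyclicI:
  fixes L :: "'g::group_add set"
  assumes "finite R" "\<And>g. \<exists>r\<in>R. - r + g \<in> L" "finite D" "\<forall>x\<in>L. \<exists>d\<in>D. \<exists>k. x = d + zmul k t"
  shows "virtually_cyclic TYPE('g)"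
proof -
  have coset: "(+) (g + zmul k t) ` cyclic_subgroup t = (+) g ` cyclic_subgroup t" for g k
  proof -
    have C: "cyclic_subgroup t = range (\<lambda>k. zmul k t)"
    proof (intro equalityI subsetI)
      fix x assume "x \<in> cyclic_subgroup t"
      then obtain n where "x = zmul (int n) t \<or> x = (((+) (- t)) ^^ n) 0"
        unfolding cyclic_subgroup_def zmul_def by auto
      moreover have "(((+) (- t)) ^^ n) 0 = zmul (- int n) t"
        by (cases "n = 0") (auto simp: zmul_def)
      ultimately show "x \<in> range (\<lambda>k. zmul k t)" by auto
    qed (auto simp: zmul_in_cyclic_subgroup)
    have "(\<exists>l. x = g + zmul k t + zmul l t) \<longleftrightarrow> (\<exists>l. x = g + zmul l t)" for x
    proof safe
      fix l show "\<exists>l'. g + zmul k t + zmul l t = g + zmul l' t"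
        by (rule exI[of _ "k + l"]) (simp add: zmul_add add.assoc)
      show "\<exists>l'. g + zmul l t = g + zmul k t + zmul l' t"
        by (rule exI[of _ "- k + l"]) (simp add: zmul_uminus add.assoc, metis zmul_add add.commute diff_add_cancel)
    qed
    then show ?thesis unfolding C image_image by (simp add: set_eq_iff image_iff)
  qed
  have "{(+) a ` cyclic_subgroup t | a. True} \<subseteq> (\<lambda>(r, d). (+) (r + d) ` cyclic_subgroup t) ` (R \<times> D)"
  proof safe
    fix g
    obtain r where r: "r \<in> R" "- r + g \<in> L" using assms(2) by blast
    obtain d k where d: "d \<in> D" "- r + g = d + zmul k t" using assms(4) r by blast
    have "g = r + d + zmul k t" using d(2) by (metis add.assoc add_minus_cancel)
    then show "(+) g ` cyclic_subgroup t \<in> (\<lambda>(r, d). (+) (r + d) ` cyclic_subgroup t) ` (R \<times> D)"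
      using coset[of "r + d" k] r d by (intro image_eqI[where x = "(r, d)"]) auto
  qed
  then show ?thesis unfolding virtually_cyclic_def
    using assms(1,3) by (meson finite_SigmaI finite_imageI finite_subset)
qed

section \<open>Transience and projection onto gradients\<close>

definition finite_support :: "('g \<Rightarrow> 'a::zero) \<Rightarrow> bool" where
  "finite_support u \<longleftrightarrow> finite {x. u x \<noteq> 0}"

lemma finite_support_mono:
  assumes "finite_support u" "\<And>x. u x = 0 \<Longrightarrow> v x = 0"
  shows "finite_support v"
  using assms unfolding finite_support_def by (metis (mono_tags, lifting) finite_subset mem_Collect_eq subsetI)

lemma finite_support_combine:
  assumes "finite_support u" "finite_support v" "\<And>x. u x = 0 \<Longrightarrow> v x = 0 \<Longrightarrow> w x = 0"
  shows "finite_support w"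
  unfolding finite_support_def
  by (rule finite_subset[of _ "{x. u x \<noteq> 0} \<union> {x. v x \<noteq> 0}"])
    (use assms in \<open>auto simp: finite_support_def\<close>)

lemma finite_support_translate:
  fixes u :: "'g::group_add \<Rightarrow> 'a::zero"
  assumes "finite_support u"
  shows "finite_support (\<lambda>x. u (g + x))"
proof -
  have "{x. u (g + x) \<noteq> 0} \<subseteq> (\<lambda>x. - g + x) ` {x. u x \<noteq> 0}"
    by (force simp: image_iff intro: exI[of _ "g + _"])
  then show ?thesis using assms unfolding finite_support_def by (meson finite_imageI finite_subset)
qed

lemma finite_support_summable:
  fixes u :: "'g \<Rightarrow> real"
  shows "finite_support u \<Longrightarrow> u summable_on UNIV"
  unfolding finite_support_def
  by (subst summable_on_cong_neutral[of "{x. u x \<noteq> 0}" _ u u]) (auto intro: summable_on_finite)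

text \<open>Substituting \<open>g - k\<close> for the summation variable confines the sum to the
  support of \<open>f\<close>. It is therefore finite for every \<open>v\<close>, in particular for
  potentials that merely vanish at infinity.\<close>

lemma conv_eq:
  assumes "f \<in> group_ring"
  shows "conv v f g = (\<Sum>k | f k \<noteq> 0. v (g - k) * of_int (f k))"
proof -
  let ?F = "{k. f k \<noteq> 0}"
  have fin: "finite ?F" using assms unfolding group_ring_def by simp
  have inj: "inj_on (\<lambda>k. g - k) ?F"
    by (auto simp: inj_on_def diff_conv_add_uminus simp del: add_uminus_conv_diff)
  have "conv v f g = infsum (\<lambda>g'. v g' * of_int (f (- g' + g))) ((\<lambda>k. g - k) ` ?F)"
    unfolding conv_def
  proof (rule infsum_cong_neutral)
    fix x assume "x \<in> UNIV - (\<lambda>k. g - k) ` ?F"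
    moreover have "x = g - (- x + g)"
      by (simp add: group_add_normalize del: add_uminus_conv_diff)
    ultimately have "f (- x + g) = 0" by blast
    then show "v x * of_int (f (- x + g)) = 0" by simp
  qed auto
  also have "\<dots> = (\<Sum>k\<in>?F. v (g - k) * of_int (f (- (g - k) + g)))"
    using fin inj by (simp add: sum.reindex)
  also have "\<dots> = (\<Sum>k\<in>?F. v (g - k) * of_int (f k))"
    by (simp add: group_add_normalize del: add_uminus_conv_diff)
  finally show ?thesis .
qed

lemma conv_diff:
  assumes "f \<in> group_ring"
  shows "conv (\<lambda>x. v x - w x) f g = conv v f g - conv w f g"
  by (simp add: conv_eq[OF assms] left_diff_distrib sum_subtractf)

lemma conv_translate:
  assumes "f \<in> group_ring"
  shows "conv (\<lambda>x. v (a + x)) f g = conv v f (a + g)"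
  by (simp add: conv_eq[OF assms] add_diff_eq)

definition vanishing :: "('g \<Rightarrow> real) \<Rightarrow> bool" where
  "vanishing v \<longleftrightarrow> (\<forall>e>0. finite {x. e \<le> \<bar>v x\<bar>})"

lemma vanishing_finite_support: "finite_support v \<Longrightarrow> vanishing v"
  unfolding vanishing_def finite_support_def
  by (auto elim!: rev_finite_subset)

lemma vanishing_add:
  assumes "vanishing u" "vanishing v"
  shows "vanishing (\<lambda>x. u x + v x)"
  unfolding vanishing_def
proof (intro allI impI)
  fix e :: real assume "0 < e"
  then have "finite ({x. e / 2 \<le> \<bar>u x\<bar>} \<union> {x. e / 2 \<le> \<bar>v x\<bar>})"
    using assms unfolding vanishing_def by (metis finite_UnI half_gt_zero)
  then show "finite {x. e \<le> \<bar>u x + v x\<bar>}"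
    by (rule rev_finite_subset) auto
qed

lemma vanishing_cmult:
  assumes "vanishing u"
  shows "vanishing (\<lambda>x. u x * c)"
proof (cases "c = 0")
  case False
  have "{x. e \<le> \<bar>u x * c\<bar>} = {x. e / \<bar>c\<bar> \<le> \<bar>u x\<bar>}" for e
    using False by (simp add: abs_mult divide_le_eq)
  then show ?thesis using assms False unfolding vanishing_def by simp
qed (auto intro: vanishing_finite_support simp: finite_support_def)

lemma vanishing_diff:
  assumes "vanishing u" "vanishing v"
  shows "vanishing (\<lambda>x. u x - v x)"
  using vanishing_add[OF assms(1) vanishing_cmult[OF assms(2), of "-1"]] by simp

lemma vanishing_sum:
  assumes "finite I" "\<And>i. i \<in> I \<Longrightarrow> vanishing (u i)"
  shows "vanishing (\<lambda>x. \<Sum>i\<in>I. u i x)"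
  using assms
  by (induction I) (auto intro!: vanishing_add intro: vanishing_finite_support simp: finite_support_def)

lemma vanishing_conv:
  assumes "f \<in> group_ring" "vanishing v"
  shows "vanishing (conv v f)"
proof -
  have "vanishing (\<lambda>x. v (x - k))" for k
    unfolding vanishing_def
  proof (intro allI impI)
    fix e :: real assume "0 < e"
    then have "finite ((\<lambda>x. x + k) ` {x. e \<le> \<bar>v x\<bar>})" using assms(2) unfolding vanishing_def by blast
    then show "finite {x. e \<le> \<bar>v (x - k)\<bar>}"
      by (rule rev_finite_subset) (force simp: image_iff intro: exI[of _ "_ - k"])
  qed
  then show ?thesis
    unfolding conv_eq[OF assms(1), abs_def] using assms(1)
    by (intro vanishing_sum vanishing_cmult) (auto simp: group_ring_def)
qed

text \<open>A nonzero value would be repeated along an infinite orbit. This gives the uniqueness of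
  potentials, their integrality, and the equality of \<open>h\<close> with the convolution of the
  potential by \<open>f\<close>.\<close>

lemma vanishing_invariant_eq_0:
  fixes v :: "'g::group_add \<Rightarrow> real"
  assumes "vanishing v" "infinite L" "\<And>g x. g \<in> L \<Longrightarrow> v (- g + x) = v x"
  shows "v x = 0"
proof (rule ccontr)
  assume "v x \<noteq> 0"
  then have "finite {y. \<bar>v x\<bar> \<le> \<bar>v y\<bar>}" using assms(1) unfolding vanishing_def by simp
  moreover have "(\<lambda>g. - g + x) ` L \<subseteq> {y. \<bar>v x\<bar> \<le> \<bar>v y\<bar>}" using assms(3) by auto
  ultimately have "finite ((\<lambda>g. - g + x) ` L)" by (rule finite_subset[rotated])
  moreover have "inj_on (\<lambda>g. - g + x) L" by (auto simp: inj_on_def)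
  ultimately show False using assms(2) finite_imageD by blast
qed

section \<open>Free semigroups and the bound of the sup norm by the energy\<close>

primrec word_val :: "'g::group_add \<Rightarrow> 'g \<Rightarrow> bool list \<Rightarrow> 'g" where
  "word_val a b [] = 0"
| "word_val a b (i # w) = (if i then a else b) + word_val a b w"

lemma word_val_snoc: "word_val a b (w @ [i]) = word_val a b w + (if i then a else b)"
  by (induction w) (auto simp: add.assoc)

text \<open>The action is on the right, so the last letter is decoded first: it decides whether the
  moved point lies in \<open>Y + a\<close> or in \<open>Y + b\<close>. Words of equal length form
  one level of the binary tree.\<close>

lemma ping_pong_word_val:
  assumes "ping_pong a b" "length v = length w" "word_val a b v = word_val a b w"
  shows "v = w"
proof -
  obtain Y y where Y: "y \<in> Y" "\<And>y. y \<in> Y \<Longrightarrow> y + a \<in> Y \<and> y + b \<in> Y"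
    "\<And>y z. y \<in> Y \<Longrightarrow> z \<in> Y \<Longrightarrow> y + a \<noteq> z + b"
    using assms(1) unfolding ping_pong_def by blast
  have inY: "y + word_val a b v \<in> Y" for v
    by (induction v rule: rev_induct) (auto simp: word_val_snoc Y simp flip: add.assoc)
  show ?thesis
    using assms(2,3)
  proof (induction v arbitrary: w rule: rev_induct)
    case (snoc i v)
    then obtain w' j where w: "w = w' @ [j]" by (metis length_append_singleton length_greater_0_conv
       rev_exhaust zero_less_Suc list.size(3))
    have "(y + word_val a b v) + (if i then a else b) = (y + word_val a b w') + (if j then a else b)"
      using snoc.prems(2) unfolding w word_val_snoc by (simp only: add.assoc)
    then have "i = j" using Y(3)[OF inY[of v] inY[of w']] Y(3)[OF inY[of w'] inY[of v]]
      by (metis (full_types))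
    then show ?case using snoc w by (simp add: word_val_snoc)
  qed simp
qed

text \<open>If a positive multiple of \<open>a\<close> were 0, putting \<open>b\<close> before or
  after it would give two different words of equal length with the same value.\<close>

lemma ping_pong_inj_zmul:
  assumes "ping_pong a b"
  shows "inj (\<lambda>n. zmul (int n) a)"
proof (rule injI)
  have v: "word_val a b (replicate n True) = zmul (int n) a" for n
    by (induction n) (auto simp: zmul_Suc[of "int _", symmetric] add.commute)
  have *: False if eq: "zmul (int n) a = zmul (int m) a" and nm: "n < m" for n m
  proof -
    have z: "zmul (int (m - n)) a = 0"
      using zmul_diff[of "int m" "int n" a] eq nm by (simp add: of_nat_diff)
    have "word_val a b (replicate (m - n) True @ [False]) = word_val a b (False # replicate (m - n) True)"
      unfolding word_val_snoc v by (simp add: v z)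
    then have "replicate (m - n) True @ [False] = False # replicate (m - n) True"
      by (rule ping_pong_word_val[OF assms, rotated]) simp
    then show False using nm by (cases "m - n") auto
  qed
  fix n m assume "zmul (int n) a = zmul (int m) a"
  then show "n = m" using *[of n m] *[of m n] by (metis linorder_neqE_nat)
qed

definition grad_sq :: "('g::group_add \<Rightarrow> real) \<Rightarrow> 'g \<Rightarrow> real" where
  "grad_sq u s = (\<Sum>\<^sub>\<infinity>x. (u (- s + x) - u x)\<^sup>2)"

lemma finite_support_grad:
  fixes u :: "'g::group_add \<Rightarrow> real"
  assumes "finite_support u"
  shows "finite_support (\<lambda>x. u (- s + x) - u x)"
  by (rule finite_support_combine[OF assms finite_support_translate[OF assms, of "- s"]]) auto

text \<open>Averaging \<open>u\<close> over the words of length \<open>k\<close> sends a unit flow from \<open>x\<close> to infinity through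
  a binary tree; its energy is finite because each edge of level \<open>k\<close> carries only \<open>2 ^ - k\<close>.\<close>

lemma ping_pong_sup_bound:
  fixes u :: "'g::group_add \<Rightarrow> real"
  assumes pp: "ping_pong a b" and u: "finite_support u"
  shows "\<bar>u x\<bar> \<le> 2 * (sqrt (grad_sq u a) + sqrt (grad_sq u b))"
proof -
  define W where "W k = {w :: bool list. length w = k}" for k
  define F where "F w = u (word_val a b w + x)" for w
  define s where "s k = (\<Sum>w\<in>W k. F w)" for k
  define N where "N = sqrt (grad_sq u a) + sqrt (grad_sq u b)"
  have W: "finite (W k)" "card (W k) = 2 ^ k" for k
    using finite_lists_length_eq[of "UNIV :: bool set" k] card_lists_length_eq[of "UNIV :: bool set" k]
    unfolding W_def by (auto simp: card_UNIV_bool)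
  have inj: "inj_on (word_val a b) (W k)" for k
    using ping_pong_word_val[OF pp] unfolding W_def inj_on_def by auto
  have WS: "W (Suc k) = (#) True ` W k \<union> (#) False ` W k" for k
    unfolding W_def by (force simp: length_Suc_conv image_iff)
  have sS: "s (Suc k) = (\<Sum>w\<in>W k. F (True # w) + F (False # w))" for k
  proof -
    have "s (Suc k) = sum F ((#) True ` W k) + sum F ((#) False ` W k)"
      unfolding s_def WS by (rule sum.union_disjoint) (use W in auto)
    moreover have "sum F ((#) i ` W k) = (\<Sum>w\<in>W k. F (i # w))" for i
      by (subst sum.reindex) (auto simp: inj_on_def)
    ultimately show ?thesis by (simp add: sum.distrib)
  qed
  have summ: "(\<lambda>y. (u (- g + y) - u y)\<^sup>2) summable_on UNIV" for g
    by (rule finite_support_summable, rule finite_support_mono[OF finite_support_grad[OF u]]) simp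
  \<comment> \<open>Cauchy-Schwarz over the \<open>2 ^ k\<close> words of a level. Distinct words
    give distinct edges, so the squares add up to at most \<open>grad_sq\<close>.\<close>
  have edge: "\<bar>\<Sum>w\<in>W k. F (i # w) - F w\<bar> \<le> (3/2) ^ k * sqrt (grad_sq u (if i then a else b))" for k i
  proof -
    let ?g = "if i then a else b"
    let ?p = "\<lambda>w. ?g + (word_val a b w + x)"
    have "(\<Sum>w\<in>W k. F (i # w) - F w)\<^sup>2 \<le> (\<Sum>w\<in>W k. (F (i # w) - F w)\<^sup>2) * 2 ^ k"
      using sum_squared_le_sum_of_squares[of "\<lambda>w. F (i # w) - F w" "W k"] W by simp
    also have "(\<Sum>w\<in>W k. (F (i # w) - F w)\<^sup>2) = (\<Sum>w\<in>W k. (u (- ?g + ?p w) - u (?p w))\<^sup>2)"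
      by (intro sum.cong) (auto simp: F_def add.assoc power2_commute)
    also have "\<dots> = (\<Sum>y\<in>?p ` W k. (u (- ?g + y) - u y)\<^sup>2)"
      using inj[of k] by (subst sum.reindex) (auto simp: inj_on_def)
    also have "\<dots> \<le> grad_sq u ?g"
      unfolding grad_sq_def by (rule finite_sum_le_infsum[OF summ]) (use W in auto)
    finally have "(\<Sum>w\<in>W k. F (i # w) - F w)\<^sup>2 \<le> grad_sq u ?g * 2 ^ k" by simp
    then have "\<bar>\<Sum>w\<in>W k. F (i # w) - F w\<bar> \<le> sqrt (grad_sq u ?g * 2 ^ k)"
      using real_le_rsqrt by (metis real_sqrt_abs real_sqrt_le_mono)
    also have "\<dots> = sqrt 2 ^ k * sqrt (grad_sq u ?g)" by (simp add: real_sqrt_mult real_sqrt_power)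
    \<comment> \<open>Any bound below 2 in place of \<open>sqrt 2\<close> would do;
      \<open>3/2\<close> makes the changes of the level averages a geometric series of ratio
      \<open>3/4\<close>, with first term \<open>N / 2\<close> and sum \<open>2 * N\<close>.\<close>
    also have "\<dots> \<le> (3/2) ^ k * sqrt (grad_sq u ?g)"
    proof -
      have "sqrt 2 \<le> 3/2" by (rule real_le_lsqrt) (auto simp: power2_eq_square)
      moreover have "0 \<le> grad_sq u ?g" unfolding grad_sq_def by (rule infsum_nonneg) simp
      ultimately show ?thesis by (intro mult_right_mono power_mono) auto
    qed
    finally show ?thesis .
  qed
  have N0: "0 \<le> N" unfolding N_def grad_sq_def by (auto intro!: add_nonneg_nonneg infsum_nonneg)
  have step: "\<bar>s k\<bar> \<le> (\<bar>s (Suc k)\<bar> + (3/2) ^ k * N) / 2" for k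
  proof -
    have "s (Suc k) - 2 * s k = (\<Sum>w\<in>W k. F (True # w) - F w) + (\<Sum>w\<in>W k. F (False # w) - F w)"
      unfolding sS by (simp add: s_def sum.distrib sum_subtractf)
    then have "\<bar>s (Suc k) - 2 * s k\<bar> \<le> (3/2) ^ k * N"
      using edge[of True k] edge[of False k] unfolding N_def by (simp add: distrib_left)
    moreover have "2 * \<bar>s k\<bar> \<le> \<bar>s (Suc k)\<bar> + \<bar>s (Suc k) - 2 * s k\<bar>" by arith
    ultimately have "2 * \<bar>s k\<bar> \<le> \<bar>s (Suc k)\<bar> + (3/2) ^ k * N" by (rule order_trans[rotated, OF add_left_mono])
    then show ?thesis by simp
  qed
  have bound: "\<bar>s 0\<bar> \<le> \<bar>s k\<bar> / 2 ^ k + 2 * N * (1 - (3/4) ^ k)" for k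
  proof (induction k)
    case (Suc k)
    have "\<bar>s k\<bar> / 2 ^ k \<le> \<bar>s (Suc k)\<bar> / 2 ^ Suc k + (3/4) ^ k * N / 2"
    proof -
      have "\<bar>s k\<bar> / 2 ^ k \<le> ((\<bar>s (Suc k)\<bar> + (3/2) ^ k * N) / 2) / 2 ^ k"
        by (rule divide_right_mono[OF step]) simp
      also have "(3/2 :: real) ^ k = (3/4) ^ k * 2 ^ k" by (simp flip: power_mult_distrib)
      finally show ?thesis by (simp add: add_divide_distrib)
    qed
    moreover have "(3/4) ^ k * N / 2 + 2 * N * (1 - (3/4) ^ k) = 2 * N * (1 - (3/4) ^ Suc k)"
      by (simp add: algebra_simps)
    ultimately show ?case using Suc by linarith
  qed simp
  \<comment> \<open>Since the words of a level have distinct values, \<open>s k\<close> is bounded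
    by the l^1 norm of \<open>u\<close>, and the level averages tend to 0.\<close>
  define T where "T = (\<Sum>\<^sub>\<infinity>y. \<bar>u y\<bar>)"
  have sT: "\<bar>s k\<bar> \<le> T" for k
  proof -
    have "\<bar>s k\<bar> \<le> (\<Sum>w\<in>W k. \<bar>u (word_val a b w + x)\<bar>)" unfolding s_def F_def by (rule sum_abs)
    also have "\<dots> = (\<Sum>y\<in>(\<lambda>w. word_val a b w + x) ` W k. \<bar>u y\<bar>)"
      using inj[of k] by (subst sum.reindex) (auto simp: inj_on_def)
    also have "\<dots> \<le> T" unfolding T_def
      by (rule finite_sum_le_infsum) (use W finite_support_summable[OF finite_support_mono[OF u]] in auto)
    finally show ?thesis .
  qed
  have "\<bar>s 0\<bar> \<le> T * (1/2) ^ k + 2 * N" for k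
  proof -
    have "\<bar>s k\<bar> / 2 ^ k \<le> T * (1/2) ^ k" using sT[of k] by (simp add: divide_simps power_divide)
    moreover have "2 * N * (1 - (3/4) ^ k) \<le> 2 * N" using N0 by (simp add: algebra_simps)
    ultimately show ?thesis using bound[of k] by linarith
  qed
  moreover have "(\<lambda>k. T * (1/2) ^ k + 2 * N) \<longlonglongrightarrow> T * 0 + 2 * N"
    by (intro tendsto_intros LIMSEQ_power_zero) auto
  ultimately have "\<bar>s 0\<bar> \<le> 2 * N" using LIMSEQ_le_const by fastforce
  moreover have "s 0 = u x" unfolding s_def W_def F_def by simp
  ultimately show ?thesis unfolding N_def by simp
qed


section \<open>Projection onto gradients by minimizing the energy\<close>

definition energy_form :: "'g set \<Rightarrow> ('g \<Rightarrow> 'g \<Rightarrow> real) \<Rightarrow> ('g \<Rightarrow> 'g \<Rightarrow> real) \<Rightarrow> real" where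
  "energy_form S p q = (\<Sum>s\<in>S. \<Sum>\<^sub>\<infinity>x. p s x * q s x)"

lemma energy_form_expand:
  assumes "\<And>s. s \<in> S \<Longrightarrow> finite_support (p s)" "\<And>s. s \<in> S \<Longrightarrow> finite_support (q s)"
  shows "energy_form S (\<lambda>s x. p s x + t * q s x) (\<lambda>s x. p s x + t * q s x) =
    energy_form S p p + 2 * t * energy_form S p q + t\<^sup>2 * energy_form S q q"
proof -
  have "(\<Sum>\<^sub>\<infinity>x. (p s x + t * q s x) * (p s x + t * q s x)) =
      (\<Sum>\<^sub>\<infinity>x. p s x * p s x) + 2 * t * (\<Sum>\<^sub>\<infinity>x. p s x * q s x) + t\<^sup>2 * (\<Sum>\<^sub>\<infinity>x. q s x * q s x)"
    if s: "s \<in> S" for s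
  proof -
    have sm: "(\<lambda>x. p s x * p s x) summable_on UNIV" "(\<lambda>x. p s x * q s x) summable_on UNIV"
      "(\<lambda>x. q s x * q s x) summable_on UNIV"
      by (auto intro!: finite_support_summable intro: finite_support_mono[OF assms(1)[OF s]]
          finite_support_mono[OF assms(2)[OF s]])
    have "(\<Sum>\<^sub>\<infinity>x. (p s x + t * q s x) * (p s x + t * q s x)) =
        (\<Sum>\<^sub>\<infinity>x. p s x * p s x + (2 * t) * (p s x * q s x) + t\<^sup>2 * (q s x * q s x))"
      by (rule infsum_cong) (simp add: algebra_simps power2_eq_square)
    also have "\<dots> = (\<Sum>\<^sub>\<infinity>x. p s x * p s x) + (\<Sum>\<^sub>\<infinity>x. (2 * t) * (p s x * q s x)) + (\<Sum>\<^sub>\<infinity>x. t\<^sup>2 * (q s x * q s x))"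
      using sm by (simp add: infsum_add summable_on_add summable_on_cmult_right)
    finally show ?thesis by (simp add: infsum_cmult_right')
  qed
  then show ?thesis unfolding energy_form_def by (simp add: sum.distrib sum_distrib_left)
qed

lemma energy_form_nonneg: "0 \<le> energy_form S p p"
  unfolding energy_form_def by (intro sum_nonneg infsum_nonneg) simp

text \<open>The second argument is the gradient of a point mass at \<open>x\<close>. Pairing with it
  gives the divergence at \<open>x\<close>, which turns orthogonality to gradients into a pointwise
  equation.\<close>

lemma energy_form_dirac:
  fixes p :: "'g::group_add \<Rightarrow> 'g \<Rightarrow> real"
  shows "energy_form S p (\<lambda>s y. of_bool (- s + y = x) - of_bool (y = x)) = (\<Sum>s\<in>S. p s (s + x) - p s x)"
proof -
  have pt: "(\<Sum>\<^sub>\<infinity>y. r y * of_bool (y = z)) = r z" for r :: "'g \<Rightarrow> real" and z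
    using infsum_cong_neutral[of "{z}" UNIV "\<lambda>y. r y * of_bool (y = z)" "\<lambda>y. r y * of_bool (y = z)"] by simp
  have sm: "(\<lambda>y. r y * of_bool (y = z)) summable_on UNIV" for r :: "'g \<Rightarrow> real" and z
    by (rule finite_support_summable) (simp add: finite_support_def)
  have "(\<Sum>\<^sub>\<infinity>y. p s y * (of_bool (- s + y = x) - of_bool (y = x))) = p s (s + x) - p s x" for s
  proof -
    have move: "- s + y = x \<longleftrightarrow> y = s + x" for y by (metis add_minus_cancel minus_add_cancel)
    have "(\<Sum>\<^sub>\<infinity>y. p s y * (of_bool (- s + y = x) - of_bool (y = x))) =
        (\<Sum>\<^sub>\<infinity>y. p s y * of_bool (y = s + x) - p s y * of_bool (y = x))"
      unfolding move by (simp add: right_diff_distrib)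
    also have "\<dots> = p s (s + x) - p s x"
      using infsum_add[OF sm[of "p s" "s + x"] sm[of "\<lambda>y. - p s y" x]]
      by (simp add: pt infsum_uminus)
    finally show ?thesis .
  qed
  then show ?thesis unfolding energy_form_def by simp
qed

text \<open>The projection of \<open>c\<close> onto the closure of the gradients: a minimizing sequence of potentials
  converges uniformly because of \<open>bound\<close>.\<close>

lemma divergence_free_part:
  fixes c :: "'g::group_add \<Rightarrow> 'g \<Rightarrow> real"
  assumes S: "finite S" and c: "\<And>s. s \<in> S \<Longrightarrow> finite_support (c s)"
    and bound: "\<And>u x. finite_support u \<Longrightarrow> (u x)\<^sup>2 \<le> C * (\<Sum>s\<in>S. grad_sq u s)"
  obtains v where "vanishing v"
    "\<And>s. s \<in> S \<Longrightarrow> (\<lambda>x. c s x - (v (- s + x) - v x)) \<in> ell2"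
    "\<And>x. (\<Sum>s\<in>S. (c s (s + x) - (v x - v (s + x))) - (c s x - (v (- s + x) - v x))) = 0"
proof -
  define D where "D u s x = u (- s + x) - u x" for u :: "'g \<Rightarrow> real" and s x
  define R where "R u s x = c s x - D u s x" for u s x
  define Q where "Q u = energy_form S (R u) (R u)" for u
  define E where "E u = energy_form S (D u) (D u)" for u
  have E: "E u = (\<Sum>s\<in>S. grad_sq u s)" for u
    unfolding E_def energy_form_def grad_sq_def D_def by (simp add: power2_eq_square)
  have E0: "0 \<le> E u" for u unfolding E_def by (rule energy_form_nonneg)
  have Q0: "0 \<le> Q u" for u unfolding Q_def by (rule energy_form_nonneg)
  have fD: "finite_support (D u s)" if "finite_support u" for u s
    unfolding D_def[abs_def] by (rule finite_support_grad[OF that])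
  have fR: "finite_support (R u s)" if "finite_support u" "s \<in> S" for u s
    by (rule finite_support_combine[OF c[OF that(2)] fD[OF that(1)]]) (simp add: R_def)
  have Q_add: "Q (\<lambda>x. v x + t * u x) = Q v - 2 * t * energy_form S (R v) (D u) + t\<^sup>2 * E u"
    if "finite_support u" "finite_support v" for u v t
  proof -
    have "R (\<lambda>x. v x + t * u x) = (\<lambda>s x. R v s x + (- t) * D u s x)"
      unfolding R_def D_def by (auto simp: fun_eq_iff algebra_simps)
    then show ?thesis unfolding Q_def E_def using fR[OF that(2)] fD[OF that(1)]
      by (simp only: energy_form_expand) simp
  qed
  let ?V = "{u :: 'g \<Rightarrow> real. finite_support u}"
  define d where "d = Inf (Q ` ?V)"
  have zero: "(\<lambda>_. 0) \<in> ?V" by (simp add: finite_support_def)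
  have d: "d \<le> Q u" if "finite_support u" for u
    unfolding d_def by (rule cInf_lower) (use that Q0 in \<open>auto intro!: bdd_belowI[of _ 0]\<close>)
  define \<delta> :: "nat \<Rightarrow> real" where "\<delta> n = 1 / real (Suc n)" for n
  have \<delta>: "0 < \<delta> n" "\<delta> n \<le> 1" "m \<le> n \<Longrightarrow> \<delta> n \<le> \<delta> m" for m n
    by (auto simp: \<delta>_def divide_simps)
  have "\<exists>u. finite_support u \<and> Q u < d + \<delta> n" for n
    using cInf_lessD[of "Q ` ?V" "d + \<delta> n"] zero \<delta>(1)[of n] unfolding d_def by auto
  then obtain v where v: "\<And>n. finite_support (v n)" "\<And>n. Q (v n) < d + \<delta> n" by metis
  have fs: "finite_support (\<lambda>x. a * u x + b * w x)" if "finite_support u" "finite_support w"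
    for a b :: real and u w :: "'g \<Rightarrow> real"
    by (rule finite_support_combine[OF that]) simp
  have C0: "0 \<le> C"
  proof (rule ccontr)
    assume "\<not> 0 \<le> C"
    let ?u = "\<lambda>x::'g. of_bool (x = 0) :: real"
    have "C * E ?u \<le> 0" using \<open>\<not> 0 \<le> C\<close> E0[of ?u] by (simp add: mult_nonpos_nonneg)
    moreover have "(?u 0)\<^sup>2 \<le> C * E ?u" unfolding E by (rule bound) (simp add: finite_support_def)
    ultimately show False by simp
  qed
  have cauchy: "(v n x - v m x)\<^sup>2 \<le> 2 * C * (\<delta> n + \<delta> m)" for n m x
  proof -
    let ?u = "\<lambda>x. v n x - v m x"
    have fu: "finite_support ?u" using fs[OF v(1)[of n] v(1)[of m], of 1 "-1"] by simp
    define I where "I = energy_form S (R (v m)) (D ?u)"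
    define e where "e = E ?u"
    have n: "Q (v n) = Q (v m) - 2 * energy_form S (R (v m)) (D ?u) + E ?u"
      using Q_add[OF fu v(1)[of m], of 1] by simp
    \<comment> \<open>Parallelogram argument: the midpoint of \<open>v m\<close> and
      \<open>v n\<close> competes as well, so two almost minimizers differ by little energy.\<close>
    have "d \<le> Q (\<lambda>x. v m x + 1/2 * ?u x)"
      by (rule d, rule finite_support_combine[OF v(1)[of n] v(1)[of m]]) simp
    also have "\<dots> = Q (v m) - energy_form S (R (v m)) (D ?u) + E ?u / 4"
      using Q_add[OF fu v(1)[of m], of "1/2"] by (simp add: power2_eq_square)
    finally have "e \<le> 2 * (Q (v n) + Q (v m) - 2 * d)"
      using n unfolding I_def[symmetric] e_def[symmetric] by argo
    also have "\<dots> \<le> 2 * (\<delta> n + \<delta> m)"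
      using v(2)[of n] v(2)[of m] by argo
    finally have "C * e \<le> C * (2 * (\<delta> n + \<delta> m))" using C0 by (rule mult_left_mono)
    moreover have "(?u x)\<^sup>2 \<le> C * e" unfolding e_def E by (rule bound[OF fu])
    ultimately show ?thesis by (simp add: mult.assoc mult.left_commute)
  qed
  have inv0: "\<delta> \<longlonglongrightarrow> 0"
    unfolding \<delta>_def[abs_def] using LIMSEQ_inverse_real_of_nat by (simp add: inverse_eq_divide)
  have "Cauchy (\<lambda>n. v n x)" for x
  proof (rule CauchyI')
    fix e :: real assume e: "0 < e"
    have "(\<lambda>n. 4 * C * \<delta> n) \<longlonglongrightarrow> 4 * C * 0" by (intro tendsto_intros inv0)
    then have "\<forall>\<^sub>F n in sequentially. 4 * C * \<delta> n < e\<^sup>2"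
      using e by (intro order_tendstoD(2)) auto
    then obtain N where N: "4 * C * \<delta> N < e\<^sup>2" by (auto simp: eventually_sequentially)
    show "\<exists>M. \<forall>m\<ge>M. \<forall>n>m. dist (v m x) (v n x) < e"
    proof (intro exI[of _ N] allI impI)
      fix m n assume mn: "N \<le> m" "m < n"
      have "\<delta> m \<le> \<delta> N" "\<delta> n \<le> \<delta> N"
        using mn by (auto intro: \<delta>)
      then have "2 * C * (\<delta> m + \<delta> n) \<le> 2 * C * (2 * \<delta> N)"
        using C0 by (intro mult_left_mono) auto
      then have "(v m x - v n x)\<^sup>2 < e\<^sup>2" using cauchy[of m x n] N by simp
      then have "\<bar>v m x - v n x\<bar>\<^sup>2 < e\<^sup>2" by simp
      then show "dist (v m x) (v n x) < e"
        using e power2_less_imp_less[of "\<bar>v m x - v n x\<bar>" e] by (simp add: dist_real_def)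
    qed
  qed
  then have "\<exists>l. (\<lambda>n. v n x) \<longlonglongrightarrow> l" for x using Cauchy_convergent convergent_def by blast
  then obtain w where w: "\<And>x. (\<lambda>n. v n x) \<longlonglongrightarrow> w x" by metis
  have unif: "(v n x - w x)\<^sup>2 \<le> 2 * C * \<delta> n" for n x
  proof (rule LIMSEQ_le)
    show "(\<lambda>m. (v n x - v m x)\<^sup>2) \<longlonglongrightarrow> (v n x - w x)\<^sup>2" by (intro tendsto_intros w)
    have "(\<lambda>m. 2 * C * (\<delta> n + \<delta> m)) \<longlonglongrightarrow> 2 * C * (\<delta> n + 0)"
      by (intro tendsto_intros inv0)
    then show "(\<lambda>m. 2 * C * (\<delta> n + \<delta> m)) \<longlonglongrightarrow> 2 * C * \<delta> n" by simp
  qed (use cauchy in blast)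
  have limR: "(\<lambda>n. R (v n) s x) \<longlonglongrightarrow> R w s x" for s x
    unfolding R_def D_def by (intro tendsto_intros w)
  show ?thesis
  proof (rule that[of w])
    show "vanishing w" unfolding vanishing_def
    proof (intro allI impI)
      fix e :: real assume e: "0 < e"
      have "(\<lambda>n. 2 * C * \<delta> n) \<longlonglongrightarrow> 2 * C * 0" by (intro tendsto_intros inv0)
      then have "\<forall>\<^sub>F n in sequentially. 2 * C * \<delta> n < e\<^sup>2"
        using e by (intro order_tendstoD(2)) auto
      then obtain n where n: "2 * C * \<delta> n < e\<^sup>2" by (auto simp: eventually_sequentially)
      \<comment> \<open>Off the finite support of \<open>v n\<close> the uniform estimate bounds
        \<open>w\<close> itself.\<close>
      have "{x. e \<le> \<bar>w x\<bar>} \<subseteq> {x. v n x \<noteq> 0}"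
      proof safe
        fix x assume "e \<le> \<bar>w x\<bar>" "v n x = 0"
        then have "e\<^sup>2 \<le> (v n x - w x)\<^sup>2" using e by (metis abs_le_square_iff abs_of_pos diff_0 power2_minus)
        then show False using unif[of n x] n by linarith
      qed
      then show "finite {x. e \<le> \<bar>w x\<bar>}" using v(1)[of n] unfolding finite_support_def by (rule finite_subset)
    qed
    show "(\<lambda>x. c s x - (w (- s + x) - w x)) \<in> ell2" if s: "s \<in> S" for s
    proof -
      \<comment> \<open>Pointwise convergence of the remainders suffices: finite partial sums pass
        to the limit, and their bound does not depend on \<open>F\<close>.\<close>
      have "sum (\<lambda>x. (R w s x)\<^sup>2) F \<le> d + 1" if F: "finite F" for F
      proof (rule LIMSEQ_le_const2)
        show "(\<lambda>n. \<Sum>x\<in>F. (R (v n) s x)\<^sup>2) \<longlonglongrightarrow> (\<Sum>x\<in>F. (R w s x)\<^sup>2)"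
          by (intro tendsto_intros limR)
        have "(\<Sum>x\<in>F. (R (v n) s x)\<^sup>2) \<le> d + 1" for n
        proof -
          have "(\<Sum>x\<in>F. (R (v n) s x)\<^sup>2) \<le> (\<Sum>\<^sub>\<infinity>x. R (v n) s x * R (v n) s x)"
            unfolding power2_eq_square
            by (rule finite_sum_le_infsum[OF finite_support_summable])
              (use F in \<open>auto intro: finite_support_mono[OF fR[OF v(1) s]]\<close>)
          also have "\<dots> \<le> Q (v n)" unfolding Q_def energy_form_def
            by (rule member_le_sum[OF s _ S]) (auto intro!: infsum_nonneg)
          also have "\<dots> \<le> d + \<delta> n" using v(2)[of n] by simp
          also have "\<dots> \<le> d + 1" using \<delta>(2) by simp
          finally show ?thesis .
        qed
        then show "\<exists>N. \<forall>n\<ge>N. (\<Sum>x\<in>F. (R (v n) s x)\<^sup>2) \<le> d + 1" by blast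
      qed
      then have "(\<lambda>x. (R w s x)\<^sup>2) summable_on UNIV"
        by (intro nonneg_bdd_above_summable_on bdd_aboveI[of _ "d + 1"]) auto
      then show ?thesis unfolding ell2_def R_def D_def by simp
    qed
    show "(\<Sum>s\<in>S. (c s (s + x) - (w x - w (s + x))) - (c s x - (w (- s + x) - w x))) = 0" for x
    proof -
      let ?u = "\<lambda>y. of_bool (y = x) :: real"
      let ?B = "\<lambda>n. energy_form S (R (v n)) (D ?u)"
      have fu: "finite_support ?u" by (simp add: finite_support_def)
      have B: "(?B n)\<^sup>2 \<le> (E ?u + 1) * \<delta> n" for n
      proof -
        \<comment> \<open>First variation: a move by \<open>?t\<close> along the point mass lowers
          the energy by at least \<open>?t * ?B n\<close>, while an almost minimizer allows at most
          \<open>\<delta> n\<close>. The \<open>+ 1\<close> keeps the denominator positive.\<close>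
        let ?t = "?B n / (E ?u + 1)"
        have pos: "0 < E ?u + 1" using E0[of ?u] by simp
        have "d \<le> Q (\<lambda>y. v n y + ?t * ?u y)"
          by (rule d, rule finite_support_combine[OF v(1)[of n] fu]) simp
        then have "2 * ?t * ?B n - ?t\<^sup>2 * E ?u \<le> \<delta> n"
          using v(2)[of n] unfolding Q_add[OF fu v(1)[of n]] by linarith
        moreover have "?t\<^sup>2 * E ?u \<le> ?t\<^sup>2 * (E ?u + 1)" by (intro mult_left_mono) auto
        moreover have "?t\<^sup>2 * (E ?u + 1) = ?t * ?B n"
          using pos by (simp add: power2_eq_square)
        ultimately have "?t * ?B n \<le> \<delta> n" by linarith
        then have "(?B n)\<^sup>2 / (E ?u + 1) \<le> \<delta> n" by (simp add: power2_eq_square)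
        then show ?thesis using pos by (simp add: divide_le_eq mult.commute)
      qed
      have Beq: "?B n = (\<Sum>s\<in>S. R (v n) s (s + x) - R (v n) s x)" for n
        unfolding D_def[abs_def] by (rule energy_form_dirac)
      have lim: "?B \<longlonglongrightarrow> (\<Sum>s\<in>S. R w s (s + x) - R w s x)"
        unfolding Beq by (intro tendsto_intros limR)
      have "(\<Sum>s\<in>S. R w s (s + x) - R w s x)\<^sup>2 \<le> (E ?u + 1) * 0"
      proof (rule LIMSEQ_le)
        show "(\<lambda>n. (?B n)\<^sup>2) \<longlonglongrightarrow> (\<Sum>s\<in>S. R w s (s + x) - R w s x)\<^sup>2" by (intro tendsto_intros lim)
        show "(\<lambda>n. (E ?u + 1) * \<delta> n) \<longlonglongrightarrow> (E ?u + 1) * 0" by (intro tendsto_intros inv0)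
      qed (use B in blast)
      then show ?thesis unfolding R_def D_def by simp
    qed
  qed
qed

section \<open>Cocycles trivialized by \<open>f\<close>\<close>

lemma finite_support_group_ring: "c \<in> group_ring \<longleftrightarrow> finite_support (\<lambda>x. real_of_int (c x))"
  unfolding group_ring_def finite_support_def by simp

lemma finite_support_ell2: "finite_support v \<Longrightarrow> v \<in> ell2"
  unfolding ell2_def by (auto intro!: finite_support_summable elim: finite_support_mono)

text \<open>Maximum principle. A positive value makes the maximum attained; there all summands are
  nonnegative with sum 0, so the maximum spreads along the infinite orbit of \<open>a\<close>,
  contrary to vanishing at infinity.\<close>

lemma harmonic_vanishing_le_0:
  fixes u :: "'g::group_add \<Rightarrow> real"
  assumes u: "vanishing u" and S: "finite S" "a \<in> S" and inj: "inj (\<lambda>n. zmul (int n) a)"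
    and harm: "\<And>x. (\<Sum>s\<in>S. (u x - u (s + x)) - (u (- s + x) - u x)) = 0"
  shows "u y \<le> 0"
proof (rule ccontr)
  assume "\<not> u y \<le> 0"
  then have y: "0 < u y" by simp
  let ?X = "{x. u y \<le> \<bar>u x\<bar>}"
  have fin: "finite ?X" using u y unfolding vanishing_def by blast
  define m where "m = Max (u ` ?X)"
  have yX: "y \<in> ?X" by simp
  have m: "u x \<le> m" for x
  proof (cases "x \<in> ?X")
    case True then show ?thesis unfolding m_def using fin by (intro Max_ge) auto
  next
    case False
    then have "u x \<le> u y" by simp
    also have "u y \<le> m" unfolding m_def by (rule Max_ge) (use fin yX in auto)
    finally show ?thesis .
  qed
  have "m \<in> u ` ?X" unfolding m_def by (rule Max_in) (use fin yX in auto)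
  then obtain x0 where x0: "u x0 = m" by blast
  have step: "u (a + x) = m" if x: "u x = m" for x
  proof -
    have "\<forall>s\<in>S. (u x - u (s + x)) - (u (- s + x) - u x) = 0"
    proof (subst sum_nonneg_eq_0_iff[symmetric, OF S(1)])
      fix s show "0 \<le> (u x - u (s + x)) - (u (- s + x) - u x)"
        using m[of "s + x"] m[of "- s + x"] x by linarith
    qed (rule harm)
    then have "(u x - u (a + x)) - (u (- a + x) - u x) = 0" using S(2) by blast
    then show ?thesis using m[of "a + x"] m[of "- a + x"] x by linarith
  qed
  have orbit: "u (zmul (int n) a + x0) = m" for n
  proof (induction n)
    case (Suc n)
    have "zmul (int (Suc n)) a + x0 = a + (zmul (int n) a + x0)"
      using zmul_Suc[of "int n" a] by (simp add: add.assoc add.commute)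
    then show ?case using step[OF Suc] by simp
  qed (simp add: x0)
  have "0 < m" using m[of y] y by linarith
  have "range (\<lambda>n. zmul (int n) a + x0) \<subseteq> {x. m \<le> \<bar>u x\<bar>}" using orbit by auto
  then have "finite (range (\<lambda>n. zmul (int n) a + x0))"
    using u \<open>0 < m\<close> unfolding vanishing_def by (meson finite_subset)
  moreover have "inj (\<lambda>n. zmul (int n) a + x0)" using inj unfolding inj_def by auto
  ultimately show False using finite_imageD by blast
qed

lemma harmonic_vanishing_eq_0:
  fixes u :: "'g::group_add \<Rightarrow> real"
  assumes u: "vanishing u" and S: "finite S" "a \<in> S" and inj: "inj (\<lambda>n. zmul (int n) a)"
    and harm: "\<And>x. (\<Sum>s\<in>S. (u x - u (s + x)) - (u (- s + x) - u x)) = 0"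
  shows "u y = 0"
proof -
  have "(\<Sum>s\<in>S. (- u x - - u (s + x)) - (- u (- s + x) - - u x)) = 0" for x
  proof -
    have "(\<Sum>s\<in>S. (- u x - - u (s + x)) - (- u (- s + x) - - u x)) =
        - (\<Sum>s\<in>S. (u x - u (s + x)) - (u (- s + x) - u x))"
      unfolding sum_negf[symmetric] by (rule sum.cong) auto
    then show ?thesis using harm by simp
  qed
  then have "- u y \<le> 0"
    using harmonic_vanishing_le_0[of "\<lambda>x. - u x", OF _ S inj] vanishing_cmult[OF u, of "-1"] by simp
  then show ?thesis using harmonic_vanishing_le_0[OF assms, of y] by linarith
qed

locale translation_cocycle =
  fixes f h :: "'g::group_add \<Rightarrow> int" and L :: "'g set" and c :: "'g \<Rightarrow> 'g \<Rightarrow> int"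
  assumes f: "f \<in> group_ring" and h: "h \<in> group_ring"
    and inj: "\<forall>v\<in>ell2. (\<forall>g. conv v f g = 0) \<longrightarrow> v = (\<lambda>_. 0)"
    and L: "add_subgroup L" and infL: "infinite L"
    and c: "\<And>g. g \<in> L \<Longrightarrow> c g \<in> group_ring"
    and conv_c: "\<And>g x. g \<in> L \<Longrightarrow> conv (\<lambda>y. real_of_int (c g y)) f x = of_int (h (- g + x) - h x)"
begin

lemmas LD = add_subgroupD[OF L]

text \<open>A potential of the cocycle on \<open>H\<close>, normalized to 0 at infinity.
  \<open>H\<close> is an arbitrary set because potentials are first found on finite sets.\<close>

definition primitive :: "('g \<Rightarrow> real) \<Rightarrow> 'g set \<Rightarrow> bool" where
  "primitive v H \<longleftrightarrow> vanishing v \<and> (\<forall>g\<in>H. \<forall>x. v (- g + x) - v x = of_int (c g x))"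

lemma conv_eq_0D: "v \<in> ell2 \<Longrightarrow> (\<And>g. conv v f g = 0) \<Longrightarrow> v x = 0"
  using inj by (metis (mono_tags))

text \<open>Both sides have the same product with \<open>f\<close>, and their difference has finite
  support, hence lies in \<open>ell2\<close>.\<close>

lemma cocycle:
  assumes "g \<in> L" "g' \<in> L"
  shows "c (g + g') x = c g x + c g' (- g + x)"
proof -
  let ?p = "\<lambda>y. real_of_int (c (g + g') y) - real_of_int (c g y)"
  let ?q = "\<lambda>y. real_of_int (c g' (- g + y))"
  have fs: "finite_support ?q" "finite_support (\<lambda>y. real_of_int (c (g + g') y))"
    "finite_support (\<lambda>y. real_of_int (c g y))"
    using c assms LD(2) finite_support_translate[of "\<lambda>y. real_of_int (c g' y)" "- g"]
    by (auto simp: finite_support_group_ring)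
  have "finite_support ?p" by (rule finite_support_combine[OF fs(2,3)]) simp
  then have "finite_support (\<lambda>y. ?p y - ?q y)" by (rule finite_support_combine[OF _ fs(1)]) simp
  then have "(\<lambda>y. ?p y - ?q y) \<in> ell2" by (rule finite_support_ell2)
  moreover have "conv (\<lambda>y. ?p y - ?q y) f z = 0" for z
    using conv_c[OF assms(1)] conv_c[OF assms(2)] conv_c[OF LD(2)[OF assms]]
    by (simp add: conv_diff[OF f] conv_translate[OF f, of "\<lambda>y. real_of_int (c g' y)"] minus_add add.assoc
        del: add_uminus_conv_diff)
  ultimately have "?p x - ?q x = 0" by (rule conv_eq_0D)
  then show ?thesis by linarith
qed

lemma cocycle_0: "c 0 x = 0"
  using cocycle[of 0 0 x] LD(1) by simp

lemma transient_primitive: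
  assumes S: "finite S" "S \<subseteq> L" "a \<in> S" "b \<in> S" and pp: "ping_pong a b"
  obtains v where "primitive v S"
proof -
  have "a \<noteq> b" using pp unfolding ping_pong_def by blast
  \<comment> \<open>The 8 is the square of the factor 2 in \<open>ping_pong_sup_bound\<close> times
    the 2 in (p + q)^2 <= 2 (p^2 + q^2).\<close>
  have bound: "(u x)\<^sup>2 \<le> 8 * (\<Sum>s\<in>S. grad_sq u s)" if u: "finite_support u" for u x
  proof -
    have nn: "0 \<le> grad_sq u s" for s unfolding grad_sq_def by (rule infsum_nonneg) simp
    have "(u x)\<^sup>2 \<le> (2 * (sqrt (grad_sq u a) + sqrt (grad_sq u b)))\<^sup>2"
      using ping_pong_sup_bound[OF pp u, of x] by (metis abs_ge_zero power2_abs power_mono)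
    also have "\<dots> = 4 * (sqrt (grad_sq u a) + sqrt (grad_sq u b))\<^sup>2" by (simp only: power_mult_distrib) simp
    also have "\<dots> \<le> 4 * (2 * ((sqrt (grad_sq u a))\<^sup>2 + (sqrt (grad_sq u b))\<^sup>2))"
      using sum_squares_ge_zero[of "sqrt (grad_sq u a) - sqrt (grad_sq u b)" 0]
      by (simp add: power2_eq_square algebra_simps)
    also have "\<dots> = 8 * (grad_sq u a + grad_sq u b)" using nn by simp
    also have "grad_sq u a + grad_sq u b \<le> (\<Sum>s\<in>S. grad_sq u s)"
      using sum_mono2[OF S(1), of "{a, b}" "grad_sq u"] S nn \<open>a \<noteq> b\<close> by simp
    finally show ?thesis by simp
  qed
  obtain v where v: "vanishing v"
    and ell: "\<And>s. s \<in> S \<Longrightarrow> (\<lambda>x. real_of_int (c s x) - (v (- s + x) - v x)) \<in> ell2"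
    and div: "\<And>x. (\<Sum>s\<in>S. (real_of_int (c s (s + x)) - (v x - v (s + x))) -
        (real_of_int (c s x) - (v (- s + x) - v x))) = 0"
    using divergence_free_part[OF S(1), of "\<lambda>s x. real_of_int (c s x)" 8] bound c S(2)
    by (auto simp: finite_support_group_ring subset_iff)
  define r where "r s x = real_of_int (c s x) - (v (- s + x) - v x)" for s x
  define u where "u x = real_of_int (h x) - conv v f x" for x
  have "vanishing (\<lambda>x. real_of_int (h x))"
    using h by (intro vanishing_finite_support) (simp add: finite_support_group_ring)
  then have u: "vanishing u" unfolding u_def[abs_def] by (rule vanishing_diff[OF _ vanishing_conv[OF f v]])
  have conv_r: "conv (r s) f x = u (- s + x) - u x" if "s \<in> S" for s x
    unfolding r_def[abs_def] u_def using conv_c[of s x] that S(2)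
    by (auto simp: conv_diff[OF f] conv_translate[OF f])
  have div_r: "(\<Sum>s\<in>S. r s (s + x) - r s x) = 0" for x using div[of x] unfolding r_def by simp
  \<comment> \<open>Divergence acts by left translations and convolution by \<open>f\<close> through
    right ones, so they commute: the convolved \<open>r\<close> stays divergence-free. By
    \<open>conv_r\<close> it is the gradient of \<open>u\<close>, so \<open>u\<close> is
    harmonic.\<close>
  have "(\<Sum>s\<in>S. (u x - u (s + x)) - (u (- s + x) - u x)) = 0" for x
  proof -
    have "(\<Sum>s\<in>S. (u x - u (s + x)) - (u (- s + x) - u x)) = (\<Sum>s\<in>S. conv (r s) f (s + x) - conv (r s) f x)"
      by (rule sum.cong) (simp_all add: conv_r)
    also have "\<dots> = (\<Sum>s\<in>S. \<Sum>k | f k \<noteq> 0. (r s (s + (x - k)) - r s (x - k)) * of_int (f k))"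
      by (simp add: conv_eq[OF f] sum_subtractf left_diff_distrib add_diff_eq)
    also have "\<dots> = (\<Sum>k | f k \<noteq> 0. (\<Sum>s\<in>S. r s (s + (x - k)) - r s (x - k)) * of_int (f k))"
      by (subst sum.swap) (simp add: sum_distrib_right)
    finally show ?thesis by (simp only: div_r) simp
  qed
  then have u0: "u x = 0" for x
    by (rule harmonic_vanishing_eq_0[OF u S(1,3) ping_pong_inj_zmul[OF pp]])
  \<comment> \<open>Here injectivity is applied to a function that may have infinite support and is
    only known to be in \<open>ell2\<close>.\<close>
  have "r s x = 0" if s: "s \<in> S" for s x
    by (rule conv_eq_0D) (use ell[OF s] conv_r[OF s] u0 in \<open>auto simp: r_def[abs_def]\<close>)
  then show ?thesis using v by (intro that[of v]) (auto simp: primitive_def r_def)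
qed

lemma primitive_unique:
  assumes v: "primitive v H" and w: "primitive w H" and H: "add_subgroup H" "infinite H"
  shows "v = w"
proof
  fix x
  have "v x - w x = 0"
  proof (rule vanishing_invariant_eq_0[of "\<lambda>x. v x - w x" H])
    show "vanishing (\<lambda>x. v x - w x)" using v w unfolding primitive_def by (auto intro: vanishing_diff)
    show "infinite H" by fact
    fix g x assume "g \<in> H"
    then have "v (- g + x) - v x = w (- g + x) - w x" using v w unfolding primitive_def by simp
    then show "v (- g + x) - w (- g + x) = v x - w x" by linarith
  qed
  then show "v x = w x" by simp
qed

lemma primitive_gen:
  assumes v: "primitive v S" and S: "S \<subseteq> L"
  shows "primitive v (gen S)"
proof -
  have "\<forall>x. v (- g + x) - v x = of_int (c g x)" if "g \<in> gen S" for g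
    using that
  proof (induction rule: gen_induct)
    case zero
    then show ?case by (simp add: cocycle_0)
  next
    case (step s y)
    have sy: "s \<in> L" "y \<in> L" using step S gen_least[OF L S] by auto
    show ?case
    proof
      fix x
      have "v (- s + x) - v x = of_int (c s x)" using v step(1) unfolding primitive_def by blast
      moreover have "v (- y + (- s + x)) - v (- s + x) = of_int (c y (- s + x))" using step by blast
      moreover have "- (s + y) + x = - y + (- s + x)"
        by (simp add: group_add_normalize del: add_uminus_conv_diff)
      ultimately show "v (- (s + y) + x) - v x = of_int (c (s + y) x)" using cocycle[OF sy, of x] by simp
    qed
  qed
  then show ?thesis using v unfolding primitive_def by blast
qed

text \<open>The potentials found for different \<open>g\<close> coincide, since each is a potential
  on the infinite subgroup \<open>gen S0\<close> and is unique there. One of them therefore serves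
  all of \<open>L\<close>.\<close>

lemma primitive_extend:
  assumes S0: "\<forall>s\<in>S0. - s \<in> S0" "S0 \<subseteq> L" "infinite (gen S0)"
    and ex: "\<And>g. g \<in> L \<Longrightarrow> \<exists>v. primitive v (insert g S0)"
  shows "\<exists>v. primitive v L"
proof -
  have G: "add_subgroup (gen S0)" by (rule add_subgroup_gen[OF S0(1)])
  have on_S0: "primitive v (gen S0)" if "primitive v (insert g S0)" for v g
    using that S0(2) by (intro primitive_gen) (auto simp: primitive_def)
  obtain v where v: "primitive v (insert 0 S0)" using ex[OF LD(1)] by blast
  have "v (- g + x) - v x = of_int (c g x)" if g: "g \<in> L" for g x
  proof -
    obtain w where w: "primitive w (insert g S0)" using ex[OF g] by blast
    then have "v = w" using primitive_unique[OF on_S0[OF v] on_S0[OF w] G S0(3)] by simp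
    then show ?thesis using w unfolding primitive_def by simp
  qed
  then show ?thesis using v unfolding primitive_def by blast
qed

lemma ping_pong_primitive:
  assumes "a \<in> L" "b \<in> L" "ping_pong a b"
  shows "\<exists>v. primitive v L"
proof (rule primitive_extend)
  let ?S = "{a, b, - a, - b}"
  show "\<forall>s\<in>?S. - s \<in> ?S" by auto
  show S: "?S \<subseteq> L" using assms LD(3) by auto
  have G: "add_subgroup (gen ?S)" by (rule add_subgroup_gen) auto
  have "a \<in> gen ?S" by (rule subsetD[OF gen_subset]) simp
  then have "range (\<lambda>n. zmul (int n) a) \<subseteq> gen ?S" using add_subgroup_zmul[OF G] by blast
  then show "infinite (gen ?S)"
    using finite_imageD[OF _ ping_pong_inj_zmul[OF assms(3)]] by (metis infinite_UNIV_nat finite_subset)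
  fix g assume "g \<in> L"
  then show "\<exists>v. primitive v (insert g ?S)"
    using transient_primitive[of "insert g ?S" a b] assms S by blast
qed

lemma primitive_imp_divides:
  assumes "primitive v L"
  shows "\<exists>w\<in>group_ring. \<forall>x. conv (\<lambda>y. real_of_int (w y)) f x = of_int (h x)"
proof -
  have v: "vanishing v" "\<And>g x. g \<in> L \<Longrightarrow> v (- g + x) = v x + of_int (c g x)"
    using assms unfolding primitive_def by (auto simp: algebra_simps)
  \<comment> \<open>The distance of \<open>v x\<close> to the nearest integer. Unlike
    \<open>frac (v x)\<close> it is small wherever \<open>v x\<close> is small and negative, so it
    vanishes at infinity; it is invariant under \<open>L\<close> because \<open>c\<close> has
    integer values.\<close>
  define m where "m x = min (frac (v x)) (1 - frac (v x))" for x
  have m_le: "\<bar>m x\<bar> \<le> \<bar>v x\<bar>" for x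
  proof (cases "0 \<le> v x")
    case True
    then have "0 \<le> real_of_int \<lfloor>v x\<rfloor>" by simp
    then have "frac (v x) \<le> v x" by (simp add: frac_def)
    then show ?thesis using True frac_lt_1[of "v x"] frac_ge_0[of "v x"] unfolding m_def min_def by auto
  next
    case False
    then have "\<lfloor>v x\<rfloor> \<le> - 1" by linarith
    then have "real_of_int \<lfloor>v x\<rfloor> \<le> - 1" by linarith
    then have "1 - frac (v x) \<le> - v x" by (simp add: frac_def)
    then show ?thesis using False frac_lt_1[of "v x"] frac_ge_0[of "v x"] unfolding m_def min_def by auto
  qed
  have "vanishing m" unfolding vanishing_def
  proof (intro allI impI)
    fix e :: real assume "0 < e"
    then have "finite {x. e \<le> \<bar>v x\<bar>}" using v unfolding vanishing_def by blast
    then show "finite {x. e \<le> \<bar>m x\<bar>}" by (rule rev_finite_subset) (use m_le order_trans in blast)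
  qed
  moreover have "m (- g + x) = m x" if "g \<in> L" for g x
    unfolding m_def v(2)[OF that] by (simp add: frac_def)
  ultimately have "m x = 0" for x using infL vanishing_invariant_eq_0 by blast
  then have "frac (v x) = 0" for x using frac_lt_1[of "v x"] unfolding m_def
    by (metis diff_gt_0_iff_gt less_irrefl min_def)
  then have int: "of_int \<lfloor>v x\<rfloor> = v x" for x by (simp add: frac_def)
  have "{x. \<lfloor>v x\<rfloor> \<noteq> 0} \<subseteq> {x. 1 \<le> \<bar>v x\<bar>}"
  proof safe
    fix x assume "\<lfloor>v x\<rfloor> \<noteq> 0"
    then have "1 \<le> \<bar>real_of_int \<lfloor>v x\<rfloor>\<bar>" by linarith
    then show "1 \<le> \<bar>v x\<bar>" by (simp add: int)
  qed
  then have "(\<lambda>x. \<lfloor>v x\<rfloor>) \<in> group_ring"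
    using v(1) unfolding group_ring_def vanishing_def by (auto intro: finite_subset)
  moreover have "conv v f x = of_int (h x)" for x
  proof -
    have "vanishing (\<lambda>x. real_of_int (h x))"
      using h by (intro vanishing_finite_support) (simp add: finite_support_group_ring)
    then have "vanishing (\<lambda>x. real_of_int (h x) - conv v f x)"
      by (rule vanishing_diff[OF _ vanishing_conv[OF f v(1)]])
    moreover have "real_of_int (h (- g + x)) - conv v f (- g + x) = real_of_int (h x) - conv v f x"
      if g: "g \<in> L" for g x
    proof -
      have "conv v f (- g + x) - conv v f x = conv (\<lambda>y. v (- g + y) - v y) f x"
        by (simp add: conv_diff[OF f] conv_translate[OF f])
      also have "\<dots> = of_int (h (- g + x) - h x)" using conv_c[OF g] v(2)[OF g] by simp
      finally show ?thesis by simp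
    qed
    ultimately have "real_of_int (h x) - conv v f x = 0" using infL vanishing_invariant_eq_0 by blast
    then show ?thesis by simp
  qed
  ultimately show ?thesis by (intro bexI[of _ "\<lambda>x. \<lfloor>v x\<rfloor>"]) (simp_all add: int)
qed

lemma finite_support_c: "g \<in> L \<Longrightarrow> finite {x. c g x \<noteq> 0}"
  using c unfolding group_ring_def by blast

lemma finite_support_c_translate: "g \<in> L \<Longrightarrow> finite {d. c g (d + x) \<noteq> 0}"
proof -
  assume "g \<in> L"
  then have "finite ((\<lambda>y. y - x) ` {x. c g x \<noteq> 0})" using finite_support_c by blast
  then show ?thesis by (rule rev_finite_subset) (force simp: image_iff intro: exI[of _ "_ + x"])
qed

lemma cocycle_uminus:
  assumes "g \<in> L" "d \<in> L"
  shows "c (- (g + d)) x = c (- d) x + c (- g) (d + x)"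
  using cocycle[of "- d" "- g" x] assms LD(3) by (simp add: minus_add del: add_uminus_conv_diff)

text \<open>For a potential \<open>v\<close>, the number \<open>c (- d) x\<close> equals
  \<open>v (d + x) - v x\<close> and tends to \<open>- v x\<close> as \<open>d\<close> goes to
  infinity. So the eventual value \<open>K x\<close> of \<open>c (- d) x\<close> has to be
  \<open>- v x\<close>, which dictates the choice of \<open>v\<close>.\<close>

lemma fg_primitive:
  assumes S: "finite S" "\<forall>s\<in>S. - s \<in> S" "S \<subseteq> L" and infS: "infinite (gen S)"
    and const: "\<And>x. \<exists>k. finite {d \<in> gen S. c (- d) x \<noteq> k}"
  shows "\<exists>v. primitive v (gen S)"
proof -
  have G: "add_subgroup (gen S)" by (rule add_subgroup_gen[OF S(2)])
  note GD = add_subgroupD[OF G]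
  have GL: "gen S \<subseteq> L" by (rule gen_least[OF L S(3)])
  obtain K where K: "\<And>x. finite {d \<in> gen S. c (- d) x \<noteq> K x}" using const by metis
  have K_eqI: "K x = k" if "finite {d \<in> gen S. c (- d) x \<noteq> k}" for x k
  proof (rule ccontr)
    assume "K x \<noteq> k"
    then have "gen S \<subseteq> {d \<in> gen S. c (- d) x \<noteq> k} \<union> {d \<in> gen S. c (- d) x \<noteq> K x}" by auto
    then show False using infS that K[of x] by (meson finite_UnI finite_subset)
  qed
  have K_shift: "K (- g + x) = K x - c g x" if g: "g \<in> gen S" for g x
  proof (rule K_eqI)
    have "c (- d) (- g + x) = c (- (d - g)) x - c g x" if "d \<in> gen S" for d
    proof -
      have "- d \<in> L" "g \<in> L" using g that GL LD(3) by auto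
      then show ?thesis using cocycle[of g "- d" x]
        by (simp add: minus_add diff_conv_add_uminus del: add_uminus_conv_diff)
    qed
    then have "(\<lambda>d. d - g) ` {d \<in> gen S. c (- d) (- g + x) \<noteq> K x - c g x} \<subseteq> {d \<in> gen S. c (- d) x \<noteq> K x}"
      using GD(4) g by auto
    then have "finite ((\<lambda>d. d - g) ` {d \<in> gen S. c (- d) (- g + x) \<noteq> K x - c g x})"
      using K finite_subset by blast
    then show "finite {d \<in> gen S. c (- d) (- g + x) \<noteq> K x - c g x}"
      by (rule finite_imageD) (auto simp: inj_on_def)
  qed
  define Z where "Z = (\<Union>s\<in>S. {x. c s x \<noteq> 0})"
  have finZ: "finite Z" unfolding Z_def using S finite_support_c by blast
  \<comment> \<open>On an orbit of \<open>gen S\<close> that misses the supports of all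
    \<open>c s\<close> the cocycle is 0, and so is \<open>K\<close>. On any other orbit
    \<open>x\<close> is moved to a point \<open>z\<close> of \<open>Z\<close>, where
    \<open>K x \<noteq> 0\<close> makes the inverse of the moving element one of the finitely many
    exceptions to the eventual value \<open>K z\<close>.\<close>
  have "{x. K x \<noteq> 0} \<subseteq> (\<Union>z\<in>Z. (\<lambda>d. d + z) ` {d \<in> gen S. c (- d) z \<noteq> K z})"
  proof
    fix x assume "x \<in> {x. K x \<noteq> 0}"
    then have x: "K x \<noteq> 0" by simp
    have "\<exists>d\<in>gen S. d + x \<in> Z"
    proof (rule ccontr)
      assume no: "\<not> ?thesis"
      have "\<forall>e\<in>gen S. c y (e + x) = 0" if "y \<in> gen S" for y
        using that
      proof (induction rule: gen_induct)
        case (step s y)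
        show ?case
        proof
          fix e assume e: "e \<in> gen S"
          have "- s + e \<in> gen S" using GD(2,3) e step(1) gen_subset by blast
          then have "c y ((- s + e) + x) = 0" using step by blast
          moreover have "c s (e + x) = 0" using no e step(1) unfolding Z_def by blast
          ultimately show "c (s + y) (e + x) = 0"
            using cocycle[of s y "e + x"] step(1,2) S(3) GL by (auto simp: add.assoc)
        qed
      qed (simp add: cocycle_0)
      then have "c (- d) x = 0" if "d \<in> gen S" for d using that GD(1,3) by (metis add.left_neutral)
      then have "{d \<in> gen S. c (- d) x \<noteq> 0} = {}" by blast
      then have "K x = 0" by (intro K_eqI) (simp only: finite.emptyI)
      then show False using x by simp
    qed
    then obtain d where d: "d \<in> gen S" "d + x \<in> Z" by blast
    have "K x = K (d + x) - c (- (- d)) (d + x)"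
      using K_shift[OF d(1), of "d + x"] by (simp add: add.assoc[symmetric])
    then have "- d \<in> {e \<in> gen S. c (- e) (d + x) \<noteq> K (d + x)}" using x d GD(3) by auto
    moreover have "x = - d + (d + x)" by simp
    ultimately show "x \<in> (\<Union>z\<in>Z. (\<lambda>d. d + z) ` {d \<in> gen S. c (- d) z \<noteq> K z})" using d(2) by blast
  qed
  moreover have "finite (\<Union>z\<in>Z. (\<lambda>d. d + z) ` {d \<in> gen S. c (- d) z \<noteq> K z})" using finZ K by blast
  ultimately have "finite_support (\<lambda>x. - real_of_int (K x))"
    unfolding finite_support_def by (simp add: finite_subset)
  then have "primitive (\<lambda>x. - real_of_int (K x)) (gen S)"
    unfolding primitive_def using K_shift by (auto intro: vanishing_finite_support)
  then show ?thesis by blast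
qed

text \<open>From \<open>d\<close> to \<open>s + d\<close> the value changes only if
  \<open>c (- s) (d + x)\<close> is nonzero, hence for finitely many \<open>d\<close>. So finitely
  many values occur on \<open>gen S\<close>; two of them occur infinitely often, and the smaller one
  serves as threshold.\<close>

lemma nonconstant_level_set:
  assumes S: "finite S" "S \<subseteq> L" and nonconst: "\<And>k. infinite {d \<in> gen S. c (- d) x \<noteq> k}"
  obtains k where "infinite {d \<in> gen S. c (- d) x \<le> k}" "infinite {d \<in> gen S. \<not> c (- d) x \<le> k}"
proof -
  have GL: "gen S \<subseteq> L" by (rule gen_least[OF L S(2)])
  define Bd where "Bd = (\<Union>s\<in>S. {d. c (- s) (d + x) \<noteq> 0})"
  have "finite Bd" unfolding Bd_def using S finite_support_c_translate LD(3) by blast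
  define V where "V = insert (c (- 0) x) ((\<lambda>(s, d). c (- (s + d)) x) ` (S \<times> Bd))"
  have finV: "finite V" unfolding V_def using S \<open>finite Bd\<close> by blast
  have val: "c (- d) x \<in> V" if "d \<in> gen S" for d
    using that
  proof (induction rule: gen_induct)
    case (step s d)
    show ?case
    proof (cases "d \<in> Bd")
      case True
      then show ?thesis unfolding V_def using step by (intro insertI2 image_eqI[of _ _ "(s, d)"]) auto
    next
      case False
      then have "c (- (s + d)) x = c (- d) x"
        using cocycle_uminus[of s d x] step(1,2) S(2) GL unfolding Bd_def by auto
      then show ?thesis using step by simp
    qed
  qed (simp add: V_def)
  have fibre: "\<exists>k. infinite {d \<in> X. c (- d) x = k}" if X: "X \<subseteq> gen S" "infinite X" for X
  proof (rule ccontr)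
    assume "\<not> ?thesis"
    then have "finite (\<Union>k\<in>V. {d \<in> X. c (- d) x = k})" using finV by blast
    moreover have "X \<subseteq> (\<Union>k\<in>V. {d \<in> X. c (- d) x = k})" using val X by blast
    ultimately show False using X finite_subset by blast
  qed
  have "infinite (gen S)" using nonconst[of 0] by (rule contrapos_nn) (auto elim: rev_finite_subset)
  then obtain k1 where k1: "infinite {d \<in> gen S. c (- d) x = k1}" using fibre[of "gen S"] by auto
  obtain k2 where k2: "infinite {d \<in> {d \<in> gen S. c (- d) x \<noteq> k1}. c (- d) x = k2}"
    using fibre[of "{d \<in> gen S. c (- d) x \<noteq> k1}"] nonconst[of k1] by auto
  then have "k1 \<noteq> k2" by (metis (mono_tags, lifting) empty_Collect_eq finite.emptyI mem_Collect_eq)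
  have k2': "infinite {d \<in> gen S. c (- d) x = k2}" by (rule infinite_super[OF _ k2]) auto
  show ?thesis
  proof (rule that[of "min k1 k2"])
    show "infinite {d \<in> gen S. c (- d) x \<le> min k1 k2}"
    proof (cases "k1 \<le> k2")
      case True
      show ?thesis by (rule infinite_super[OF _ k1]) (use True in auto)
    next
      case False
      show ?thesis by (rule infinite_super[OF _ k2']) (use False in auto)
    qed
    show "infinite {d \<in> gen S. \<not> c (- d) x \<le> min k1 k2}"
    proof (cases "k1 \<le> k2")
      case True
      show ?thesis by (rule infinite_super[OF _ k2']) (use True \<open>k1 \<noteq> k2\<close> in auto)
    next
      case False
      show ?thesis by (rule infinite_super[OF _ k1]) (use False in auto)
    qed
  qed
qed

text \<open>The level set is formed in all of \<open>L\<close>. Translating it by \<open>g\<close>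
  changes it only at those \<open>d\<close> where \<open>c (- g) (d + x)\<close> is nonzero, so it
  is almost invariant under every element of \<open>L\<close>.\<close>

lemma nonconstant_dichotomy:
  assumes S: "finite S" "\<forall>s\<in>S. - s \<in> S" "S \<subseteq> L"
    and nonconst: "\<And>k. infinite {d \<in> gen S. c (- d) x \<noteq> k}"
  shows "(\<exists>a\<in>L. \<exists>b\<in>L. ping_pong a b) \<or>
    (\<exists>t D. finite D \<and> (\<forall>x\<in>L. \<exists>d\<in>D. \<exists>k. x = d + zmul k t))"
proof -
  obtain k where k: "infinite {d \<in> gen S. c (- d) x \<le> k}" "infinite {d \<in> gen S. \<not> c (- d) x \<le> k}"
    using nonconstant_level_set[OF S(1,3) nonconst] by blast
  have GL: "gen S \<subseteq> L" by (rule gen_least[OF L S(3)])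
  show ?thesis
  proof (rule cut_dichotomy[OF L _ _ S])
    let ?A = "{d \<in> L. c (- d) x \<le> k}"
    show "?A \<subseteq> L" by blast
    fix g assume g: "g \<in> L"
    have "{d \<in> L. (g + d \<in> ?A) \<noteq> (d \<in> ?A)} \<subseteq> {d. c (- g) (d + x) \<noteq> 0}"
      using cocycle_uminus[OF g] g LD(2) by auto
    then show "finite {d \<in> L. (g + d \<in> ?A) \<noteq> (d \<in> ?A)}"
      using finite_support_c_translate[OF LD(3)[OF g]] finite_subset by blast
  next
    show "infinite (gen S \<inter> {d \<in> L. c (- d) x \<le> k})"
      by (rule infinite_super[OF _ k(1)]) (use GL in auto)
    show "infinite (gen S - {d \<in> L. c (- d) x \<le> k})"
      by (rule infinite_super[OF _ k(2)]) auto
  qed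
qed

end

section \<open>Locally finite subgroups, and the combination of all cases\<close>

lemma nontrivial_linear_relation:
  fixes M :: "'i \<Rightarrow> 'a \<Rightarrow> real"
  assumes "finite Y" "finite J" "card Y < card J"
  shows "\<exists>a. (\<exists>j\<in>J. a j \<noteq> 0) \<and> (\<forall>y\<in>Y. (\<Sum>j\<in>J. a j * M j y) = 0)"
  using assms
proof (induction Y arbitrary: J M rule: finite_induct)
  case empty
  then obtain j where "j \<in> J" by fastforce
  then show ?case by (intro exI[of _ "\<lambda>_. 1"]) auto
next
  case (insert y Y)
  show ?case
  proof (cases "\<forall>j\<in>J. M j y = 0")
    case True
    have "card Y < card J" using insert by simp
    then show ?thesis using insert.IH[OF insert.prems(1), of M] True by auto
  next
    case False
    then obtain i where i: "i \<in> J" "M i y \<noteq> 0" by blast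
    define N where "N j z = M j z - M j y / M i y * M i z" for j z
    have "card Y < card (J - {i})" using insert i by simp
    then obtain a where a: "\<exists>j\<in>J - {i}. a j \<noteq> 0" "\<And>z. z \<in> Y \<Longrightarrow> (\<Sum>j\<in>J - {i}. a j * N j z) = 0"
      using insert.IH[of "J - {i}" N] insert.prems(1) by auto
    define b where "b = a(i := - (\<Sum>j\<in>J - {i}. a j * (M j y / M i y)))"
    have "(\<Sum>j\<in>J. b j * M j z) = (\<Sum>j\<in>J - {i}. a j * N j z)" for z
    proof -
      have "(\<Sum>j\<in>J. b j * M j z) = b i * M i z + (\<Sum>j\<in>J - {i}. a j * M j z)"
        using sum.remove[OF insert.prems(1) i(1), of "\<lambda>j. b j * M j z"] by (simp add: b_def)
      also have "\<dots> = (\<Sum>j\<in>J - {i}. a j * N j z)"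
        unfolding b_def N_def by (simp add: right_diff_distrib sum_subtractf sum_distrib_right mult.assoc)
      finally show ?thesis .
    qed
    moreover have "N j y = 0" for j unfolding N_def using i by simp
    ultimately have "\<forall>z\<in>insert y Y. (\<Sum>j\<in>J. b j * M j z) = 0" using a(2) by auto
    moreover have "\<exists>j\<in>J. b j \<noteq> 0" using a(1) unfolding b_def by auto
    ultimately show ?thesis by blast
  qed
qed

text \<open>Convolution by \<open>f\<close> maps functions on \<open>Y\<close> to functions on
  \<open>Y\<close>, a square linear system in which injectivity gives surjectivity. The
  \<open>card Y + 1\<close> functions consisting of \<open>h\<close> (index \<open>None\<close>) and
  the convolved point masses are dependent, and injectivity keeps the coefficient of
  \<open>h\<close> nonzero.\<close>

lemma conv_onto_finite:
  fixes f h :: "'g::group_add \<Rightarrow> int"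
  assumes f: "f \<in> group_ring" and inj: "\<forall>v\<in>ell2. (\<forall>g. conv v f g = 0) \<longrightarrow> v = (\<lambda>_. 0)"
    and Y: "finite Y" "\<And>y k. y \<in> Y \<Longrightarrow> f k \<noteq> 0 \<Longrightarrow> y + k \<in> Y" and h: "\<And>x. h x \<noteq> 0 \<Longrightarrow> x \<in> Y"
  obtains v where "finite_support v" "\<And>x. conv v f x = of_int (h x)"
proof -
  define J where "J = insert None (Some ` Y)"
  define M where "M j = (case j of None \<Rightarrow> (\<lambda>x. real_of_int (h x)) | Some y \<Rightarrow> conv (\<lambda>x. of_bool (x = y)) f)" for j
  have "finite J" "card Y < card J" unfolding J_def using Y(1) by (auto simp: card_image)
  then obtain a where a: "\<exists>j\<in>J. a j \<noteq> 0" "\<And>y. y \<in> Y \<Longrightarrow> (\<Sum>j\<in>J. a j * M j y) = 0"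
    using nontrivial_linear_relation[OF Y(1), of J M] by blast
  define v where "v x = (if x \<in> Y then a (Some x) else 0)" for x
  have fsv: "finite_support v" unfolding finite_support_def v_def using Y(1) by simp
  have conv_v: "conv v f x = (\<Sum>y\<in>Y. a (Some y) * M (Some y) x)" for x
  proof -
    have "v z = (\<Sum>y\<in>Y. a (Some y) * of_bool (z = y))" for z
      unfolding v_def using Y(1) by simp
    then have "conv v f x = (\<Sum>k | f k \<noteq> 0. \<Sum>y\<in>Y. a (Some y) * of_bool (x - k = y) * of_int (f k))"
      by (simp only: conv_eq[OF f] sum_distrib_right)
    also have "\<dots> = (\<Sum>y\<in>Y. a (Some y) * M (Some y) x)"
      by (subst sum.swap) (simp add: M_def conv_eq[OF f] sum_distrib_left mult.assoc)
    finally show ?thesis .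
  qed
  have rel: "a None * of_int (h x) + conv v f x = 0" for x
  proof (cases "x \<in> Y")
    case True
    have "(\<Sum>j\<in>J. a j * M j x) = a None * M None x + (\<Sum>y\<in>Y. a (Some y) * M (Some y) x)"
      unfolding J_def using Y(1) by (simp add: sum.reindex)
    then show ?thesis using a(2)[OF True] conv_v by (simp add: M_def)
  next
    case False
    have "v (x - k) * of_int (f k) = 0" if "f k \<noteq> 0" for k
      using Y(2)[of "x - k" k] that False unfolding v_def by auto
    then have "conv v f x = 0" unfolding conv_eq[OF f] by (intro sum.neutral) blast
    then show ?thesis using h[of x] False by auto
  qed
  have a0: "a None \<noteq> 0"
  proof
    assume "a None = 0"
    then have "v = (\<lambda>_. 0)" using inj finite_support_ell2[OF fsv] rel by simp
    then have "a (Some y) = 0" if "y \<in> Y" for y using that unfolding v_def by metis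
    then show False using a(1) \<open>a None = 0\<close> unfolding J_def by auto
  qed
  show ?thesis
  proof (rule that[of "\<lambda>x. v x * (- 1 / a None)"])
    show "finite_support (\<lambda>x. v x * (- 1 / a None))" by (rule finite_support_mono[OF fsv]) simp
    have "conv (\<lambda>x. v x * (- 1 / a None)) f x = conv v f x * (- 1 / a None)" for x
      unfolding conv_eq[OF f] sum_distrib_right by (rule sum.cong) auto
    moreover have "conv v f x = - (a None * of_int (h x))" for x using rel[of x] by linarith
    ultimately show "conv (\<lambda>x. v x * (- 1 / a None)) f x = of_int (h x)" for x using a0 by simp
  qed
qed

text \<open>Write elements as an \<open>L\<close>-part plus a representative in \<open>R\<close>.
  Taking for \<open>S\<close> the \<open>L\<close>-parts of all \<open>r + k\<close> with
  \<open>k\<close> in the support of \<open>f\<close>, and those of the support of \<open>h\<close>,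
  together with inverses, makes \<open>gen S + R\<close> stable under right addition of the support
  of \<open>f\<close>; local finiteness makes it finite.\<close>

lemma (in translation_cocycle) locally_finite_primitive:
  assumes fin: "\<And>S. finite S \<Longrightarrow> \<forall>s\<in>S. - s \<in> S \<Longrightarrow> S \<subseteq> L \<Longrightarrow> finite (gen S)"
    and R: "finite R" "\<And>g. \<exists>r\<in>R. g - r \<in> L"
  shows "\<exists>v. primitive v L"
proof -
  obtain \<rho> where \<rho>: "\<And>g. \<rho> g \<in> R" "\<And>g. g - \<rho> g \<in> L" using R(2) by metis
  let ?W = "(\<lambda>(r, k). r + k) ` (R \<times> {k. f k \<noteq> 0}) \<union> {x. h x \<noteq> 0}"
  define T where "T = (\<lambda>z. z - \<rho> z) ` ?W"
  have "finite ?W" using R f h unfolding group_ring_def by auto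
  then have T: "finite T" "T \<subseteq> L" unfolding T_def using \<rho> by auto
  define S where "S = T \<union> uminus ` T"
  have S: "finite S" "\<forall>s\<in>S. - s \<in> S" "S \<subseteq> L" unfolding S_def using T LD(3) by auto
  have G: "add_subgroup (gen S)" by (rule add_subgroup_gen[OF S(2)])
  define Y where "Y = (\<lambda>(d, r). d + r) ` (gen S \<times> R)"
  have W: "d + z \<in> Y" if "z \<in> ?W" "d \<in> gen S" for z d
  proof -
    have "z - \<rho> z \<in> T" using that(1) unfolding T_def by (rule imageI)
    then have "z - \<rho> z \<in> gen S" using gen_subset[of S] unfolding S_def by blast
    then have "d + (z - \<rho> z) \<in> gen S" using add_subgroupD(2)[OF G that(2)] by blast
    moreover have "d + z = d + (z - \<rho> z) + \<rho> z"
      by (simp add: group_add_normalize del: add_uminus_conv_diff)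
    ultimately show ?thesis unfolding Y_def using \<rho>(1)[of z]
      by (intro image_eqI[of _ _ "(d + (z - \<rho> z), \<rho> z)"]) auto
  qed
  have "finite Y" unfolding Y_def using fin[OF S] R by auto
  moreover have "y + k \<in> Y" if y: "y \<in> Y" and k: "f k \<noteq> 0" for y k
  proof -
    obtain d r where dr: "d \<in> gen S" "r \<in> R" "y = d + r" using y unfolding Y_def by auto
    have "r + k \<in> ?W" using dr k by auto
    then show ?thesis using W[OF _ dr(1), of "r + k"] dr(3) by (simp add: add.assoc)
  qed
  moreover have "x \<in> Y" if "h x \<noteq> 0" for x
    using W[of x 0] that add_subgroupD(1)[OF G] by auto
  ultimately obtain v where v: "finite_support v" "\<And>x. conv v f x = of_int (h x)"
    by (rule conv_onto_finite[OF f inj]) auto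
  have "v (- g + x) - v x = of_int (c g x)" if g: "g \<in> L" for g x
  proof -
    have "finite_support (\<lambda>x. v (- g + x) - v x)" by (rule finite_support_grad[OF v(1)])
    then have "finite_support (\<lambda>x. v (- g + x) - v x - of_int (c g x))"
      by (rule finite_support_combine[of _ "\<lambda>x. real_of_int (c g x)"])
        (use c[OF g] in \<open>auto simp: finite_support_group_ring\<close>)
    then have "(\<lambda>x. v (- g + x) - v x - of_int (c g x)) \<in> ell2" by (rule finite_support_ell2)
    then have "v (- g + x) - v x - of_int (c g x) = 0"
    proof (rule conv_eq_0D)
      fix y show "conv (\<lambda>x. v (- g + x) - v x - of_int (c g x)) f y = 0"
        using conv_c[OF g] by (simp add: conv_diff[OF f] conv_translate[OF f] v(2))
    qed
    then show ?thesis by simp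
  qed
  then have "primitive v L" unfolding primitive_def using vanishing_finite_support[OF v(1)] by blast
  then show ?thesis by blast
qed

text \<open>A single infinite finitely generated subgroup suffices to glue the potentials over all
  of \<open>L\<close>; when there is none, \<open>L\<close> is locally finite.\<close>

theorem (in translation_cocycle) divides:
  assumes R: "finite R" "\<And>g. \<exists>r\<in>R. - r + g \<in> L" and nvc: "\<not> virtually_cyclic TYPE('g)"
  shows "\<exists>w\<in>group_ring. \<forall>x. conv (\<lambda>y. real_of_int (w y)) f x = of_int (h x)"
proof -
  have not_cyclic: "\<not> (\<exists>t D. finite D \<and> (\<forall>x\<in>L. \<exists>d\<in>D. \<exists>k. x = d + zmul k t))"
    using virtually_cyclicI[OF R] nvc by blast
  have "\<exists>v. primitive v L"
  proof (cases "\<exists>a\<in>L. \<exists>b\<in>L. ping_pong a b")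
    case True
    then show ?thesis using ping_pong_primitive by blast
  next
    case False
    then have ex: "\<exists>v. primitive v (gen S)"
      if "finite S" "\<forall>s\<in>S. - s \<in> S" "S \<subseteq> L" "infinite (gen S)" for S
      using fg_primitive[OF that] nonconstant_dichotomy[OF that(1-3)] not_cyclic by blast
    show ?thesis
    proof (cases "\<exists>S. finite S \<and> (\<forall>s\<in>S. - s \<in> S) \<and> S \<subseteq> L \<and> infinite (gen S)")
      case True
      then obtain S where S: "finite S" "\<forall>s\<in>S. - s \<in> S" "S \<subseteq> L" "infinite (gen S)" by blast
      show ?thesis
      proof (rule primitive_extend[OF S(2-4)])
        fix g assume g: "g \<in> L"
        let ?T = "insert g (insert (- g) S)"
        have "infinite (gen ?T)" by (rule infinite_super[OF gen_mono S(4)]) auto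
        then obtain v where "primitive v (gen ?T)" using ex[of ?T] S g LD(3) by auto
        then show "\<exists>v. primitive v (insert g S)"
          using gen_subset[of ?T] unfolding primitive_def by (intro exI[of _ v]) blast
      qed
    next
      case False
      then have fin: "\<And>S. finite S \<Longrightarrow> \<forall>s\<in>S. - s \<in> S \<Longrightarrow> S \<subseteq> L \<Longrightarrow> finite (gen S)" by blast
      have "\<exists>r\<in>uminus ` R. g - r \<in> L" for g
      proof -
        obtain r where r: "r \<in> R" "- r + - g \<in> L" using R(2)[of "- g"] by blast
        have "- (- r + - g) \<in> L" using LD(3)[OF r(2)] .
        then show ?thesis using r(1) by (auto simp: minus_add simp del: add_uminus_conv_diff)
      qed
      then show ?thesis using locally_finite_primitive[OF fin, of "uminus ` R"] R(1) by blast
    qed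
  qed
  then show ?thesis using primitive_imp_divides by blast
qed

section \<open>Characters and duality\<close>

text \<open>The Pontryagin pairing of the group ring with the torus, in multiplicative
  notation.\<close>

definition chi :: "('g \<Rightarrow> int) \<Rightarrow> ('g \<Rightarrow> complex) \<Rightarrow> complex" where
  "chi h x = (\<Prod>g | h g \<noteq> 0. x g powi h g)"

lemma torus_pow_nonzero: "x \<in> torus_pow \<Longrightarrow> x g \<noteq> 0"
  unfolding torus_pow_def by (metis (mono_tags, lifting) mem_Collect_eq norm_zero zero_neq_one)

lemma chi_superset:
  assumes "finite F" "{g. h g \<noteq> 0} \<subseteq> F"
  shows "chi h x = (\<Prod>g\<in>F. x g powi h g)"
  unfolding chi_def by (rule prod.mono_neutral_left) (use assms in auto)

lemma group_ring_add: "h \<in> group_ring \<Longrightarrow> k \<in> group_ring \<Longrightarrow> h + k \<in> group_ring"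
  unfolding group_ring_def by (auto intro: finite_subset[of _ "{g. h g \<noteq> 0} \<union> {g. k g \<noteq> 0}"])

lemma group_ring_uminus: "h \<in> group_ring \<Longrightarrow> - h \<in> group_ring"
  unfolding group_ring_def by simp

lemma group_ring_0: "0 \<in> group_ring"
  unfolding group_ring_def by simp

lemma group_ring_single: "(\<lambda>g. of_bool (g = k)) \<in> group_ring"
  unfolding group_ring_def by simp

lemma group_ring_translate:
  fixes h :: "'g::group_add \<Rightarrow> int"
  shows "h \<in> group_ring \<Longrightarrow> (\<lambda>g. h (a + g)) \<in> group_ring"
  using finite_support_translate[of h a] unfolding group_ring_def finite_support_def by simp

lemma chi_0 [simp]: "chi 0 x = 1"
  unfolding chi_def by simp

lemma chi_add:
  assumes "h \<in> group_ring" "k \<in> group_ring" "x \<in> torus_pow"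
  shows "chi (h + k) x = chi h x * chi k x"
proof -
  let ?F = "{g. h g \<noteq> 0} \<union> {g. k g \<noteq> 0}"
  have F: "finite ?F" using assms unfolding group_ring_def by simp
  have "chi (h + k) x = (\<Prod>g\<in>?F. x g powi (h + k) g)" by (rule chi_superset[OF F]) auto
  also have "\<dots> = (\<Prod>g\<in>?F. x g powi h g) * (\<Prod>g\<in>?F. x g powi k g)"
    using torus_pow_nonzero[OF assms(3)] by (simp add: power_int_add prod.distrib)
  also have "\<dots> = chi h x * chi k x"
    using chi_superset[OF F, of h x] chi_superset[OF F, of k x] by auto
  finally show ?thesis .
qed

lemma norm_chi: "x \<in> torus_pow \<Longrightarrow> cmod (chi h x) = 1"
  unfolding chi_def torus_pow_def by (simp add: norm_power_int flip: prod_norm)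

lemma chi_uminus:
  assumes "x \<in> torus_pow"
  shows "chi (- h) x = cnj (chi h x)"
proof -
  have "chi (- h) x = inverse (chi h x)"
    unfolding chi_def by (simp add: power_int_minus flip: prod_inversef)
  also have "\<dots> = cnj (chi h x)"
    using norm_chi[OF assms, of h] by (simp add: inverse_eq_divide divide_conv_cnj)
  finally show ?thesis .
qed

lemma chi_mult: "chi h (\<lambda>g. x g * y g) = chi h x * chi h y"
  unfolding chi_def by (simp add: power_int_mult_distrib prod.distrib)

lemma chi_cnj: "chi h (\<lambda>g. cnj (x g)) = cnj (chi h x)"
  unfolding chi_def by simp

lemma chi_single: "chi (\<lambda>g. of_bool (g = k)) x = x k"
  by (subst chi_superset[of "{k}"]) auto

lemma chi_reindex:
  assumes "bij e"
  shows "chi h (x \<circ> e) = chi (h \<circ> inv e) x"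
proof -
  have "bij_betw e {n. h n \<noteq> 0} {g. (h \<circ> inv e) g \<noteq> 0}"
    by (rule bij_betw_byWitness[where f' = "inv e"])
      (use assms in \<open>auto simp: bij_is_inj bij_is_surj surj_f_inv_f\<close>)
  then show ?thesis unfolding chi_def
    using prod.reindex_bij_betw[of e _ _ "\<lambda>g. x g powi (h \<circ> inv e) g"] assms
    by (auto simp: bij_is_inj comp_def)
qed

lemma chi_lshift: "chi h (lshift a x) = chi (\<lambda>g. h (a + g)) x"
proof -
  have b: "bij ((+) (- a))" by (rule bij_betw_byWitness[where f' = "(+) a"]) auto
  have "inv ((+) (- a)) = (+) a" by (rule inv_equality) auto
  then have "chi h (x \<circ> (+) (- a)) = chi (h \<circ> (+) a) x" using chi_reindex[OF b, of h x] by simp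
  then show ?thesis by (simp add: comp_def lshift_def[abs_def])
qed

text \<open>This exhibits \<open>X_f\<close> as the set of points at which the characters of all
  left translates of \<open>f\<close> are trivial.\<close>

lemma rho_eq_chi: "rho f x a = chi (\<lambda>g. f (- a + g)) x"
  unfolding chi_lshift[symmetric] rho_def chi_def lshift_def by simp

section \<open>Integer functions as a group, and extension of characters\<close>

lemma sum_fun_apply: "(\<Sum>i\<in>I. h i) x = (\<Sum>i\<in>I. (h i x :: int))"
  by (induction I rule: infinite_finite_induct) auto

lemma zmul_fun: "zmul m (h :: 'g \<Rightarrow> int) = (\<lambda>g. m * h g)"
  by (induction m rule: int_induct[where k = 0]) (auto simp: zmul_Suc zmul_pred fun_eq_iff algebra_simps)

text \<open>A partial character is kept as a subgroup of the product with the circle that has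
  trivial fibre over 0. As sets of pairs, chains have unions as upper bounds, and single-valuedness
  is checked over 0 alone.\<close>

definition char_graph :: "('a::ab_group_add \<times> complex) set \<Rightarrow> bool" where
  "char_graph F \<longleftrightarrow> (0, 1) \<in> F \<and> (\<forall>a z b w. (a, z) \<in> F \<longrightarrow> (b, w) \<in> F \<longrightarrow> (a + b, z * w) \<in> F) \<and>
     (\<forall>a z. (a, z) \<in> F \<longrightarrow> (- a, inverse z) \<in> F) \<and> (\<forall>a z. (a, z) \<in> F \<longrightarrow> cmod z = 1) \<and>
     (\<forall>z. (0, z) \<in> F \<longrightarrow> z = 1)"

lemma char_graphD:
  assumes "char_graph F"
  shows "(0, 1) \<in> F" "(a, z) \<in> F \<Longrightarrow> (b, w) \<in> F \<Longrightarrow> (a + b, z * w) \<in> F"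
    "(a, z) \<in> F \<Longrightarrow> (- a, inverse z) \<in> F" "(a, z) \<in> F \<Longrightarrow> cmod z = 1" "(0, z) \<in> F \<Longrightarrow> z = 1"
  using assms unfolding char_graph_def by blast+

lemma char_graph_unique:
  assumes F: "char_graph F" and "(a, z) \<in> F" "(a, w) \<in> F"
  shows "z = w"
proof -
  have "(0, z * inverse w) \<in> F"
    using char_graphD(2)[OF F assms(2) char_graphD(3)[OF F assms(3)]] by simp
  then have "z * inverse w = 1" by (rule char_graphD(5)[OF F])
  moreover have "w \<noteq> 0" using char_graphD(4)[OF F assms(3)] by auto
  ultimately show ?thesis by (simp add: field_simps)
qed

lemma char_graph_zmul:
  assumes F: "char_graph F" and "(a, z) \<in> F"
  shows "(zmul m a, z powi m) \<in> F"
proof -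
  have z: "z \<noteq> 0" using char_graphD(4)[OF assms] by auto
  show ?thesis
  proof (induction m rule: int_induct[where k = 0])
    case (step1 i)
    have "z powi (i + 1) = z * z powi i" using z by (simp add: power_int_add)
    then show ?case using char_graphD(2)[OF F assms(2) step1(2)] by (simp add: zmul_Suc)
  next
    case (step2 i)
    have "z powi (i - 1) = inverse z * z powi i" using z by (simp add: power_int_diff field_simps)
    then show ?case
      using char_graphD(2)[OF F char_graphD(3)[OF F assms(2)] step2(2)] by (simp add: zmul_pred)
  qed (simp add: char_graphD(1)[OF F])
qed

text \<open>Adjoins the multiples of \<open>(a, \<zeta>)\<close>; \<open>compat\<close> is what
  keeps the fibre over 0 trivial.\<close>

lemma char_graph_extend:
  assumes F: "char_graph F" and \<zeta>: "cmod \<zeta> = 1"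
    and compat: "\<And>m z. (zmul m a, z) \<in> F \<Longrightarrow> \<zeta> powi m = z"
  obtains F' where "char_graph F'" "F \<subseteq> F'" "(a, \<zeta>) \<in> F'"
proof -
  let ?G = "{(b + zmul m a, z * \<zeta> powi m) | b z m. (b, z) \<in> F}"
  have \<zeta>0: "\<zeta> \<noteq> 0" using \<zeta> by auto
  have mem: "(b + zmul m a, z * \<zeta> powi m) \<in> ?G" if "(b, z) \<in> F" for b z m using that by blast
  have sub: "F \<subseteq> ?G"
  proof safe
    fix b z assume "(b, z) \<in> F"
    then show "\<exists>b' z' m. (b, z) = (b' + zmul m a, z' * \<zeta> powi m) \<and> (b', z') \<in> F"
      by (intro exI[of _ b] exI[of _ z] exI[of _ 0]) simp
  qed
  have "char_graph ?G"
    unfolding char_graph_def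
  proof (intro conjI allI impI)
    show "(0, 1) \<in> ?G" using sub char_graphD(1)[OF F] by blast
  next
    fix x u y v assume "(x, u) \<in> ?G" "(y, v) \<in> ?G"
    then obtain b z m b' z' m' where *: "x = b + zmul m a" "u = z * \<zeta> powi m" "(b, z) \<in> F"
      "y = b' + zmul m' a" "v = z' * \<zeta> powi m'" "(b', z') \<in> F" by blast
    have "x + y = (b + b') + zmul (m + m') a" unfolding * by (simp add: zmul_add algebra_simps)
    moreover have "u * v = (z * z') * \<zeta> powi (m + m')" unfolding * using \<zeta>0 by (simp add: power_int_add)
    ultimately show "(x + y, u * v) \<in> ?G" using mem[OF char_graphD(2)[OF F *(3,6)], of "m + m'"] by simp
  next
    fix x u assume "(x, u) \<in> ?G"
    then obtain b z m where *: "x = b + zmul m a" "u = z * \<zeta> powi m" "(b, z) \<in> F" by blast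
    have "- x = - b + zmul (- m) a" unfolding * by (simp add: zmul_uminus)
    moreover have "inverse u = inverse z * \<zeta> powi (- m)" unfolding * by (simp add: power_int_minus)
    ultimately show "(- x, inverse u) \<in> ?G" using mem[OF char_graphD(3)[OF F *(3)], of "- m"] by simp
    show "cmod u = 1" unfolding * using char_graphD(4)[OF F *(3)] \<zeta> by (simp add: norm_mult norm_power_int)
  next
    fix u assume "(0, u) \<in> ?G"
    then obtain b z m where *: "0 = b + zmul m a" "u = z * \<zeta> powi m" "(b, z) \<in> F" by blast
    have "zmul m a = - b" using *(1) by (simp add: eq_neg_iff_add_eq_0 add.commute)
    then have "\<zeta> powi m = inverse z" using compat char_graphD(3)[OF F *(3)] by metis
    moreover have "z \<noteq> 0" using char_graphD(4)[OF F *(3)] by auto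
    ultimately show "u = 1" unfolding * by simp
  qed
  moreover have "(0 + zmul 1 a, 1 * \<zeta> powi 1) \<in> ?G" using char_graphD(1)[OF F] by blast
  ultimately show ?thesis using that[of ?G] sub by simp
qed

text \<open>By division with remainder, the multiples of \<open>a\<close> in the domain are the
  multiples of the least positive one, so the value has to fit only there.\<close>

lemma char_graph_compat:
  assumes F: "char_graph F" and n: "0 < n" "(zmul (int n) a, z) \<in> F" "\<zeta> ^ n = z"
    and least: "\<And>m w. 0 < m \<Longrightarrow> m < n \<Longrightarrow> (zmul (int m) a, w) \<notin> F"
    and m: "(zmul m a, w) \<in> F"
  shows "\<zeta> powi m = w"
proof -
  let ?q = "m div int n"
  have "(zmul m a + - zmul ?q (zmul (int n) a), w * inverse (z powi ?q)) \<in> F"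
    using char_graphD(2)[OF F m char_graphD(3)[OF F char_graph_zmul[OF F n(2)]]] .
  also have "zmul m a + - zmul ?q (zmul (int n) a) = zmul (m mod int n) a"
    using zmul_diff[of m "?q * int n" a] by (simp add: zmul_zmul minus_div_mult_eq_mod)
  finally have mod: "(zmul (m mod int n) a, w * inverse (z powi ?q)) \<in> F" .
  have "m mod int n = int (nat (m mod int n))" "nat (m mod int n) < n"
    using n(1) by (auto simp: nat_less_iff)
  then have "nat (m mod int n) = 0" using least mod by (metis gr0I)
  then have m0: "m mod int n = 0" using n(1) by (metis \<open>m mod int n = int (nat (m mod int n))\<close> of_nat_0)
  then have "w * inverse (z powi ?q) = 1" using mod char_graphD(5)[OF F] by simp
  moreover have "z \<noteq> 0" using char_graphD(4)[OF F n(2)] by auto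
  ultimately have "w = z powi ?q" by (simp add: field_simps)
  also have "\<dots> = \<zeta> powi (int n * ?q)" by (simp add: power_int_mult flip: n(3))
  also have "int n * ?q = m" using m0 by (metis add.right_neutral mult_div_mod_eq)
  finally show ?thesis by simp
qed

lemma char_graph_compat_free:
  assumes F: "char_graph F" and free: "\<And>m w. 0 < m \<Longrightarrow> (zmul (int m) a, w) \<notin> F"
    and m: "(zmul m a, w) \<in> F"
  shows "\<zeta> powi m = w"
proof -
  have "\<not> 0 < m" using free[of "nat m"] m by auto
  moreover have "\<not> m < 0"
    using free[of "nat (- m)"] char_graphD(3)[OF F m] by (auto simp: zmul_uminus)
  ultimately have "m = 0" by simp
  then show ?thesis using char_graphD(5)[OF F] m by simp
qed

lemma char_graph_add_point:
  assumes F: "char_graph F"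
  obtains F' \<zeta> where "char_graph F'" "F \<subseteq> F'" "(a, \<zeta>) \<in> F'"
proof (cases "\<exists>n>0. \<exists>z. (zmul (int n) a, z) \<in> F")
  case True
  define n where "n = (LEAST n. 0 < n \<and> (\<exists>z. (zmul (int n) a, z) \<in> F))"
  have "0 < n \<and> (\<exists>z. (zmul (int n) a, z) \<in> F)" unfolding n_def by (rule LeastI_ex) (use True in blast)
  then obtain z where n: "0 < n" "(zmul (int n) a, z) \<in> F" by blast
  have least: "(zmul (int m) a, w) \<notin> F" if "0 < m" "m < n" for m w
    using not_less_Least[of m "\<lambda>n. 0 < n \<and> (\<exists>z. (zmul (int n) a, z) \<in> F)"] that unfolding n_def by blast
  have z: "z = cis (Arg z)" using char_graphD(4)[OF F n(2)] rcis_cmod_Arg[of z] by (simp add: rcis_def)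
  let ?\<zeta> = "cis (Arg z / real n)"
  have "?\<zeta> ^ n = cis (real n * (Arg z / real n))" by (rule Complex.DeMoivre)
  then have "?\<zeta> ^ n = z" using n(1) z by simp
  then have "?\<zeta> powi m = w" if "(zmul m a, w) \<in> F" for m w
    using char_graph_compat[OF F n _ least that] by blast
  then obtain F' where "char_graph F'" "F \<subseteq> F'" "(a, ?\<zeta>) \<in> F'"
    using char_graph_extend[OF F norm_cis, of a] by metis
  then show ?thesis by (rule that)
next
  case False
  then have "1 powi m = w" if "(zmul m a, w) \<in> F" for m w
    using char_graph_compat_free[OF F _ that] by blast
  then obtain F' where "char_graph F'" "F \<subseteq> F'" "(a, 1) \<in> F'"
    using char_graph_extend[OF F norm_one, of a] by metis
  then show ?thesis by (rule that)
qed

text \<open>A character extends to one more element because the circle is divisible; Zorn's lemma does the rest.\<close>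

theorem character_separating_subgroup:
  fixes H :: "'a::ab_group_add set"
  assumes H: "add_subgroup H" and k: "k \<notin> H"
  obtains \<phi> where "\<And>a b. \<phi> (a + b) = \<phi> a * \<phi> b" "\<And>a. cmod (\<phi> a) = 1" "\<And>a. a \<in> H \<Longrightarrow> \<phi> a = 1" "\<phi> k \<noteq> 1"
proof -
  note HD = add_subgroupD[OF H]
  let ?F0 = "H \<times> {1 :: complex}"
  have F0: "char_graph ?F0" unfolding char_graph_def using HD by auto
  \<comment> \<open>\<open>k\<close> gets a nontrivial value before the maximal extension is taken:
    a primitive n-th root of unity if \<open>k\<close> has finite order n modulo \<open>H\<close>,
    and \<open>- 1\<close> otherwise.\<close>
  have "\<exists>\<zeta> F1. \<zeta> \<noteq> 1 \<and> char_graph F1 \<and> ?F0 \<subseteq> F1 \<and> (k, \<zeta>) \<in> F1"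
  proof (cases "\<exists>n>0. zmul (int n) k \<in> H")
    case True
    define n where "n = (LEAST n. 0 < n \<and> zmul (int n) k \<in> H)"
    have n: "0 < n \<and> zmul (int n) k \<in> H" unfolding n_def by (rule LeastI_ex) (use True in blast)
    have least: "(zmul (int m) k, w) \<notin> ?F0" if "0 < m" "m < n" for m w
      using not_less_Least[of m "\<lambda>n. 0 < n \<and> zmul (int n) k \<in> H"] that unfolding n_def by blast
    let ?\<zeta> = "cis (2 * pi / real n)"
    have "n \<noteq> 1" using n k by auto
    then have n2: "2 \<le> n" using n by linarith
    have "?\<zeta> ^ n = cis (real n * (2 * pi / real n))" by (rule Complex.DeMoivre)
    then have "?\<zeta> ^ n = 1" using n by simp
    moreover have "?\<zeta> \<noteq> 1"
    proof
      assume "?\<zeta> = 1"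
      then have "cos (2 * pi / real n) = 1" by (metis cis.sel(1) one_complex.sel(1))
      then obtain j where "2 * pi / real n = of_int j * 2 * pi" by (auto simp: cos_one_2pi_int)
      then have "(2 * pi) * (1 / real n) = (2 * pi) * of_int j" by simp
      then have "1 / real n = of_int j" by (subst (asm) mult_cancel_left) simp
      moreover have "0 < 1 / real n" "1 / real n < 1" using n2 by auto
      ultimately have "0 < j" "j < 1" by linarith+
      then show False by simp
    qed
    moreover have "?\<zeta> powi m = w" if "(zmul m k, w) \<in> ?F0" for m w
      using char_graph_compat[OF F0 _ _ calculation(1) least that] n by auto
    then obtain F1 where "char_graph F1" "?F0 \<subseteq> F1" "(k, ?\<zeta>) \<in> F1"
      by (rule char_graph_extend[OF F0 norm_cis])
    ultimately show ?thesis by blast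
  next
    case False
    then have "(- 1 :: complex) powi m = w" if "(zmul m k, w) \<in> ?F0" for m w
      using char_graph_compat_free[OF F0 _ that] by blast
    moreover have "cmod (- 1) = 1" by simp
    ultimately obtain F1 where "char_graph F1" "?F0 \<subseteq> F1" "(k, - 1) \<in> F1"
      using char_graph_extend[OF F0, of "- 1" k] by blast
    moreover have "(- 1 :: complex) \<noteq> 1" by simp
    ultimately show ?thesis by blast
  qed
  then obtain \<zeta> F1 where F1: "\<zeta> \<noteq> 1" "char_graph F1" "?F0 \<subseteq> F1" "(k, \<zeta>) \<in> F1" by blast
  let ?A = "{F. char_graph F \<and> F1 \<subseteq> F}"
  have "\<exists>M\<in>?A. \<forall>F\<in>?A. M \<subseteq> F \<longrightarrow> F = M"
  proof (rule subset_Zorn_nonempty)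
    show "?A \<noteq> {}" using F1 by blast
    fix C assume C: "C \<noteq> {}" "subset.chain ?A C"
    have CA: "char_graph F" "F1 \<subseteq> F" if "F \<in> C" for F
      using C(2) that unfolding subset.chain_def by blast+
    have pair: "\<exists>F\<in>C. p \<in> F \<and> q \<in> F" if "p \<in> \<Union> C" "q \<in> \<Union> C" for p q
      using that C(2) unfolding subset.chain_def by blast
    have "char_graph (\<Union> C)" unfolding char_graph_def
    proof (intro conjI allI impI)
      show "(0, 1) \<in> \<Union> C" using C(1) CA char_graphD(1) by blast
    next
      fix a z b w assume "(a, z) \<in> \<Union> C" "(b, w) \<in> \<Union> C"
      then obtain F where F: "F \<in> C" "(a, z) \<in> F" "(b, w) \<in> F" using pair by blast
      then show "(a + b, z * w) \<in> \<Union> C" using char_graphD(2)[OF CA(1)[OF F(1)]] by blast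
    next
      fix a z assume "(a, z) \<in> \<Union> C"
      then obtain F where F: "F \<in> C" "(a, z) \<in> F" by blast
      then show "(- a, inverse z) \<in> \<Union> C" using char_graphD(3)[OF CA(1)[OF F(1)]] by blast
      show "cmod z = 1" using F char_graphD(4)[OF CA(1)[OF F(1)]] by blast
    next
      fix z assume "(0, z) \<in> \<Union> C"
      then obtain F where F: "F \<in> C" "(0, z) \<in> F" by blast
      then show "z = 1" using char_graphD(5)[OF CA(1)[OF F(1)]] by blast
    qed
    then show "\<Union> C \<in> ?A" using C(1) CA by blast
  qed
  then obtain F where "F \<in> ?A" and F_max: "\<forall>F'\<in>?A. F \<subseteq> F' \<longrightarrow> F' = F" by (rule bexE)
  then have F: "char_graph F" "F1 \<subseteq> F" by auto
  have max: "F' = F" if "char_graph F'" "F \<subseteq> F'" for F' using that F F_max by auto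
  have "\<exists>z. (a, z) \<in> F" for a
  proof -
    obtain F' z where "char_graph F'" "F \<subseteq> F'" "(a, z) \<in> F'" using char_graph_add_point[OF F(1)] by blast
    then show ?thesis using max by blast
  qed
  then obtain \<phi> where \<phi>: "\<And>a. (a, \<phi> a) \<in> F" by metis
  note uniq = char_graph_unique[OF F(1)]
  show ?thesis
  proof (rule that[of \<phi>])
    show "\<phi> (a + b) = \<phi> a * \<phi> b" for a b
      using uniq[OF \<phi>[of "a + b"] char_graphD(2)[OF F(1) \<phi> \<phi>]] .
    show "cmod (\<phi> a) = 1" for a using char_graphD(4)[OF F(1) \<phi>] .
    show "\<phi> a = 1" if "a \<in> H" for a using uniq[OF \<phi>[of a], of 1] that F1(3) F(2) by blast
    show "\<phi> k \<noteq> 1" using uniq[OF \<phi>[of k], of \<zeta>] F1(1,4) F(2) by blast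
  qed
qed

section \<open>Duality between \<open>X_f\<close> and the left ideal generated by
  \<open>f\<close>\<close>

definition left_multiples :: "('g::group_add \<Rightarrow> int) \<Rightarrow> ('g \<Rightarrow> int) set" where
  "left_multiples f = {h \<in> group_ring. \<exists>w\<in>group_ring. \<forall>x. conv (\<lambda>y. real_of_int (w y)) f x = of_int (h x)}"

lemma add_subgroup_left_multiples:
  assumes f: "f \<in> group_ring"
  shows "add_subgroup (left_multiples f)"
  unfolding add_subgroup_def
proof (intro conjI ballI)
  have "conv (\<lambda>y. real_of_int (0 y)) f x = of_int (0 x)" for x by (simp add: conv_eq[OF f])
  then show "0 \<in> left_multiples f" unfolding left_multiples_def using group_ring_0 by blast
next
  fix a b assume "a \<in> left_multiples f" "b \<in> left_multiples f"
  then obtain v w where *: "a \<in> group_ring" "b \<in> group_ring" "v \<in> group_ring" "w \<in> group_ring"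
    "\<And>x. conv (\<lambda>y. real_of_int (v y)) f x = of_int (a x)" "\<And>x. conv (\<lambda>y. real_of_int (w y)) f x = of_int (b x)"
    unfolding left_multiples_def by blast
  have "conv (\<lambda>y. real_of_int ((v + w) y)) f x = of_int ((a + b) x)" for x
    using *(5,6)[of x] by (simp add: conv_eq[OF f] distrib_right sum.distrib)
  then show "a + b \<in> left_multiples f" unfolding left_multiples_def using * group_ring_add by blast
next
  fix a assume "a \<in> left_multiples f"
  then obtain v where *: "a \<in> group_ring" "v \<in> group_ring"
    "\<And>x. conv (\<lambda>y. real_of_int (v y)) f x = of_int (a x)"
    unfolding left_multiples_def by blast
  have "conv (\<lambda>y. real_of_int ((- v) y)) f x = of_int ((- a) x)" for x
    using *(3)[of x] by (simp add: conv_eq[OF f] sum_negf)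
  then show "- a \<in> left_multiples f" unfolding left_multiples_def using * group_ring_uminus by blast
qed

lemma translate_in_left_multiples:
  assumes f: "f \<in> group_ring"
  shows "(\<lambda>g. f (- a + g)) \<in> left_multiples f"
proof -
  have "conv (\<lambda>y. real_of_int (of_bool (y = a))) f x = of_int (f (- a + x))" for x
    unfolding conv_def
    using infsum_cong_neutral[of "{a}" UNIV "\<lambda>y. real_of_int (of_bool (y = a)) * of_int (f (- y + x))"
        "\<lambda>y. real_of_int (of_bool (y = a)) * of_int (f (- y + x))"] by simp
  then show ?thesis
    unfolding left_multiples_def using group_ring_translate[OF f] group_ring_single[of a]
    by (auto intro!: bexI[of _ "\<lambda>y. of_bool (y = a)"])
qed

text \<open>\<open>\<phi>\<close> lives on all integer functions. On finitely supported ones it is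
  determined by its values at point masses, and these are the coordinates of a point of the
  torus.\<close>

lemma hom_eq_chi:
  assumes hom: "\<And>a b. \<phi> (a + b) = \<phi> a * \<phi> b" and unit: "\<And>a. cmod (\<phi> a) = 1"
    and h: "h \<in> group_ring"
  shows "\<phi> h = chi h (\<lambda>g. \<phi> (\<lambda>k. of_bool (k = g)))"
proof -
  have nz: "\<phi> a \<noteq> 0" for a using unit[of a] by auto
  have "\<phi> 0 * \<phi> 0 = \<phi> 0" using hom[of 0 0] by simp
  then have one: "\<phi> 0 = 1" using nz by simp
  have neg: "\<phi> (- a) = inverse (\<phi> a)" for a
    using hom[of a "- a"] one nz by (simp add: field_simps)
  have mul: "\<phi> (zmul m a) = \<phi> a powi m" for m a
  proof (induction m rule: int_induct[where k = 0])
    case (step1 i)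
    have "\<phi> (zmul (i + 1) a) = \<phi> a * \<phi> (zmul i a)" unfolding zmul_Suc by (rule hom)
    then show ?case using nz step1 by (simp add: power_int_add)
  next
    case (step2 i)
    have "\<phi> (zmul (i - 1) a) = \<phi> (- a) * \<phi> (zmul i a)" unfolding zmul_pred by (rule hom)
    then show ?case using nz step2 by (simp add: neg power_int_diff field_simps)
  qed (simp only: zmul_0 one power_int_0_right)
  have prod: "\<phi> (\<Sum>g\<in>F. zmul (h g) (\<lambda>k. of_bool (k = g))) = (\<Prod>g\<in>F. \<phi> (\<lambda>k. of_bool (k = g)) powi h g)"
    if "finite F" for F using that
  proof (induction F)
    case (insert x F)
    then show ?case by (simp only: sum.insert prod.insert not_False_eq_True hom mul)
  qed (simp only: sum.empty prod.empty one)
  have sum: "(\<Sum>g | h g \<noteq> 0. zmul (h g) (\<lambda>k. of_bool (k = g))) = h"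
  proof
    fix k
    have "(\<Sum>g | h g \<noteq> 0. zmul (h g) (\<lambda>k. of_bool (k = g))) k = (\<Sum>g | h g \<noteq> 0. if k = g then h g else 0)"
      unfolding zmul_fun sum_fun_apply by (rule sum.cong) auto
    also have "\<dots> = h k" using h unfolding group_ring_def by (simp add: sum.delta)
    finally show "(\<Sum>g | h g \<noteq> 0. zmul (h g) (\<lambda>k. of_bool (k = g))) k = h k" .
  qed
  have "finite {g. h g \<noteq> 0}" using h unfolding group_ring_def by simp
  from prod[OF this, unfolded sum] show ?thesis unfolding chi_def .
qed

text \<open>A character that is trivial on the left ideal and separates \<open>k\<close> from it
  would be a point of \<open>X_f\<close> where \<open>chi k\<close> is not 1.\<close>

theorem trivial_on_X_f:
  assumes f: "f \<in> group_ring" and k: "k \<in> group_ring" and triv: "\<And>x. x \<in> X_f f \<Longrightarrow> chi k x = 1"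
  shows "k \<in> left_multiples f"
proof (rule ccontr)
  assume "k \<notin> left_multiples f"
  then obtain \<phi> :: "('a \<Rightarrow> int) \<Rightarrow> complex" where \<phi>: "\<And>a b. \<phi> (a + b) = \<phi> a * \<phi> b" "\<And>a. cmod (\<phi> a) = 1"
    "\<And>a. a \<in> left_multiples f \<Longrightarrow> \<phi> a = 1" "\<phi> k \<noteq> 1"
    using character_separating_subgroup[OF add_subgroup_left_multiples[OF f]] by metis
  define x where "x g = \<phi> (\<lambda>k. of_bool (k = g))" for g
  have chi: "chi h x = \<phi> h" if "h \<in> group_ring" for h
    unfolding x_def[abs_def] using hom_eq_chi[OF \<phi>(1,2) that] by simp
  have "x \<in> X_f f"
    unfolding X_f_def torus_pow_def rho_eq_chi
    using \<phi>(2,3) chi group_ring_translate[OF f] translate_in_left_multiples[OF f]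
    by (auto simp: x_def)
  then show False using triv chi[OF k] \<phi>(4) by simp
qed

text \<open>The converse half of the duality: \<open>k\<close> is an integer combination of left
  translates of \<open>f\<close>, whose characters are trivial on \<open>X_f\<close>.\<close>

lemma left_multiples_trivial:
  assumes f: "f \<in> group_ring" and k: "k \<in> left_multiples f" and x: "x \<in> X_f f"
  shows "chi k x = 1"
proof -
  obtain w where w: "w \<in> group_ring" "\<And>x. conv (\<lambda>y. real_of_int (w y)) f x = of_int (k x)"
    using k unfolding left_multiples_def by blast
  have xT: "x \<in> torus_pow" and rho: "chi (\<lambda>g. f (- a + g)) x = 1" for a
    using x unfolding X_f_def rho_eq_chi by auto
  have fin: "finite {a. w a \<noteq> 0}" using w unfolding group_ring_def by simp
  have "real_of_int (k g) = (\<Sum>a | w a \<noteq> 0. real_of_int (w a) * of_int (f (- a + g)))" for g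
    unfolding w(2)[symmetric] conv_def infsum_finite[OF fin, symmetric]
    by (rule infsum_cong_neutral) auto
  then have keq: "k g = (\<Sum>a | w a \<noteq> 0. w a * f (- a + g))" for g
    by (metis (mono_tags, lifting) of_int_eq_iff of_int_mult of_int_sum sum.cong)
  have mul: "zmul m h \<in> group_ring \<and> chi (zmul m h) x = chi h x powi m" if h: "h \<in> group_ring" for m h
  proof -
    have "zmul m h \<in> group_ring" using h unfolding zmul_fun group_ring_def
      by (auto elim: rev_finite_subset)
    moreover have "chi (zmul m h) x = chi h x powi m"
    proof -
      have "chi (zmul m h) x = (\<Prod>g | h g \<noteq> 0. x g powi (zmul m h) g)"
        by (rule chi_superset) (use h in \<open>auto simp: group_ring_def zmul_fun\<close>)
      also have "\<dots> = (\<Prod>g | h g \<noteq> 0. (x g powi h g) powi m)"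
        by (simp add: zmul_fun mult.commute[of m] power_int_mult)
      also have "\<dots> = (\<Prod>g | h g \<noteq> 0. x g powi h g) powi m"
        by (induction rule: infinite_finite_induct) (auto simp: power_int_mult_distrib)
      finally show ?thesis unfolding chi_def .
    qed
    ultimately show ?thesis by blast
  qed
  have sum: "(\<Sum>a\<in>F. h a) \<in> group_ring \<and> chi (\<Sum>a\<in>F. h a) x = (\<Prod>a\<in>F. chi (h a) x)"
    if "finite F" "\<And>a. h a \<in> group_ring" for F :: "'a set" and h
    using that by (induction F) (auto simp: group_ring_0 group_ring_add chi_add[OF _ _ xT])
  have "k = (\<Sum>a | w a \<noteq> 0. zmul (w a) (\<lambda>g. f (- a + g)))"
    by (rule ext) (simp add: keq sum_fun_apply zmul_fun)
  then have "chi k x = (\<Prod>a | w a \<noteq> 0. chi (zmul (w a) (\<lambda>g. f (- a + g))) x)"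
    using sum[OF fin, of "\<lambda>a. zmul (w a) (\<lambda>g. f (- a + g))"] mul group_ring_translate[OF f] by simp
  also have "\<dots> = 1" using mul group_ring_translate[OF f] rho by (simp add: prod.neutral)
  finally show ?thesis .
qed

section \<open>Measures determined by their Fourier coefficients\<close>

lemma compact_torus_pow: "compact (torus_pow :: ('g \<Rightarrow> complex) set)"
proof -
  have "torus_pow = (PiE UNIV (\<lambda>_. sphere 0 1) :: ('g \<Rightarrow> complex) set)"
    unfolding torus_pow_def by (auto simp: PiE_UNIV_domain)
  moreover have "compactin (product_topology (\<lambda>_. euclidean) UNIV) (PiE UNIV (\<lambda>_. sphere 0 1) :: ('g \<Rightarrow> complex) set)"
    by (subst compactin_PiE) simp
  ultimately show ?thesis by (simp add: euclidean_product_topology flip: compactin_euclidean_iff)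
qed

lemma continuous_on_chi:
  assumes "h \<in> group_ring"
  shows "continuous_on torus_pow (chi h)"
  unfolding chi_def[abs_def]
  by (intro continuous_on_prod continuous_on_power_int continuous_on_subset[OF continuous_on_product_coordinates])
    (auto simp: torus_pow_nonzero)

lemma measurable_coordinate: "(\<lambda>x. x g) \<in> borel_measurable (borel :: ('g \<Rightarrow> complex) measure)"
  by (rule borel_measurable_continuous_onI) simp

lemma measurable_chi: "chi h \<in> borel_measurable (borel :: ('g \<Rightarrow> complex) measure)"
proof -
  have "(\<lambda>x. x g powi k) \<in> borel_measurable (borel :: ('g \<Rightarrow> complex) measure)" for g k
    using measurable_coordinate[of g] unfolding power_int_def by (cases "0 \<le> k") auto
  then show ?thesis unfolding chi_def[abs_def] by (intro borel_measurable_prod) auto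
qed

inductive trig_poly :: "(('g \<Rightarrow> complex) \<Rightarrow> complex) \<Rightarrow> bool" where
  chi: "h \<in> group_ring \<Longrightarrow> trig_poly (\<lambda>x. a * chi h x)"
| add: "trig_poly p \<Longrightarrow> trig_poly q \<Longrightarrow> trig_poly (\<lambda>x. p x + q x)"

text \<open>The product is matched on the torus only, where coordinates are nonzero and exponents
  add up.\<close>

lemma trig_poly_mult:
  assumes "trig_poly p" "trig_poly q"
  shows "\<exists>r. trig_poly r \<and> (\<forall>x\<in>torus_pow. r x = p x * q x)"
  using assms
proof (induction p)
  case (chi h a)
  from \<open>trig_poly q\<close> show ?case
  proof (induction q)
    case (chi k b)
    show ?case
      by (rule exI[of _ "\<lambda>x. (a * b) * chi (h + k) x"])
        (use chi \<open>h \<in> group_ring\<close> in \<open>auto intro!: trig_poly.chi group_ring_add simp: chi_add\<close>)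
  next
    case (add p q)
    then obtain r s where "trig_poly r" "\<forall>x\<in>torus_pow. r x = a * chi h x * p x"
      "trig_poly s" "\<forall>x\<in>torus_pow. s x = a * chi h x * q x" by blast
    then show ?case
      by (intro exI[of _ "\<lambda>x. r x + s x"]) (auto intro: trig_poly.add simp: distrib_left)
  qed
next
  case (add p p')
  then obtain r s where "trig_poly r" "\<forall>x\<in>torus_pow. r x = p x * q x"
    "trig_poly s" "\<forall>x\<in>torus_pow. s x = p' x * q x" by blast
  then show ?case
    by (intro exI[of _ "\<lambda>x. r x + s x"]) (auto intro: trig_poly.add simp: distrib_right)
qed

lemma continuous_on_trig_poly: "trig_poly p \<Longrightarrow> continuous_on torus_pow p"
  by (induction rule: trig_poly.induct) (auto intro!: continuous_intros continuous_on_chi)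

text \<open>Real-valued functions are singled out for the real Stone-Weierstrass theorem; real and
  imaginary parts of coordinates then separate points.\<close>

definition real_trig_poly :: "(('g \<Rightarrow> complex) \<Rightarrow> real) \<Rightarrow> bool" where
  "real_trig_poly r \<longleftrightarrow> (\<exists>p. trig_poly p \<and> (\<forall>x\<in>torus_pow. p x = complex_of_real (r x)))"

lemma trig_poly_coordinate:
  "trig_poly (\<lambda>x. a * x g)" "\<exists>p. trig_poly p \<and> (\<forall>x\<in>torus_pow. p x = a * cnj (x g))"
proof -
  show "trig_poly (\<lambda>x. a * x g)"
    using trig_poly.chi[OF group_ring_single[of g], of a] by (simp add: chi_single)
  show "\<exists>p. trig_poly p \<and> (\<forall>x\<in>torus_pow. p x = a * cnj (x g))"
    using trig_poly.chi[OF group_ring_uminus[OF group_ring_single[of g]], of a]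
    by (intro exI conjI) (assumption, simp add: chi_uminus chi_single)
qed

lemma real_trig_poly_ring: "function_ring_on (Collect real_trig_poly) (torus_pow :: (nat \<Rightarrow> complex) set)"
proof
  show "compact (torus_pow :: (nat \<Rightarrow> complex) set)" by (rule compact_torus_pow)
next
  fix r :: "(nat \<Rightarrow> complex) \<Rightarrow> real" assume "r \<in> Collect real_trig_poly"
  then obtain p where p: "trig_poly p" "\<forall>x\<in>torus_pow. p x = complex_of_real (r x)"
    unfolding real_trig_poly_def by blast
  then have "continuous_on torus_pow (\<lambda>x. Re (p x))"
    by (intro continuous_intros continuous_on_trig_poly)
  then show "continuous_on torus_pow r" by (rule continuous_on_eq) (simp add: p(2))
next
  fix r s :: "(nat \<Rightarrow> complex) \<Rightarrow> real" assume "r \<in> Collect real_trig_poly" "s \<in> Collect real_trig_poly"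
  then obtain p q where pq: "trig_poly p" "\<forall>x\<in>torus_pow. p x = complex_of_real (r x)"
    "trig_poly q" "\<forall>x\<in>torus_pow. q x = complex_of_real (s x)"
    unfolding real_trig_poly_def by blast
  then show "(\<lambda>x. r x + s x) \<in> Collect real_trig_poly"
    unfolding real_trig_poly_def by (auto intro!: exI[of _ "\<lambda>x. p x + q x"] trig_poly.add)
  obtain m where "trig_poly m" "\<forall>x\<in>torus_pow. m x = p x * q x" using trig_poly_mult[OF pq(1,3)] by blast
  then show "(\<lambda>x. r x * s x) \<in> Collect real_trig_poly"
    unfolding real_trig_poly_def using pq(2,4) by auto
next
  fix c :: real
  have "trig_poly (\<lambda>x :: nat \<Rightarrow> complex. complex_of_real c * chi 0 x)" by (rule trig_poly.chi[OF group_ring_0])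
  then show "(\<lambda>_ :: nat \<Rightarrow> complex. c) \<in> Collect real_trig_poly"
    unfolding real_trig_poly_def by auto
next
  fix x y :: "nat \<Rightarrow> complex" assume xy: "x \<in> torus_pow" "y \<in> torus_pow" "x \<noteq> y"
  then obtain n where n: "x n \<noteq> y n" by auto
  have "real_trig_poly (\<lambda>x :: nat \<Rightarrow> complex. Re (x n))"
  proof -
    obtain p where p: "trig_poly p" "\<forall>x\<in>torus_pow. p x = 1/2 * cnj (x n)"
      using trig_poly_coordinate(2)[of "1/2" n] by blast
    have "1/2 * x n + 1/2 * cnj (x n) = complex_of_real (Re (x n))" for x :: "nat \<Rightarrow> complex"
      by (simp add: complex_eq_iff)
    then show ?thesis unfolding real_trig_poly_def
      using trig_poly.add[OF trig_poly_coordinate(1)[of "1/2" n] p(1)] p(2) by (metis (no_types, lifting))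
  qed
  moreover have "real_trig_poly (\<lambda>x :: nat \<Rightarrow> complex. Im (x n))"
  proof -
    obtain p where p: "trig_poly p" "\<forall>x\<in>torus_pow. p x = \<i>/2 * cnj (x n)"
      using trig_poly_coordinate(2)[of "\<i>/2" n] by blast
    have "- \<i>/2 * x n + \<i>/2 * cnj (x n) = complex_of_real (Im (x n))" for x :: "nat \<Rightarrow> complex"
      by (simp add: complex_eq_iff)
    then show ?thesis unfolding real_trig_poly_def
      using trig_poly.add[OF trig_poly_coordinate(1)[of "- \<i>/2" n] p(1)] p(2) by (metis (no_types, lifting))
  qed
  ultimately show "\<exists>r\<in>Collect real_trig_poly. r x \<noteq> r y"
    using n by (metis (mono_tags, lifting) complex_eqI mem_Collect_eq)
qed

text \<open>The coefficients determine integrals of trigonometric polynomials, then of continuous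
  functions by uniform approximation on the compact torus, then measures of closed sets by
  approximating indicators from above. The index type \<open>nat\<close> provides the metric on
  functions that \<open>infdist\<close> uses.\<close>

lemma measure_eqI_fourier_nat:
  fixes M N :: "(nat \<Rightarrow> complex) measure"
  assumes M: "finite_measure M" "sets M = sets borel" "AE x in M. x \<in> torus_pow"
    and N: "finite_measure N" "sets N = sets borel" "AE x in N. x \<in> torus_pow"
    and eq: "\<And>h. h \<in> group_ring \<Longrightarrow> (\<integral>x. chi h x \<partial>M) = (\<integral>x. chi h x \<partial>N)"
  shows "M = N"
proof -
  let ?T = "torus_pow :: (nat \<Rightarrow> complex) set"
  interpret ring: function_ring_on "Collect real_trig_poly" ?T by (rule real_trig_poly_ring)
  have trig_int: "integrable P p" if P: "finite_measure P" "sets P = sets borel" "AE x in P. x \<in> ?T" and p: "trig_poly p"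
    for P p
    using p
  proof induction
    case (chi h a)
    interpret finite_measure P by fact
    have "AE x in P. norm (a * chi h x) \<le> norm a"
      using P(3) by eventually_elim (simp add: norm_mult norm_chi)
    moreover have "chi h \<in> borel_measurable P"
      using measurable_chi measurable_cong_sets[OF P(2) refl] by blast
    ultimately show ?case by (intro integrable_const_bound) auto
  qed simp
  have trig_eq: "(\<integral>x. p x \<partial>M) = (\<integral>x. p x \<partial>N)" if "trig_poly p" for p
    using that
  proof induction
    case (chi h a)
    then show ?case using eq by simp
  next
    case (add p q)
    then show ?case using trig_int[OF M] trig_int[OF N] by simp
  qed
  have approx: "\<bar>(\<integral>x. \<phi> x \<partial>P) - Re (\<integral>x. p x \<partial>P)\<bar> \<le> e * measure P (space P)"
    if P: "finite_measure P" "sets P = sets borel" "AE x in P. x \<in> ?T" and p: "trig_poly p"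
      and int: "integrable P \<phi>"
      and close: "\<And>x. x \<in> ?T \<Longrightarrow> \<bar>\<phi> x - Re (p x)\<bar> \<le> e"
    for P p \<phi> and e :: real
  proof -
    interpret finite_measure P by fact
    have p_int: "integrable P (\<lambda>x. Re (p x))" using trig_int[OF P p] by simp
    have "(\<integral>x. \<phi> x \<partial>P) - Re (\<integral>x. p x \<partial>P) = (\<integral>x. \<phi> x - Re (p x) \<partial>P)"
      using int p_int trig_int[OF P p] by simp
    also have "\<bar>\<dots>\<bar> \<le> (\<integral>x. \<bar>\<phi> x - Re (p x)\<bar> \<partial>P)" by (rule integral_abs_bound)
    also have "\<dots> \<le> (\<integral>x. e \<partial>P)"
    proof (rule integral_mono_AE)
      show "AE x in P. \<bar>\<phi> x - Re (p x)\<bar> \<le> e" using P(3) by eventually_elim (rule close)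
    qed (use int p_int in auto)
    finally show ?thesis by (simp add: mult.commute)
  qed
  have cont_eq: "(\<integral>x. \<phi> x \<partial>M) = (\<integral>x. \<phi> x \<partial>N)"
    if \<phi>: "continuous_on UNIV \<phi>" "integrable M \<phi>" "integrable N \<phi>" for \<phi> :: "(nat \<Rightarrow> complex) \<Rightarrow> real"
  proof (rule ccontr)
    assume ne: "\<not> ?thesis"
    define m where "m = measure M (space M) + measure N (space N) + 1"
    let ?d = "\<bar>(\<integral>x. \<phi> x \<partial>M) - (\<integral>x. \<phi> x \<partial>N)\<bar>"
    \<comment> \<open>The two approximations together cost at most \<open>e * m\<close>, half of the
      supposed difference. The \<open>+ 1\<close> in \<open>m\<close> avoids division by 0.\<close>
    define e where "e = ?d / (2 * m)"
    have m: "0 < m" unfolding m_def by (simp add: add_nonneg_pos)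
    then have e: "0 < e" unfolding e_def using ne by simp
    obtain r where r: "real_trig_poly r" "\<And>x. x \<in> ?T \<Longrightarrow> \<bar>\<phi> x - r x\<bar> < e"
      using ring.Stone_Weierstrass_basic[OF continuous_on_subset[OF \<phi>(1) subset_UNIV] e] by auto
    then obtain p where p: "trig_poly p" "\<And>x. x \<in> ?T \<Longrightarrow> p x = complex_of_real (r x)"
      unfolding real_trig_poly_def by blast
    have close: "\<bar>\<phi> x - Re (p x)\<bar> \<le> e" if "x \<in> ?T" for x using r(2)[OF that] p(2)[OF that] by simp
    have "?d \<le> e * measure M (space M) + e * measure N (space N)"
      using approx[OF M p(1) \<phi>(2) close] approx[OF N p(1) \<phi>(3) close] trig_eq[OF p(1)] by simp
    also have "\<dots> \<le> e * m" unfolding m_def using e by (simp add: distrib_left)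
    also have "\<dots> = ?d / 2" unfolding e_def using m by simp
    finally show False using ne by simp
  qed
  have closed_eq: "emeasure M C = emeasure N C" if C: "closed C" for C
  proof (cases "C = {}")
    case False
    define \<phi> where "\<phi> n x = max 0 (1 - real n * infdist x C)" for n and x :: "nat \<Rightarrow> complex"
    have bound: "norm (\<phi> n x) \<le> 1" for n x unfolding \<phi>_def by (auto simp: infdist_nonneg)
    have cont: "continuous_on UNIV (\<phi> n)" for n
      unfolding \<phi>_def[abs_def] by (intro continuous_intros)
    have lim: "(\<lambda>n. \<phi> n x) \<longlonglongrightarrow> indicator C x" for x
    proof (cases "x \<in> C")
      case True
      then show ?thesis unfolding \<phi>_def by simp
    next
      case False
      then have "infdist x C \<noteq> 0" using in_closed_iff_infdist_zero[OF C \<open>C \<noteq> {}\<close>] by blast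
      then have pos: "0 < infdist x C" using infdist_nonneg[of x C] by simp
      obtain k where k: "1 / infdist x C < real k" using reals_Archimedean2 by blast
      have "\<phi> n x = 0" if "k \<le> n" for n
      proof -
        have "1 \<le> real k * infdist x C" using k pos by (simp add: field_simps)
        also have "\<dots> \<le> real n * infdist x C" using that pos by (intro mult_right_mono) auto
        finally show ?thesis unfolding \<phi>_def by simp
      qed
      then have "\<forall>\<^sub>F n in sequentially. \<phi> n x = indicator C x"
        using False by (auto simp: eventually_sequentially)
      then show ?thesis by (rule tendsto_eventually)
    qed
    have int: "integrable P (\<phi> n)" and conv: "(\<lambda>n. \<integral>x. \<phi> n x \<partial>P) \<longlonglongrightarrow> measure P C"
      if P: "finite_measure P" "sets P = sets borel" for P n
    proof -
      interpret finite_measure P by fact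
      have meas: "\<phi> n \<in> borel_measurable P" for n
        using borel_measurable_continuous_onI[OF cont] measurable_cong_sets[OF P(2) refl] by blast
      show "integrable P (\<phi> n)" by (rule integrable_const_bound[of _ 1]) (use bound meas in auto)
      have C_P: "C \<in> sets P" using C P(2) by simp
      have "(\<lambda>n. \<integral>x. \<phi> n x \<partial>P) \<longlonglongrightarrow> (\<integral>x. indicator C x \<partial>P)"
        by (rule integral_dominated_convergence[where w = "\<lambda>_. 1"]) (use meas C_P lim bound in auto)
      then show "(\<lambda>n. \<integral>x. \<phi> n x \<partial>P) \<longlonglongrightarrow> measure P C"
        using C_P sets.sets_into_space by (simp add: Int_absorb2)
    qed
    have "measure M C = measure N C"
      using LIMSEQ_unique[OF conv[OF M(1,2)]] conv[OF N(1,2)] cont_eq[OF cont int[OF M(1,2)] int[OF N(1,2)]] by simp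
    then show ?thesis
      using finite_measure.emeasure_eq_measure[OF M(1)] finite_measure.emeasure_eq_measure[OF N(1)] by simp
  qed simp
  show ?thesis
  proof (rule measure_eqI_generator_eq[where E = "Collect closed" and A = "\<lambda>_. UNIV" and \<Omega> = UNIV])
    show "Int_stable (Collect closed :: (nat \<Rightarrow> complex) set set)" by (auto simp: Int_stable_def)
    show "emeasure M UNIV \<noteq> \<infinity>" for i :: nat
      using finite_measure.emeasure_finite[OF M(1), of UNIV] by simp
    have b: "sets (borel :: (nat \<Rightarrow> complex) measure) = sigma_sets UNIV (Collect closed)"
      by (simp add: borel_eq_closed)
    show "sets M = sigma_sets UNIV (Collect closed)" "sets N = sigma_sets UNIV (Collect closed)"
      using M(2) N(2) b by auto
  qed (use closed_eq in auto)
qed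

text \<open>Coordinates are renumbered by \<open>nat\<close>. The push-forward loses nothing: since
  \<open>\<Psi>\<close> undoes \<open>\<Phi>\<close>, every measurable set is a preimage under
  \<open>\<Phi>\<close>.\<close>

lemma measure_eqI_fourier:
  fixes M N :: "('g \<Rightarrow> complex) measure"
  assumes cnt: "countable (UNIV :: 'g set)" "infinite (UNIV :: 'g set)" and X: "X \<subseteq> torus_pow"
    and M: "finite_measure M" "sets M = sets (restrict_space borel X)"
    and N: "finite_measure N" "sets N = sets (restrict_space borel X)"
    and eq: "\<And>h. h \<in> group_ring \<Longrightarrow> (\<integral>x. chi h x \<partial>M) = (\<integral>x. chi h x \<partial>N)"
  shows "M = N"
proof -
  define e :: "nat \<Rightarrow> 'g" where "e = from_nat_into UNIV"
  have e: "bij e" unfolding e_def using bij_betw_from_nat_into[OF cnt] .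
  define \<Phi> where "\<Phi> x = x \<circ> e" for x :: "'g \<Rightarrow> complex"
  define \<Psi> where "\<Psi> y = y \<circ> inv e" for y :: "nat \<Rightarrow> complex"
  have \<Psi>\<Phi>: "\<Psi> (\<Phi> x) = x" for x unfolding \<Phi>_def \<Psi>_def using e by (auto simp: bij_is_surj surj_f_inv_f)
  have \<Phi>_cont: "continuous_on UNIV \<Phi>" unfolding \<Phi>_def[abs_def] comp_def
    by (intro continuous_on_coordinatewise_then_product continuous_on_product_coordinates)
  have \<Psi>_cont: "continuous_on UNIV \<Psi>" unfolding \<Psi>_def[abs_def] comp_def
    by (intro continuous_on_coordinatewise_then_product continuous_on_product_coordinates)
  have \<Phi>_meas: "\<Phi> \<in> measurable P borel" if "sets P = sets (restrict_space borel X)" for P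
    using measurable_restrict_space1[OF borel_measurable_continuous_onI[OF \<Phi>_cont], of X]
      measurable_cong_sets[OF that refl] by blast
  have space: "space P = X" if "sets P = sets (restrict_space borel X)" for P
    using sets_eq_imp_space_eq[OF that] by (simp add: space_restrict_space)
  have int: "(\<integral>y. chi h y \<partial>distr P borel \<Phi>) = (\<integral>x. chi (h \<circ> inv e) x \<partial>P)"
    if "sets P = sets (restrict_space borel X)" for P h
    by (subst integral_distr[OF \<Phi>_meas[OF that] measurable_chi]) (simp add: \<Phi>_def chi_reindex[OF e])
  have torus: "AE y in distr P borel \<Phi>. y \<in> torus_pow" if "sets P = sets (restrict_space borel X)" for P
  proof (subst AE_distr_iff[OF \<Phi>_meas[OF that]])
    show "{y \<in> space borel. y \<in> torus_pow} \<in> sets (borel :: (nat \<Rightarrow> complex) measure)"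
      by (simp add: borel_compact[OF compact_torus_pow])
    show "AE x in P. \<Phi> x \<in> torus_pow"
      by (rule AE_I2) (use X space[OF that] in \<open>auto simp: \<Phi>_def torus_pow_def\<close>)
  qed
  have gr: "h \<circ> inv e \<in> group_ring" if "h \<in> group_ring" for h :: "nat \<Rightarrow> int"
  proof -
    have "{g. (h \<circ> inv e) g \<noteq> 0} \<subseteq> e ` {n. h n \<noteq> 0}"
      using e by (auto simp: image_iff) (metis bij_is_surj surj_f_inv_f)
    then show ?thesis using that unfolding group_ring_def by (auto intro: finite_subset)
  qed
  have D: "distr M borel \<Phi> = distr N borel \<Phi>"
  proof (rule measure_eqI_fourier_nat)
    show "finite_measure (distr M borel \<Phi>)" "finite_measure (distr N borel \<Phi>)"
      using finite_measure.finite_measure_distr[OF M(1) \<Phi>_meas[OF M(2)]]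
        finite_measure.finite_measure_distr[OF N(1) \<Phi>_meas[OF N(2)]] by auto
  qed (use torus M(2) N(2) int eq gr in auto)
  show ?thesis
  proof (rule measure_eqI)
    show "sets M = sets N" using M N by simp
    fix A assume "A \<in> sets M"
    then obtain B where B: "B \<in> sets borel" "A = X \<inter> B" using M(2) by (auto simp: sets_restrict_space)
    have \<Psi>B: "\<Psi> -` B \<in> sets borel"
      using measurable_sets[OF borel_measurable_continuous_onI[OF \<Psi>_cont] B(1)] by simp
    have "emeasure P A = emeasure (distr P borel \<Phi>) (\<Psi> -` B)" if "sets P = sets (restrict_space borel X)" for P
    proof -
      have "\<Phi> -` (\<Psi> -` B) \<inter> space P = A" using B space[OF that] \<Psi>\<Phi> by auto
      then show ?thesis using emeasure_distr[OF \<Phi>_meas[OF that] \<Psi>B] by simp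
    qed
    then show "emeasure M A = emeasure N A" using D M(2) N(2) by simp
  qed
qed

section \<open>Ergodicity\<close>

lemma lshift_lshift: "lshift a (lshift b x) = lshift (a + b) x"
  by (rule ext) (simp add: lshift_def minus_add add.assoc del: add_uminus_conv_diff)

lemma lshift_0: "lshift 0 x = x"
  by (rule ext) (simp add: lshift_def)

lemma lshift_X_f:
  assumes "x \<in> X_f f"
  shows "lshift a x \<in> X_f f"
proof -
  have "(\<lambda>g. f (- b + (a + g))) = (\<lambda>g. f (- (- a + b) + g))" for b
    by (simp add: minus_add add.assoc del: add_uminus_conv_diff)
  then have "rho f (lshift a x) b = rho f x (- a + b)" for b
    unfolding rho_eq_chi chi_lshift by simp
  then show ?thesis using assms unfolding X_f_def torus_pow_def by (simp add: lshift_def)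
qed

lemma mult_X_f: "x \<in> X_f f \<Longrightarrow> y \<in> X_f f \<Longrightarrow> (\<lambda>g. x g * y g) \<in> X_f f"
  unfolding X_f_def torus_pow_def rho_eq_chi by (auto simp: chi_mult norm_mult)

lemma cnj_X_f: "x \<in> X_f f \<Longrightarrow> (\<lambda>g. cnj (x g)) \<in> X_f f"
  unfolding X_f_def torus_pow_def rho_eq_chi by (auto simp: chi_cnj)

locale haar_X_f =
  fixes f :: "'g::group_add \<Rightarrow> int" and M :: "('g \<Rightarrow> complex) measure"
  assumes cnt: "countable (UNIV :: 'g set)" "infinite (UNIV :: 'g set)"
    and f: "f \<in> group_ring" and haar: "normalized_haar (X_f f) M"
begin

abbreviation "X \<equiv> X_f f"

lemma space_M: "space M = X" and sets_M: "sets M = sets (restrict_space borel X)"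
  and prob_M: "prob_space M"
  and invariant: "y \<in> X \<Longrightarrow> A \<in> sets M \<Longrightarrow> emeasure M ((\<lambda>x. \<lambda>g. x g * y g) ` A) = emeasure M A"
  using haar unfolding normalized_haar_def by auto

sublocale prob_space M by (rule prob_M)

lemma X_torus: "X \<subseteq> torus_pow"
  unfolding X_f_def by blast

lemma measurable_M: "g \<in> measurable borel N \<Longrightarrow> g \<in> measurable M N"
  using measurable_restrict_space1[of g borel N X] measurable_cong_sets[OF sets_M refl] by blast

lemma measurable_M_M:
  assumes "continuous_on UNIV \<theta>" "\<And>x. x \<in> X \<Longrightarrow> \<theta> x \<in> X"
  shows "\<theta> \<in> measurable M M"
proof -
  have "\<theta> \<in> measurable (restrict_space borel X) (restrict_space borel X)"
    by (rule measurable_restrict_space3) (use assms borel_measurable_continuous_onI in auto)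
  then show ?thesis using measurable_cong_sets[OF sets_M sets_M] by blast
qed

lemma measurable_chi_M: "chi h \<in> borel_measurable M"
  by (rule measurable_M[OF measurable_chi])

lemma integrable_chi: "integrable M (chi h)"
proof (rule integrable_const_bound[of _ 1])
  show "AE x in M. norm (chi h x) \<le> 1"
    by (rule AE_I2) (use space_M X_torus in \<open>auto simp: subset_iff norm_chi\<close>)
qed (rule measurable_chi_M)

lemma measurable_lshift: "lshift a \<in> measurable M M"
proof (rule measurable_M_M)
  show "continuous_on UNIV (lshift a :: ('g \<Rightarrow> complex) \<Rightarrow> _)"
    unfolding lshift_def[abs_def]
    by (intro continuous_on_coordinatewise_then_product continuous_on_product_coordinates)
qed (rule lshift_X_f)

text \<open>Invariance is given for images. The preimage of a set under multiplication by
  \<open>y\<close> is its image under multiplication by the conjugate of \<open>y\<close>, which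
  again lies in \<open>X\<close>.\<close>

lemma integral_chi_translate:
  assumes y: "y \<in> X"
  shows "(\<integral>x. chi h x \<partial>M) = (\<integral>x. chi h x \<partial>M) * chi h y"
proof -
  let ?t = "\<lambda>y x. \<lambda>g. x g * y g :: complex"
  have t: "?t y \<in> measurable M M" if "y \<in> X" for y
  proof (rule measurable_M_M)
    show "continuous_on UNIV (?t y)"
      by (intro continuous_on_coordinatewise_then_product continuous_intros continuous_on_product_coordinates)
  qed (use that mult_X_f in auto)
  let ?y = "\<lambda>g. cnj (y g)"
  have inv: "y g * cnj (y g) = 1" for g
    using y X_torus unfolding torus_pow_def by (auto simp flip: complex_norm_square)
  have "distr M M (?t y) = M"
  proof (rule measure_eqI)
    fix A assume "A \<in> sets (distr M M (?t y))"
    then have A: "A \<in> sets M" by simp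
    have "?t y -` A \<inter> space M = ?t ?y ` A"
    proof (intro equalityI subsetI)
      fix x assume "x \<in> ?t y -` A \<inter> space M"
      then have "?t y x \<in> A" by blast
      moreover have "x = ?t ?y (?t y x)" using inv by (simp add: mult.assoc)
      ultimately show "x \<in> ?t ?y ` A" by (intro image_eqI[where x = "?t y x"])
    next
      fix x assume "x \<in> ?t ?y ` A"
      then obtain z where z: "z \<in> A" "x = ?t ?y z" by blast
      then have "z \<in> X" using A sets.sets_into_space space_M by blast
      then have "x \<in> X" unfolding z(2) by (rule mult_X_f[OF _ cnj_X_f[OF y]])
      moreover have "?t y x = z" unfolding z(2) using inv by (simp add: mult.assoc mult.commute[of "cnj _"])
      ultimately show "x \<in> ?t y -` A \<inter> space M" using z(1) space_M by simp
    qed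
    then show "emeasure (distr M M (?t y)) A = emeasure M A"
      using emeasure_distr[OF t[OF y] A] invariant[OF cnj_X_f[OF y] A] by simp
  qed simp
  then have "(\<integral>x. chi h x \<partial>M) = (\<integral>x. chi h x \<partial>distr M M (?t y))" by simp
  also have "\<dots> = (\<integral>x. chi h x * chi h y \<partial>M)"
    by (subst integral_distr[OF t[OF y] measurable_chi_M]) (simp add: chi_mult)
  finally show ?thesis by simp
qed

definition trivial :: "('g \<Rightarrow> int) \<Rightarrow> bool" where
  "trivial h \<longleftrightarrow> (\<forall>x\<in>X. chi h x = 1)"

lemma integral_chi: "(\<integral>x. chi h x \<partial>M) = of_bool (trivial h)"
proof (cases "trivial h")
  case True
  then have "(\<integral>x. chi h x \<partial>M) = (\<integral>x. 1 \<partial>M)"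
    unfolding trivial_def by (intro Bochner_Integration.integral_cong) (auto simp: space_M)
  then show ?thesis using True prob_space by simp
next
  case False
  then obtain y where "y \<in> X" "chi h y \<noteq> 1" unfolding trivial_def by blast
  then show ?thesis using integral_chi_translate[of y h] False by simp
qed

lemma measure_eqI_X:
  assumes "finite_measure N" "sets N = sets M" "finite_measure N'" "sets N' = sets M"
    and "\<And>h. h \<in> group_ring \<Longrightarrow> (\<integral>x. chi h x \<partial>N) = (\<integral>x. chi h x \<partial>N')"
  shows "N = N'"
  by (rule measure_eqI_fourier[OF cnt X_torus]) (use assms sets_M in auto)

text \<open>The Fourier coefficients of \<open>M\<close> record only which characters are trivial on
  \<open>X\<close>, and the shift preserves triviality because it maps \<open>X\<close> onto
  itself.\<close>

lemma distr_lshift: "distr M M (lshift a) = M"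
proof (rule measure_eqI_X)
  show "finite_measure (distr M M (lshift a))" by (rule finite_measure_distr[OF measurable_lshift])
  show "finite_measure M" by unfold_locales
  fix h :: "'g \<Rightarrow> int"
  have "(\<integral>x. chi h x \<partial>distr M M (lshift a)) = (\<integral>x. chi (\<lambda>g. h (a + g)) x \<partial>M)"
    by (subst integral_distr[OF measurable_lshift measurable_chi_M]) (simp add: chi_lshift)
  moreover have "trivial (\<lambda>g. h (a + g)) \<longleftrightarrow> trivial h"
  proof
    assume *: "trivial (\<lambda>g. h (a + g))"
    show "trivial h" unfolding trivial_def
    proof
      fix x assume "x \<in> X"
      then have "chi h (lshift a (lshift (- a) x)) = 1"
        using * lshift_X_f unfolding trivial_def chi_lshift[symmetric] by blast
      then show "chi h x = 1" by (simp add: lshift_lshift lshift_0)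
    qed
  next
    assume "trivial h"
    then show "trivial (\<lambda>g. h (a + g))"
      unfolding trivial_def chi_lshift[symmetric] using lshift_X_f by blast
  qed
  ultimately show "(\<integral>x. chi h x \<partial>distr M M (lshift a)) = (\<integral>x. chi h x \<partial>M)"
    by (simp add: integral_chi)
qed simp_all

text \<open>Written without conjugation, this is the usual Fourier coefficient of the indicator at
  \<open>- h\<close>.\<close>

definition coeff :: "('g \<Rightarrow> complex) set \<Rightarrow> ('g \<Rightarrow> int) \<Rightarrow> complex" where
  "coeff A h = (\<integral>x. indicator A x * chi h x \<partial>M)"

lemma coeff_lshift:
  assumes A: "A \<in> sets M" "\<And>a. lshift a ` A = A"
  shows "coeff A (\<lambda>g. h (a + g)) = coeff A h"
proof -
  have mem: "lshift a x \<in> A \<longleftrightarrow> x \<in> A" for x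
  proof
    assume "lshift a x \<in> A"
    then have "lshift (- a) (lshift a x) \<in> A" using A(2)[of "- a"] by blast
    then show "x \<in> A" by (simp add: lshift_lshift lshift_0)
  qed (use A(2)[of a] in blast)
  have "coeff A h = (\<integral>x. indicator A x * chi h x \<partial>distr M M (lshift a))"
    unfolding coeff_def distr_lshift ..
  also have "\<dots> = (\<integral>x. indicator A (lshift a x) * chi h (lshift a x) \<partial>M)"
    by (rule integral_distr[OF measurable_lshift]) (use A(1) measurable_chi_M in measurable)
  finally show ?thesis unfolding coeff_def chi_lshift by (simp add: indicator_def mem)
qed

lemma
  assumes A: "A \<in> sets M"
  shows integrable_indicator_complex: "integrable M (\<lambda>x. indicator A x :: complex)"
    and integral_indicator_complex: "(\<integral>x. indicator A x \<partial>M) = complex_of_real (measure M A)"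
proof -
  have eq: "(indicator A x :: complex) = complex_of_real (indicator A x)" for x
    by (simp add: indicator_def)
  show "integrable M (\<lambda>x. indicator A x :: complex)"
    unfolding eq using A by (simp add: emeasure_eq_measure)
  show "(\<integral>x. indicator A x \<partial>M) = complex_of_real (measure M A)"
    unfolding eq using A sets.sets_into_space[OF A] by (simp add: Int_absorb2)
qed

text \<open>Obtained by integrating the squared distance of the indicator from its projection onto
  the span of the characters. The factor is \<open>cnj z\<close> because \<open>coeff\<close>
  carries no conjugation.\<close>

lemma bessel:
  assumes A: "A \<in> sets M" and I: "finite I" "I \<subseteq> group_ring"
    and dist: "\<And>h k. h \<in> I \<Longrightarrow> k \<in> I \<Longrightarrow> h \<noteq> k \<Longrightarrow> \<not> trivial (h - k)"
    and coeff: "\<And>h. h \<in> I \<Longrightarrow> coeff A h = z"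
  shows "real (card I) * (cmod z)\<^sup>2 \<le> 1"
proof -
  define \<phi> where "\<phi> x = (\<Sum>h\<in>I. chi h x)" for x
  let ?A = "\<lambda>x. indicator A x :: complex"
  let ?n = "of_nat (card I) :: complex"
  have Aint: "integrable M (\<lambda>x. ?A x * chi h x)" for h
  proof (rule integrable_const_bound[of _ 1])
    show "AE x in M. norm (?A x * chi h x) \<le> 1"
      by (rule AE_I2) (use space_M X_torus in \<open>auto simp: norm_mult indicator_def subset_iff norm_chi\<close>)
  qed (use A measurable_chi_M in measurable)
  have cnj_chi: "cnj (chi h x) = chi (- h) x" if "x \<in> X" for h x
    using chi_uminus[of x h] that X_torus by auto
  have 1: "integrable M (\<lambda>x. ?A x * \<phi> x)" "(\<integral>x. ?A x * \<phi> x \<partial>M) = ?n * z"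
    using Aint coeff unfolding \<phi>_def coeff_def by (auto simp: sum_distrib_left)
  have 2: "integrable M (\<lambda>x. cnj (?A x * \<phi> x))" "(\<integral>x. cnj (?A x * \<phi> x) \<partial>M) = ?n * cnj z"
  proof -
    show "integrable M (\<lambda>x. cnj (?A x * \<phi> x))" using 1(1) by (simp only: complex_integrable_cnj)
    show "(\<integral>x. cnj (?A x * \<phi> x) \<partial>M) = ?n * cnj z" by (simp only: Bochner_Integration.integral_cnj 1(2)) simp
  qed
  have \<phi>\<phi>: "\<phi> x * cnj (\<phi> x) = (\<Sum>h\<in>I. \<Sum>k\<in>I. chi (h - k) x)" if x: "x \<in> X" for x
  proof -
    have "chi h x * cnj (chi k x) = chi (h - k) x" if "h \<in> I" "k \<in> I" for h k
      using chi_add[of h "- k" x] that I(2) group_ring_uminus[of k] x X_torus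
      by (auto simp: cnj_chi subset_iff)
    then show ?thesis unfolding \<phi>_def by (simp add: sum_product)
  qed
  have int3: "integrable M (\<lambda>x. \<Sum>h\<in>I. \<Sum>k\<in>I. chi (h - k) x)" using integrable_chi by auto
  have 3: "integrable M (\<lambda>x. \<phi> x * cnj (\<phi> x))"
    by (subst Bochner_Integration.integrable_cong[OF refl \<phi>\<phi>]) (use space_M int3 in auto)
  have "(\<integral>x. \<phi> x * cnj (\<phi> x) \<partial>M) = (\<integral>x. (\<Sum>h\<in>I. \<Sum>k\<in>I. chi (h - k) x) \<partial>M)"
    by (rule Bochner_Integration.integral_cong) (use space_M \<phi>\<phi> in auto)
  also have "\<dots> = (\<Sum>h\<in>I. \<Sum>k\<in>I. of_bool (trivial (h - k)))"
    using integrable_chi by (simp add: integral_chi)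
  also have "\<dots> = (\<Sum>h\<in>I. \<Sum>k\<in>I. if k = h then 1 else 0)"
  proof (intro sum.cong refl)
    fix h k assume "h \<in> I" "k \<in> I"
    moreover have "trivial (h - h)" unfolding trivial_def by simp
    ultimately show "of_bool (trivial (h - k)) = (if k = h then 1 else (0::complex))" using dist[of h k] by auto
  qed
  also have "\<dots> = ?n" using I(1) by simp
  finally have norm_\<phi>: "(\<integral>x. \<phi> x * cnj (\<phi> x) \<partial>M) = ?n" .
  let ?d = "\<lambda>x. ?A x - cnj z * \<phi> x"
  have expand: "complex_of_real ((cmod (?d x))\<^sup>2) =
      ?A x - cnj z * (?A x * \<phi> x) - z * cnj (?A x * \<phi> x) + z * cnj z * (\<phi> x * cnj (\<phi> x))" for x
    unfolding complex_norm_square by (auto simp: indicator_def algebra_simps)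
  note A0 = integrable_indicator_complex[OF A] integral_indicator_complex[OF A]
  have "complex_of_real (\<integral>x. (cmod (?d x))\<^sup>2 \<partial>M) = (\<integral>x. complex_of_real ((cmod (?d x))\<^sup>2) \<partial>M)"
    by (rule integral_complex_of_real[symmetric])
  also have "\<dots> = complex_of_real (measure M A) - cnj z * (?n * z) - z * (?n * cnj z) + z * cnj z * ?n"
    unfolding expand using A0 1 2 3 norm_\<phi> by simp
  also have "\<dots> = complex_of_real (measure M A - real (card I) * (cmod z)\<^sup>2)"
    using complex_norm_square[of z] by (simp add: algebra_simps)
  finally have "(\<integral>x. (cmod (?d x))\<^sup>2 \<partial>M) = measure M A - real (card I) * (cmod z)\<^sup>2"
    by (simp only: of_real_eq_iff)
  moreover have "0 \<le> (\<integral>x. (cmod (?d x))\<^sup>2 \<partial>M)" by (rule integral_nonneg_AE) simp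
  ultimately show ?thesis using prob_le_1[of A] by linarith
qed

text \<open>By duality, restricting characters to \<open>X\<close> identifies elements of the group
  ring that differ by a left multiple of \<open>f\<close>, so the orbit is that of the class of
  \<open>h\<close>. Triviality of \<open>h\<close> is then divisibility by \<open>f\<close>.\<close>

lemma trivial_if_finite_orbit:
  assumes inj: "\<forall>v\<in>ell2. (\<forall>g. conv v f g = 0) \<longrightarrow> v = (\<lambda>_. 0)"
    and nvc: "\<not> virtually_cyclic TYPE('g)" and h: "h \<in> group_ring"
    and orbit: "finite (range (\<lambda>a. \<lambda>x\<in>X. chi h (lshift a x)))"
  shows "trivial h"
proof -
  define L where "L = {a. \<forall>x\<in>X. chi h (lshift a x) = chi h x}"
  let ?\<kappa> = "\<lambda>a. \<lambda>x\<in>X. chi h (lshift a x)"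
  have L: "add_subgroup L" unfolding add_subgroup_def
  proof (intro conjI ballI)
    show "0 \<in> L" unfolding L_def by (simp add: lshift_0)
    fix a assume a: "a \<in> L"
    show "- a \<in> L" unfolding L_def
    proof safe
      fix x assume x: "x \<in> X"
      then have "chi h (lshift a (lshift (- a) x)) = chi h (lshift (- a) x)"
        using a lshift_X_f unfolding L_def by blast
      then show "chi h (lshift (- a) x) = chi h x" by (simp add: lshift_lshift lshift_0)
    qed
    fix b assume "b \<in> L"
    then show "a + b \<in> L" using a unfolding L_def by (simp add: lshift_X_f flip: lshift_lshift)
  qed
  note LD = add_subgroupD[OF L]
  have same: "a - b \<in> L" if "?\<kappa> a = ?\<kappa> b" for a b
    unfolding L_def
  proof safe
    fix x assume "x \<in> X"
    then have "chi h (lshift a (lshift (- b) x)) = chi h (lshift b (lshift (- b) x))"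
      using fun_cong[OF that, of "lshift (- b) x"] lshift_X_f[of x f "- b"] by simp
    then show "chi h (lshift (a - b) x) = chi h x" by (simp add: lshift_lshift lshift_0)
  qed
  obtain R0 where R0: "finite R0" "range ?\<kappa> = ?\<kappa> ` R0"
    using finite_subset_image[OF orbit subset_refl] by auto
  \<comment> \<open>Orbit points correspond to cosets \<open>L + r\<close>; negated representatives
    give the cosets \<open>r + L\<close> that the divisibility theorem expects.\<close>
  define R where "R = uminus ` R0"
  have R: "\<exists>r\<in>R. - r + g \<in> L" for g
  proof -
    have "?\<kappa> (- g) \<in> ?\<kappa> ` R0" using R0(2) by blast
    then obtain r where r: "r \<in> R0" "?\<kappa> (- g) = ?\<kappa> r" by blast
    then have "- (- g - r) \<in> L" using same LD(3) by blast
    then show ?thesis unfolding R_def using r(1) by auto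
  qed
  have finR: "finite R" unfolding R_def using R0 by simp
  have infL: "infinite L"
  proof
    assume "finite L"
    have "UNIV \<subseteq> (\<lambda>(r, l). r + l) ` (R \<times> L)"
    proof
      fix g
      obtain r where "r \<in> R" "- r + g \<in> L" using R by blast
      then show "g \<in> (\<lambda>(r, l). r + l) ` (R \<times> L)" by (intro image_eqI[of _ _ "(r, - r + g)"]) auto
    qed
    then show False using cnt(2) finR \<open>finite L\<close> by (meson finite_SigmaI finite_imageI finite_subset)
  qed
  \<comment> \<open>An element of the stabilizer changes \<open>h\<close> by something trivial on
    \<open>X\<close>, hence by a left multiple of \<open>f\<close>; the multiplier becomes the
    cocycle.\<close>
  have "\<exists>w\<in>group_ring. \<forall>x. conv (\<lambda>y. real_of_int (w y)) f x = of_int (h (- a + x) - h x)" if a: "a \<in> L" for a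
  proof -
    let ?k = "(\<lambda>g. h (- a + g)) + - h"
    have k: "(\<lambda>g. h (- a + g)) \<in> group_ring" "- h \<in> group_ring"
      using group_ring_translate group_ring_uminus h by auto
    have "?k \<in> left_multiples f"
    proof (rule trivial_on_X_f[OF f group_ring_add[OF k]])
      fix x assume x: "x \<in> X"
      then have xT: "x \<in> torus_pow" using X_torus by blast
      have "chi h (lshift (- a) x) = chi h x" using LD(3)[OF a] x unfolding L_def by blast
      then show "chi ?k x = 1"
        using chi_add[OF k xT] chi_uminus[OF xT, of h] norm_chi[OF xT, of h]
        by (simp add: chi_lshift flip: complex_norm_square)
    qed
    then show ?thesis unfolding left_multiples_def by simp
  qed
  then have "\<forall>a\<in>L. \<exists>w. w \<in> group_ring \<and> (\<forall>x. conv (\<lambda>y. real_of_int (w y)) f x = of_int (h (- a + x) - h x))"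
    by blast
  from bchoice[OF this] obtain c where c: "\<forall>a\<in>L. c a \<in> group_ring \<and>
      (\<forall>x. conv (\<lambda>y. real_of_int (c a y)) f x = of_int (h (- a + x) - h x))" by blast
  interpret translation_cocycle f h L c
    by unfold_locales (use f h inj L infL c in auto)
  have "h \<in> left_multiples f"
    unfolding left_multiples_def using divides[OF finR R nvc] h by blast
  then show ?thesis unfolding trivial_def using left_multiples_trivial[OF f] by blast
qed

text \<open>Invariance of \<open>A\<close> gives all translates of \<open>h\<close> the same
  coefficient. Infinitely many of them differ on \<open>X\<close>, so Bessel's inequality forces it
  to be 0.\<close>

lemma coeff_infinite_orbit:
  assumes A: "A \<in> sets M" "\<And>a. lshift a ` A = A" and h: "h \<in> group_ring"
    and orbit: "infinite (range (\<lambda>a. \<lambda>x\<in>X. chi h (lshift a x)))"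
  shows "coeff A h = 0"
proof (rule ccontr)
  assume nz: "coeff A h \<noteq> 0"
  let ?\<kappa> = "\<lambda>a. \<lambda>x\<in>X. chi h (lshift a x)"
  let ?h = "\<lambda>a. \<lambda>g. h (a + g)"
  obtain n where n: "1 < real n * (cmod (coeff A h))\<^sup>2" using nz reals_Archimedean3[of "(cmod (coeff A h))\<^sup>2"] by auto
  obtain F where F: "F \<subseteq> range ?\<kappa>" "finite F" "card F = n"
    using infinite_arbitrarily_large[OF orbit] by metis
  obtain R where R: "R \<subseteq> UNIV" "inj_on ?\<kappa> R" "F = ?\<kappa> ` R" 
    using iffD1[OF subset_image_inj F(1)] by (elim exE conjE)
  have kappa: "?\<kappa> a = (\<lambda>x\<in>X. chi (?h a) x)" for a by (simp add: chi_lshift)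
  have inj: "inj_on ?h R" by (rule inj_onI) (use R(2) in \<open>auto simp: kappa inj_on_def\<close>)
  have cardR: "card R = n" "finite R" using card_image[OF R(2)] F R(3) finite_image_iff[OF R(2)] by auto
  have "real (card (?h ` R)) * (cmod (coeff A h))\<^sup>2 \<le> 1"
  proof (rule bessel[OF A(1)])
    show "finite (?h ` R)" "?h ` R \<subseteq> group_ring" using cardR group_ring_translate[OF h] by auto
    show "coeff A k = coeff A h" if "k \<in> ?h ` R" for k using that coeff_lshift[OF A] by auto
    fix k l assume kl: "k \<in> ?h ` R" "l \<in> ?h ` R" "k \<noteq> l"
    show "\<not> trivial (k - l)"
    proof
      assume triv: "trivial (k - l)"
      have gr: "k \<in> group_ring" "l \<in> group_ring" using kl group_ring_translate[OF h] by auto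
      have "chi k x = chi l x" if x: "x \<in> X" for x
      proof -
        have xT: "x \<in> torus_pow" using x X_torus by blast
        have "chi ((k - l) + l) x = chi (k - l) x * chi l x"
          using chi_add[OF group_ring_add[OF gr(1) group_ring_uminus[OF gr(2)]] gr(2) xT] by simp
        then show ?thesis using triv x unfolding trivial_def by simp
      qed
      moreover obtain a b where ab: "a \<in> R" "b \<in> R" "k = ?h a" "l = ?h b" using kl by blast
      ultimately have "?\<kappa> a = ?\<kappa> b" unfolding kappa by (auto simp: restrict_def)
      then have "a = b" using R(2) ab by (auto dest: inj_onD)
      then show False using kl(3) ab by blast
    qed
  qed
  then show False using n card_image[OF inj] cardR by simp
qed

text \<open>For an invariant \<open>A\<close> of measure \<open>m\<close>, the restriction of
  \<open>M\<close> to \<open>A\<close> and the multiple of \<open>M\<close> by \<open>m\<close> have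
  the same Fourier coefficients, so they are the same measure. Evaluated at \<open>A\<close> this
  says \<open>m = m * m\<close>.\<close>

theorem ergodic:
  assumes inj: "\<forall>v\<in>ell2. (\<forall>g. conv v f g = 0) \<longrightarrow> v = (\<lambda>_. 0)"
    and nvc: "\<not> virtually_cyclic TYPE('g)"
  shows "ergodic_shift M"
  unfolding ergodic_shift_def
proof (intro conjI allI ballI impI)
  show "lshift g \<in> measurable M M" "distr M M (lshift g) = M" for g
    by (rule measurable_lshift, rule distr_lshift)
  fix A assume A: "A \<in> sets M" and "\<forall>g. lshift g ` A = A"
  then have inv: "\<And>g. lshift g ` A = A" by blast
  define m where "m = measure M A"
  define N where "N = density M (\<lambda>x. ennreal (indicator A x))"
  define N' where "N' = density M (\<lambda>x. ennreal m)"
  have m0: "0 \<le> m" unfolding m_def by simp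
  have meas: "(\<lambda>x. indicator A x :: real) \<in> borel_measurable M" using A by measurable
  have emN: "emeasure N B = emeasure M (A \<inter> B)" if "B \<in> sets M" for B
    unfolding N_def using that A
    by (subst emeasure_density) (auto simp: ennreal_indicator indicator_inter_arith[symmetric])
  have emN': "emeasure N' B = ennreal m * emeasure M B" if "B \<in> sets M" for B
    unfolding N'_def using that by (simp add: emeasure_density_const)
  have "N = N'"
  proof (rule measure_eqI_X)
    show "sets N = sets M" "sets N' = sets M" unfolding N_def N'_def by simp_all
    show "finite_measure N" "finite_measure N'"
      using emN[OF sets.top] emN'[OF sets.top]
      by (auto intro!: finite_measureI simp: N_def N'_def ennreal_mult_eq_top_iff)
    fix h :: "'g \<Rightarrow> int" assume h: "h \<in> group_ring"
    have "(\<integral>x. chi h x \<partial>N) = coeff A h"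
      unfolding N_def coeff_def by (subst integral_density[OF measurable_chi_M meas])
        (auto simp: scaleR_conv_of_real indicator_def intro!: Bochner_Integration.integral_cong)
    moreover have "(\<integral>x. chi h x \<partial>N') = m * of_bool (trivial h)"
      unfolding N'_def by (subst integral_density[OF measurable_chi_M])
        (auto simp: m0 scaleR_conv_of_real integral_chi)
    moreover have "coeff A h = m * of_bool (trivial h)"
    proof (cases "trivial h")
      case True
      have "coeff A h = (\<integral>x. indicator A x \<partial>M)"
        unfolding coeff_def using True
        by (intro Bochner_Integration.integral_cong) (auto simp: space_M trivial_def)
      then show ?thesis using True integral_indicator_complex[OF A] by (simp add: m_def)
    next
      case False
      then have "infinite (range (\<lambda>a. \<lambda>x\<in>X. chi h (lshift a x)))"
        using trivial_if_finite_orbit[OF inj nvc h] by blast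
      then show ?thesis using coeff_infinite_orbit[OF A inv h] False by simp
    qed
    ultimately show "(\<integral>x. chi h x \<partial>N) = (\<integral>x. chi h x \<partial>N')" by simp
  qed
  then have "emeasure M A = ennreal m * emeasure M A" using emN[OF A] emN'[OF A] by simp
  then have "ennreal m = ennreal (m * m)" using m0 by (simp add: m_def emeasure_eq_measure ennreal_mult)
  then have "m = m * m" using m0 by (simp del: ennreal_mult)
  then have "m = 0 \<or> m = 1" by simp
  then show "emeasure M A = 0 \<or> emeasure M A = 1" unfolding m_def by (auto simp: emeasure_eq_measure)
qed

end

theorem theorem1p3:
  fixes f :: "'g::group_add \<Rightarrow> int" and M :: "('g \<Rightarrow> complex) measure"
  assumes "countable (UNIV :: 'g set)" and "infinite (UNIV :: 'g set)"
    and "\<not> virtually_cyclic TYPE('g)"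
    and "f \<in> group_ring"
    and "\<forall>v\<in>ell2. (\<forall>g. conv v f g = 0) \<longrightarrow> v = (\<lambda>_. 0)"
    and "normalized_haar (X_f f) M"
  shows "ergodic_shift M"
proof -
  interpret haar_X_f f M by unfold_locales (use assms in auto)
  show ?thesis using ergodic assms(3,5) by blast
qed

end
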